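(* Let $\rho^1,\rho^2\in\mathbb{R}$ be constants with $\rho^2>\rho^1$. Suppose that $f_0:\mathbb{R}\to\mathbb{R}$ satisfies $\|f_0\|_{L^\infty(\mathbb{R})}<\infty$ and $\|\partial_x f_0\|_{L^\infty(\mathbb{R})}<1$. Then there exists a global in time weak solution $f$ of the Muskat contour equation with initial data $f_0$, that is, a function $f=f(x,t)$ such that, for any $T>0$ and every $\eta\in C_c^\infty([0,T)\times\mathbb{R})$, $$\int_0^T\!\int_{\mathbb{R}}\eta_t(x,t)f(x,t)\,dx\,dt+\int_{\mathbb{R}}\eta(x,0)f_0(x)\,dx=\int_0^T\!\int_{\mathbb{R}}\eta_x(x,t)\,\frac{\rho^2-\rho^1}{2\pi}\,PV\!\int_{\mathbb{R}}\arctan\left(\frac{f(x,t)-f(\alpha,t)}{x-\alpha}\right)d\alpha\,dx\,dt ,$$ and it satisfies, for any $T>0$, $$f(x,t)\in C([0,T]\times\mathbb{R})\cap L^\infty([0,T];W^{1,\infty}(\mathbb{R})).$$ In particular $f$ is Lipschitz continuous.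
   Context: The Muskat contour equation is $f_t(x,t)=\frac{\rho^2-\rho^1}{2\pi}\,PV\int_{\mathbb{R}}\frac{(\partial_x f(x,t)-\partial_x f(x-\alpha,t))\,\alpha}{\alpha^2+(f(x,t)-f(x-\alpha,t))^2}\,d\alpha$ with $f(x,0)=f_0(x)$, where $\rho^1,\rho^2$ are the densities of the two fluids and the fluid of density $\rho^2$ lies below the interface $\{(x,f(x,t))\}$; the displayed integral identity is its weak formulation. $PV$ denotes the principal value. Because $f(\cdot,t)$ is only assumed bounded, the nonlinear term has to be understood as a principal value for the integral of two functions, one in the Hardy space $\mathcal{H}^1$ and the other in $BMO$; concretely, the principal value at infinity is a limit taken after integrating against $\eta_x$, i.e. the right-hand side is $$\lim_{N\to\infty}\int_0^T\!\int_{\mathbb{R}}\eta_x(x,t)\,\frac{\rho^2-\rho^1}{2\pi}\int_{|x-\alpha|<N}\arctan\left(\frac{f(x,t)-f(\alpha,t)}{x-\alpha}\right)d\alpha\,dx\,dt .$$ *)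

theory Defs
  imports "HOL-Analysis.Analysis" "HOL-Probability.Essential_Supremum"
begin

(* Derivatives are taken within S, so at boundary points belonging to S (e.g. t = 0 in
   R x [0,T)) they are one-sided and values outside S are irrelevant.  Intended for convex S
   with nonempty interior, where the derivative within S is unique. *)
primrec Ck_on :: "nat \<Rightarrow> 'a::euclidean_space set \<Rightarrow> ('a \<Rightarrow> real) \<Rightarrow> bool" where
  "Ck_on 0 S f \<longleftrightarrow> continuous_on S f"
| "Ck_on (Suc k) S f \<longleftrightarrow>
     f differentiable_on S \<and> (\<forall>v. Ck_on k S (\<lambda>x. frechet_derivative f (at x within S) v))"

definition smooth_on :: "'a::euclidean_space set \<Rightarrow> ('a \<Rightarrow> real) \<Rightarrow> bool" where
  "smooth_on S f \<longleftrightarrow> (\<forall>k. Ck_on k S f)"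

definition Cc_infinity :: "'a::euclidean_space set \<Rightarrow> ('a \<Rightarrow> real) set" where
  "Cc_infinity S =
     {f. smooth_on S f \<and> (\<exists>K. compact K \<and> K \<subseteq> S \<and> (\<forall>p\<in>S - K. f p = 0))}"

definition Linf_norm :: "(real \<Rightarrow> real) \<Rightarrow> ereal" where
  "Linf_norm u = esssup lebesgue (\<lambda>x. ereal \<bar>u x\<bar>)"

definition locally_integrable :: "(real \<Rightarrow> real) \<Rightarrow> bool" where
  "locally_integrable u \<longleftrightarrow> (\<forall>K. compact K \<longrightarrow> set_integrable lebesgue K u)"

definition has_weak_deriv :: "(real \<Rightarrow> real) \<Rightarrow> (real \<Rightarrow> real) \<Rightarrow> bool" where
  "has_weak_deriv u v \<longleftrightarrow>
     locally_integrable u \<and> locally_integrable v \<and>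
     (\<forall>\<phi>\<in>Cc_infinity UNIV. (LINT x|lebesgue. u x * deriv \<phi> x) = - (LINT x|lebesgue. v x * \<phi> x))"

definition weakly_differentiable :: "(real \<Rightarrow> real) \<Rightarrow> bool" where
  "weakly_differentiable u \<longleftrightarrow> (\<exists>v. has_weak_deriv u v)"

(* Unique up to null sets, hence its L^infinity norm does not depend on the choice. *)
definition weak_deriv :: "(real \<Rightarrow> real) \<Rightarrow> real \<Rightarrow> real" where
  "weak_deriv u = (SOME v. has_weak_deriv u v)"

definition W1inf_norm :: "(real \<Rightarrow> real) \<Rightarrow> ereal" where
  "W1inf_norm u = Linf_norm u + Linf_norm (weak_deriv u)"

definition W1inf :: "(real \<Rightarrow> real) set" where
  "W1inf = {u. weakly_differentiable u \<and> W1inf_norm u < \<infinity>}"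

(* L^infinity([0,T]; W^{1,infinity}(R)).  Since W^{1,infinity} is not separable, measurability
   in t is not meant in the strong (Bochner) sense; we ask for joint measurability.  The
   finiteness of esssup includes measurability of the norm, as esssup is infinite otherwise. *)
definition Linf_W1inf :: "real \<Rightarrow> (real \<Rightarrow> real \<Rightarrow> real) set" where
  "Linf_W1inf T =
     {f. (\<lambda>(x, t). f x t) \<in> borel_measurable (lebesgue_on (UNIV \<times> {0..T})) \<and>
         (AE t in lebesgue_on {0..T}. (\<lambda>x. f x t) \<in> W1inf) \<and>
         esssup (lebesgue_on {0..T}) (\<lambda>t. W1inf_norm (\<lambda>x. f x t)) < \<infinity>}"

(* Here f x t is the height of the interface; only times t >= 0 matter.  The principal value
   at infinity is the limit of the truncations |x - a| < N, taken after testing against the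
   x-derivative of eta.  The integrand at a = x is 0 by the convention 0/0 = 0 (a null set). *)
definition muskat_weak_solution ::
  "real \<Rightarrow> real \<Rightarrow> (real \<Rightarrow> real) \<Rightarrow> (real \<Rightarrow> real \<Rightarrow> real) \<Rightarrow> bool" where
  "muskat_weak_solution \<rho>1 \<rho>2 f0 f \<longleftrightarrow>
     (\<forall>T>0. \<forall>\<eta>\<in>Cc_infinity (UNIV \<times> {0..<T}).
        ((\<lambda>N::real.
            LINT t:{0<..<T}|lebesgue. LINT x|lebesgue.
              deriv (\<lambda>y. \<eta> (y, t)) x *
              ((\<rho>2 - \<rho>1) / (2 * pi) *
               (LINT a:{a. \<bar>x - a\<bar> < N}|lebesgue. arctan ((f x t - f a t) / (x - a)))))
         \<longlongrightarrow>
           (LINT t:{0<..<T}|lebesgue. LINT x|lebesgue. deriv (\<lambda>s. \<eta> (x, s)) t * f x t)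
           + (LINT x|lebesgue. \<eta> (x, 0) * f0 x)) at_top)"

end

theory Submission
  imports Defs "HOL-Complex_Analysis.Great_Picard"
begin

text \<open>
With \<open>c = (\<rho>2 - \<rho>1) / (2 * pi)\<close>, which is positive, the equation reads \<open>f\<^sub>t = c * \<Phi>\<^sub>x\<close>, where \<open>\<Phi>
x\<close> is the integral over \<open>y\<close> of \<open>arctan ((f x - f y) / (x - y))\<close>, the angle under which the point
of the graph above \<open>y\<close> is seen from the point above \<open>x\<close>. Global existence rests on two maximum
principles. The supremum of \<open>\<bar>f\<bar>\<close> does not grow, and neither does that of the slope as long as
it is at most 1. For the latter one differentiates the equation. At a point of slope 1 the
observer moves along a line of slope 1, and the second derivative of the angle under which a
fixed point is seen is nonpositive if the secant has slope in \<open>[-1, 1]\<close>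
(\<open>arctan_second_difference\<close>).

The solution is constructed by an explicit difference scheme on the lattice of width \<open>h\<close> that
satisfies both maximum principles exactly (\<open>step_bound\<close>, \<open>step_slope_bound\<close>). Away from an
extremum the discrete inequalities hold up to errors proportional to the distance from the
extremal value. A small time step and an artificial viscosity absorb them. The amount of
viscosity is governed by the sum of \<open>1 / \<bar>i - j\<bar>\<close> over the window to which the integral is
truncated. This sum grows only logarithmically in the number of lattice points, so the viscosity
vanishes under refinement although the window exhausts the line.

The integral for \<open>\<Phi>\<close> diverges at infinity for a function that is merely bounded, but differences
of \<open>\<Phi>\<close> between two points of a bounded set converge, with tails of order \<open>1 / N\<close> outside a
window of radius \<open>N\<close> (\<open>far_flux_difference\<close>). This has two consequences. First, spatial averages
of the approximations move at a bounded rate, which together with the slope bound makes them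
equicontinuous in time (\<open>evolve_time_modulus\<close>), and a subsequence converges pointwise to a
continuous function. Second, a test function enters the weak formulation through its
\<open>x\<close>-derivative, which has mean 0 and sees only differences of \<open>\<Phi>\<close>. The part of the flux outside
the window of radius \<open>N\<close> thus contributes \<open>O(1 / N)\<close> uniformly in the mesh
(\<open>discrete_weak_form\<close>), the remaining part converges by dominated convergence, and letting \<open>N\<close>
tend to infinity in the end yields the principal value (\<open>scheme_limit_weak_solution\<close>).

Two links to Sobolev functions are needed. The weak derivative of the initial datum is tested
against smoothed trapezoids to bound the slopes of its cell averages (\<open>cell_average_slope\<close>).
Conversely, the limit is Lipschitz in space and has a weak derivative by the Radon-Nikodym
theorem; its norm is a supremum of countably many difference quotients and so depends measurably
on time (\<open>lipschitz_in_x_imp_Linf_W1inf\<close>).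
\<close>

section \<open>Smooth functions of one variable\<close>

text \<open>
Membership in \<open>smooth_on\<close> unfolds to iterated Frechet derivatives in all directions. On the line
a sequence of successive derivatives carries the same information and is much easier to
transform.
\<close>
definition smooth :: "(real \<Rightarrow> real) \<Rightarrow> bool" where
  "smooth f \<longleftrightarrow> (\<exists>D. D 0 = f \<and> (\<forall>n x. (D n has_real_derivative D (Suc n) x) (at x)))"

text \<open>
To show smoothness it suffices to name a family of functions that is closed under
differentiation; the family then supplies all the higher derivatives one after another.
\<close>
lemma smooth_coinduct:
  assumes "f \<in> \<F>" and step: "\<And>g. g \<in> \<F> \<Longrightarrow> \<exists>g'\<in>\<F>. \<forall>x. (g has_real_derivative g' x) (at x)"
  shows "smooth f"
proof -
  have "\<exists>D. D 0 = f \<and> (\<forall>n. D n \<in> \<F> \<and> (\<forall>x. (D n has_real_derivative D (Suc n) x) (at x)))"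
  proof -
    have "\<exists>D. \<forall>n. (D n \<in> \<F> \<and> (n = 0 \<longrightarrow> D n = f)) \<and> (\<forall>x. (D n has_real_derivative D (Suc n) x) (at x))"
      by (rule dependent_nat_choice) (use assms in auto)
    then show ?thesis by blast
  qed
  then show ?thesis unfolding smooth_def by blast
qed

lemma smooth_imp_smooth_on: "smooth_on UNIV f" if "smooth f"
proof -
  from that obtain D where D0: "D 0 = f" and D: "\<And>n x. (D n has_real_derivative D (Suc n) x) (at x)"
    unfolding smooth_def by blast
  \<comment> \<open>The scalar \<open>c\<close> and the index \<open>n\<close> must vary: differentiating in direction \<open>v\<close> turns \<open>c * D n\<close> into \<open>c * v * D (Suc n)\<close>.\<close>
  have "Ck_on k UNIV (\<lambda>x. c * D n x)" for k n and c :: real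
  proof (induction k arbitrary: n c)
    case 0
    have "continuous_on UNIV (D n)"
      using D by (meson DERIV_isCont continuous_at_imp_continuous_on)
    then show ?case by (simp add: continuous_on_mult_left)
  next
    case (Suc k)
    have der: "((\<lambda>x. c * D n x) has_derivative (\<lambda>v. c * D (Suc n) x * v)) (at x)" for x
    proof -
      have "((\<lambda>x. c * D n x) has_real_derivative c * D (Suc n) x) (at x)"
        by (rule DERIV_cmult[OF D])
      then show ?thesis by (simp add: has_field_derivative_def)
    qed
    have "frechet_derivative (\<lambda>x. c * D n x) (at x within UNIV) = (\<lambda>v. c * D (Suc n) x * v)" for x
      using frechet_derivative_at[OF der] by simp
    moreover have "Ck_on k UNIV (\<lambda>x. c * D (Suc n) x * v)" for v
      using Suc.IH[of "c * v" "Suc n"] by (simp add: mult_ac)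
    moreover have "(\<lambda>x. c * D n x) differentiable_on UNIV"
      using der unfolding differentiable_on_def differentiable_def by auto
    ultimately show ?case by simp
  qed
  from this[of _ 1 0] show ?thesis unfolding smooth_on_def D0 by simp
qed

lemma smooth_affine: "smooth (\<lambda>x. f (a * x + b))" if "smooth f"
proof -
  from that obtain D where D0: "D 0 = f" and D: "\<And>n x. (D n has_real_derivative D (Suc n) x) (at x)"
    unfolding smooth_def by blast
  have "((\<lambda>x. a ^ n * D n (a * x + b)) has_real_derivative a ^ Suc n * D (Suc n) (a * x + b)) (at x)" for n x
    by (rule derivative_eq_intros DERIV_chain2[OF D] refl | simp)+
  then show ?thesis unfolding smooth_def
    by (intro exI[of _ "\<lambda>n x. a ^ n * D n (a * x + b)"]) (simp add: D0)
qed

lemma smooth_add: "smooth (\<lambda>x. f x + g x)" if "smooth f" "smooth g"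
proof -
  from that obtain D E where D0: "D 0 = f" "E 0 = g"
    and D: "\<And>n x. (D n has_real_derivative D (Suc n) x) (at x)" "\<And>n x. (E n has_real_derivative E (Suc n) x) (at x)"
    unfolding smooth_def by blast
  show ?thesis unfolding smooth_def
    by (intro exI[of _ "\<lambda>n x. D n x + E n x"]) (auto simp: D0 intro!: DERIV_add D)
qed

lemma smooth_cmult: "smooth (\<lambda>x. c * f x)" if "smooth f"
proof -
  from that obtain D where D0: "D 0 = f" and D: "\<And>n x. (D n has_real_derivative D (Suc n) x) (at x)"
    unfolding smooth_def by blast
  show ?thesis unfolding smooth_def
    by (intro exI[of _ "\<lambda>n x. c * D n x"]) (auto simp: D0 intro!: DERIV_cmult D)
qed

lemma smooth_diff: "smooth (\<lambda>x. f x - g x)" if "smooth f" "smooth g"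
  using smooth_add[OF that(1) smooth_cmult[OF that(2), of "-1"]] by simp

lemma smooth_antiderivative: "smooth F" if "smooth f" "\<And>x. (F has_real_derivative f x) (at x)"
proof -
  from that obtain D where D0: "D 0 = f" and D: "\<And>n x. (D n has_real_derivative D (Suc n) x) (at x)"
    unfolding smooth_def by blast
  show ?thesis unfolding smooth_def
    by (intro exI[of _ "case_nat F D"]) (auto simp: D0 that(2) D split: nat.split)
qed

text \<open>
By the product rule the sums of products of derivatives are closed under differentiation, so the
binomial coefficients of the Leibniz formula never have to be computed.
\<close>
inductive_set prod_closure :: "(nat \<Rightarrow> real \<Rightarrow> real) \<Rightarrow> (nat \<Rightarrow> real \<Rightarrow> real) \<Rightarrow> (real \<Rightarrow> real) set"
  for D E where
  prod: "(\<lambda>x. D i x * E j x) \<in> prod_closure D E"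
| add: "f \<in> prod_closure D E \<Longrightarrow> g \<in> prod_closure D E \<Longrightarrow> (\<lambda>x. f x + g x) \<in> prod_closure D E"

lemma smooth_mult: "smooth (\<lambda>x. f x * g x)" if "smooth f" "smooth g"
proof -
  from that obtain D E where D0: "D 0 = f" "E 0 = g"
    and D: "\<And>n x. (D n has_real_derivative D (Suc n) x) (at x)" "\<And>n x. (E n has_real_derivative E (Suc n) x) (at x)"
    unfolding smooth_def by blast
  show ?thesis
  proof (rule smooth_coinduct)
    show "(\<lambda>x. f x * g x) \<in> prod_closure D E" using prod_closure.prod[of D 0 E 0] D0 by simp
    fix h assume "h \<in> prod_closure D E"
    then show "\<exists>h'\<in>prod_closure D E. \<forall>x. (h has_real_derivative h' x) (at x)"
    proof induction
      case (prod i j)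
      show ?case
        by (rule bexI[of _ "\<lambda>x. D (Suc i) x * E j x + D i x * E (Suc j) x"])
          (auto intro!: prod_closure.intros derivative_eq_intros D)
    next
      case (add f g)
      then obtain f' g' where "f' \<in> prod_closure D E" "g' \<in> prod_closure D E"
        "\<And>x. (f has_real_derivative f' x) (at x)" "\<And>x. (g has_real_derivative g' x) (at x)" by blast
      then show ?case
        by (intro bexI[of _ "\<lambda>x. f' x + g' x"]) (auto intro!: prod_closure.intros DERIV_add)
    qed
  qed
qed

text \<open>
The classical function \<open>exp (- 1 / x)\<close>, flat at 0, multiplied by a polynomial in \<open>1 / x\<close>: with
this factor the family is closed under differentiation.
\<close>
definition flat_exp :: "real poly \<Rightarrow> real \<Rightarrow> real" where
  "flat_exp p x = (if x > 0 then poly p (1 / x) * exp (- (1 / x)) else 0)"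

lemma poly_exp_decay: "((\<lambda>y. poly p y * exp (- y)) \<longlongrightarrow> 0) at_top" for p :: "real poly"
proof (induction p)
  case (pCons a p)
  have "((\<lambda>y::real. y * poly p y * exp (- y)) \<longlongrightarrow> 0) at_top" for p
  proof -
    have "((\<lambda>y. \<Sum>i\<le>degree p. coeff p i * (y ^ Suc i / exp y)) \<longlongrightarrow> (\<Sum>i\<le>degree p. coeff p i * 0)) at_top"
      by (intro tendsto_intros tendsto_power_div_exp_0)
    then show ?thesis
      by (simp add: poly_altdef sum_distrib_left sum_distrib_right exp_minus field_simps)
  qed
  moreover have "((\<lambda>y::real. a * exp (- y)) \<longlongrightarrow> a * 0) at_top"
    using tendsto_power_div_exp_0[of 0] by (intro tendsto_intros) (simp add: exp_minus field_simps)
  ultimately have "((\<lambda>y::real. a * exp (- y) + y * poly p y * exp (- y)) \<longlongrightarrow> a * 0 + 0) at_top"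
    by (intro tendsto_add)
  then show ?case by (simp add: algebra_simps)
qed simp

lemma DERIV_flat_exp:
  "(flat_exp p has_real_derivative flat_exp (monom 1 2 * (p - pderiv p)) x) (at x)"
proof -
  consider "x > 0" | "x < 0" | "x = 0" by linarith
  then show ?thesis
  proof cases
    case 1
    have "((\<lambda>x. poly p (1 / x) * exp (- (1 / x))) has_real_derivative
        flat_exp (monom 1 2 * (p - pderiv p)) x) (at x)"
      using 1 by (auto intro!: derivative_eq_intros DERIV_chain2[OF poly_DERIV]
        simp: flat_exp_def poly_monom field_simps power2_eq_square)
    then show ?thesis
      by (rule has_field_derivative_transform_within_open[where S = "{0<..}"])
        (use 1 in \<open>auto simp: flat_exp_def\<close>)
  next
    case 2
    have "((\<lambda>x. 0) has_real_derivative flat_exp (monom 1 2 * (p - pderiv p)) x) (at x)"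
      using 2 by (simp add: flat_exp_def)
    then show ?thesis
      by (rule has_field_derivative_transform_within_open[where S = "{..<0}"])
        (use 2 in \<open>auto simp: flat_exp_def\<close>)
  next
    case 3
    have "((\<lambda>y. poly (pCons 0 p) y * exp (- y)) \<longlongrightarrow> 0) at_top" by (rule poly_exp_decay)
    then have "((\<lambda>h::real. poly (pCons 0 p) (inverse h) * exp (- inverse h)) \<longlongrightarrow> 0) (at_right 0)"
      by (rule filterlim_compose[OF _ filterlim_inverse_at_top_right])
    then have r: "((\<lambda>h. flat_exp p h / h) \<longlongrightarrow> 0) (at_right 0)"
      by (rule Lim_transform_eventually)
        (auto simp: eventually_at_filter flat_exp_def field_simps)
    have l: "((\<lambda>h. flat_exp p h / h) \<longlongrightarrow> 0) (at_left 0)"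
      by (rule Lim_transform_eventually[OF tendsto_const])
        (auto simp: eventually_at_filter flat_exp_def)
    have "((\<lambda>h. flat_exp p h / h) \<longlongrightarrow> 0) (at 0)"
      using filterlim_split_at l r by blast
    then show ?thesis using 3 by (simp add: DERIV_def flat_exp_def)
  qed
qed

lemma smooth_flat_exp: "smooth (flat_exp p)"
  by (rule smooth_coinduct[of _ "range flat_exp"]) (use DERIV_flat_exp in auto)

lemma smooth_imp_continuous: "smooth f \<Longrightarrow> continuous_on UNIV f"
  unfolding smooth_def by (meson DERIV_isCont continuous_at_imp_continuous_on)

lemma continuous_antiderivative:
  fixes f :: "real \<Rightarrow> real" assumes "continuous_on UNIV f"
  shows "\<exists>F. \<forall>x. (F has_real_derivative f x) (at x)"
  using einterval_antiderivative[of "-\<infinity>" "\<infinity>" f] assms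
  by (auto simp: continuous_on_eq_continuous_at has_real_derivative_iff_has_vector_derivative)

text \<open>
A smooth replacement of \<open>max 0 x\<close>. It is obtained by integrating a bump supported in \<open>[0, 1]\<close>
twice; integrating once and normalising gives the derivative, a smooth step from 0 to 1.
\<close>
lemma smooth_ramp_exists:
  obtains \<theta> \<psi> :: "real \<Rightarrow> real" and k
  where "smooth \<theta>" "smooth \<psi>" "\<And>x. (\<theta> has_real_derivative \<psi> x) (at x)"
    "\<And>x. 0 \<le> \<psi> x" "\<And>x. \<psi> x \<le> 1" "\<And>x. x \<le> 0 \<Longrightarrow> \<psi> x = 0" "\<And>x. 1 \<le> x \<Longrightarrow> \<psi> x = 1"
    "\<And>x. x \<le> 0 \<Longrightarrow> \<theta> x = 0" "\<And>x. 1 \<le> x \<Longrightarrow> \<theta> x = x - k" "\<And>x. \<bar>\<theta> x - max 0 x\<bar> \<le> 1"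
proof -
  define \<phi> where "\<phi> = (\<lambda>x. flat_exp 1 x * flat_exp 1 (-1 * x + 1))"
  have sm: "smooth \<phi>" unfolding \<phi>_def by (intro smooth_mult smooth_flat_exp smooth_affine)
  have pos: "\<phi> x > 0" if "0 < x" "x < 1" for x using that by (simp add: \<phi>_def flat_exp_def)
  have nn: "\<phi> x \<ge> 0" for x by (simp add: \<phi>_def flat_exp_def)
  have z: "\<phi> x = 0" if "x \<le> 0 \<or> 1 \<le> x" for x using that by (auto simp: \<phi>_def flat_exp_def)
  obtain F where F: "\<And>x. (F has_real_derivative \<phi> x) (at x)"
    using continuous_antiderivative[OF smooth_imp_continuous[OF sm]] by blast
  have "F 0 < F 1"
    by (rule DERIV_pos_imp_increasing_open) (use F pos in \<open>auto intro: continuous_at_imp_continuous_on DERIV_isCont\<close>)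
  have mono: "F x \<le> F y" if "x \<le> y" for x y
    by (rule DERIV_nonneg_imp_nondecreasing[OF that]) (use F nn in blast)
  have const: "F b = F a" if "a \<le> b" "\<And>x. a < x \<Longrightarrow> x < b \<Longrightarrow> \<phi> x = 0" for a b
  proof (cases "a < b")
    case True
    then show ?thesis
      by (rule DERIV_isconst_end)
        (use F that in \<open>auto intro!: continuous_at_imp_continuous_on DERIV_isCont, metis\<close>)
  qed (use that in simp)
  define d where "d = F 1 - F 0"
  have d: "d > 0" using \<open>F 0 < F 1\<close> by (simp add: d_def)
  define \<psi> where "\<psi> = (\<lambda>x. (F x - F 0) / d)"
  have F0: "F x = F 0" if "x \<le> 0" for x using const[OF that] z by auto
  have F1: "F x = F 1" if "1 \<le> x" for x using const[OF that] z by auto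
  have \<psi>0: "\<psi> x = 0" if "x \<le> 0" for x using F0[OF that] by (simp add: \<psi>_def)
  have \<psi>1: "\<psi> x = 1" if "1 \<le> x" for x using F1[OF that] d by (simp add: \<psi>_def d_def)
  have \<psi>mono: "\<psi> x \<le> \<psi> y" if "x \<le> y" for x y
    using mono[OF that] d by (simp add: \<psi>_def divide_right_mono)
  have \<psi>nn: "0 \<le> \<psi> x" for x using \<psi>mono[of "min x 0" x] \<psi>0[of "min x 0"] by simp
  have \<psi>le: "\<psi> x \<le> 1" for x using \<psi>mono[of x "max x 1"] \<psi>1[of "max x 1"] by simp
  have \<psi>der: "(\<psi> has_real_derivative (1/d) * \<phi> x) (at x)" for x
    unfolding \<psi>_def using d by (auto intro!: derivative_eq_intros F)
  have sm\<psi>: "smooth \<psi>" by (rule smooth_antiderivative[OF smooth_cmult[OF sm] \<psi>der])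
  obtain G where G: "\<And>x. (G has_real_derivative \<psi> x) (at x)"
    using continuous_antiderivative[OF smooth_imp_continuous[OF sm\<psi>]] by blast
  define \<theta> where "\<theta> = (\<lambda>x. G x - G 0)"
  have \<theta>: "(\<theta> has_real_derivative \<psi> x) (at x)" for x
    unfolding \<theta>_def by (auto intro!: derivative_eq_intros G)
  have sm\<theta>: "smooth \<theta>" by (rule smooth_antiderivative[OF sm\<psi> \<theta>])
  have cont\<theta>: "continuous_on A \<theta>" for A
    using \<theta> by (meson DERIV_isCont continuous_at_imp_continuous_on)
  have \<theta>0: "\<theta> x = 0" if "x \<le> 0" for x
  proof (cases "x < 0")
    case True
    have "\<theta> 0 = \<theta> x"
      by (rule DERIV_isconst_end[OF True cont\<theta>]) (use \<theta> \<psi>0 in \<open>metis less_imp_le\<close>)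
    then show ?thesis by (simp add: \<theta>_def)
  qed (use that in \<open>simp add: \<theta>_def\<close>)
  have \<theta>1: "\<theta> x = x - (1 - \<theta> 1)" if "1 \<le> x" for x
  proof (cases "1 < x")
    case True
    have "\<theta> x - x = \<theta> 1 - 1"
    proof (rule DERIV_isconst_end[OF True])
      show "continuous_on {1..x} (\<lambda>x. \<theta> x - x)" by (intro continuous_intros cont\<theta>)
      show "DERIV (\<lambda>x. \<theta> x - x) y :> 0" if "1 < y" for y
        using that \<psi>1[of y] by (auto intro!: derivative_eq_intros \<theta>)
    qed
    then show ?thesis by simp
  qed (use that in simp)
  \<comment> \<open>Between 0 and 1 the error is controlled because both \<open>\<theta>\<close> and \<open>x - \<theta> x\<close> increase, the derivative of \<open>\<theta>\<close> lying in \<open>[0, 1]\<close>.\<close>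
  have \<theta>_nn: "\<theta> a \<le> \<theta> b" if "a \<le> b" for a b
    by (rule DERIV_nonneg_imp_nondecreasing[OF that]) (use \<theta> \<psi>nn in blast)
  have \<theta>_up: "b - \<theta> b \<ge> a - \<theta> a" if "a \<le> b" for a b
    by (rule DERIV_nonneg_imp_nondecreasing[OF that])
      (use \<psi>le in \<open>auto intro!: exI derivative_eq_intros \<theta>\<close>)
  have z0: "\<theta> 0 = 0" by (simp add: \<theta>_def)
  have "\<bar>\<theta> x - max 0 x\<bar> \<le> 1" for x
  proof -
    consider "x \<le> 0" | "0 \<le> x" "x \<le> 1" | "1 \<le> x" by linarith
    then show ?thesis
    proof cases
      case 1 then show ?thesis using \<theta>0[OF 1] by simp
    next
      case 2 then show ?thesis using \<theta>_nn[OF 2(1)] \<theta>_up[OF 2(1)] z0 by simp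
    next
      case 3
      then show ?thesis using \<theta>1[OF 3] \<theta>_nn[of 0 1] \<theta>_up[of 0 1] z0 by simp
    qed
  qed
  with sm\<theta> sm\<psi> \<theta> \<psi>nn \<psi>le \<psi>0 \<psi>1 \<theta>0 \<theta>1 show ?thesis by (rule that)
qed

section \<open>Weak derivatives tested against trapezoids\<close>

text \<open>
The antiderivative of the difference of the indicators of \<open>(p, p + \<delta>]\<close> and \<open>(q, q + \<delta>]\<close>: it
rises with slope 1, stays constant and falls with slope \<open>-1\<close>. Divided by \<open>\<delta>\<close> it tends to the
indicator of \<open>(p, q]\<close>.
\<close>
definition trapezoid :: "real \<Rightarrow> real \<Rightarrow> real \<Rightarrow> real \<Rightarrow> real" where
  "trapezoid p q \<delta> x = max 0 (x - p) - max 0 (x - (p + \<delta>)) - max 0 (x - q) + max 0 (x - (q + \<delta>))"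

lemma trapezoid_bounds: "0 \<le> trapezoid p q \<delta> x" "trapezoid p q \<delta> x \<le> \<delta>" if "p \<le> q" "0 \<le> \<delta>"
  using that unfolding trapezoid_def by linarith+

lemma trapezoid_outside: "trapezoid p q \<delta> x = 0" if "x \<le> p \<or> q + \<delta> \<le> x" "p \<le> q" "0 \<le> \<delta>"
  using that unfolding trapezoid_def by linarith

lemma trapezoid_measurable [measurable]: "trapezoid p q \<delta> \<in> borel_measurable borel"
  unfolding trapezoid_def by measurable

lemma integral_trapezoid:
  assumes "p \<le> q" "0 \<le> \<delta>"
  shows "integrable lebesgue (trapezoid p q \<delta>)" "(LINT x|lebesgue. trapezoid p q \<delta> x) = \<delta> * (q - p)"
proof -
  define R where "R = (\<lambda>a x::real. (max 0 (x - a))\<^sup>2 / 2)"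
  have R: "DERIV (R a) x :> max 0 (x - a)" for a x
  proof -
    consider "x > a" | "x < a" | "x = a" by linarith
    then show ?thesis
    proof cases
      case 1
      have "DERIV (\<lambda>x. (x - a)\<^sup>2 / 2) x :> max 0 (x - a)"
        using 1 by (auto intro!: derivative_eq_intros)
      then show ?thesis
        by (rule has_field_derivative_transform_within_open[where S = "{a<..}"]) (use 1 in \<open>auto simp: R_def\<close>)
    next
      case 2
      have "DERIV (\<lambda>x. 0) x :> max 0 (x - a)" using 2 by simp
      then show ?thesis
        by (rule has_field_derivative_transform_within_open[where S = "{..<a}"]) (use 2 in \<open>auto simp: R_def\<close>)
    next
      case 3
      have "((\<lambda>h::real. (R a (a + h) - R a a) / h) \<longlongrightarrow> 0) (at 0)"
      proof (rule tendsto_0_le[where K = 1 and f = "\<lambda>h. h"])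
        show "((\<lambda>h::real. h) \<longlongrightarrow> 0) (at 0)" by (rule tendsto_ident_at)
        show "\<forall>\<^sub>F h in at 0. norm ((R a (a + h) - R a a) / h) \<le> norm h * 1"
          by (rule always_eventually) (auto simp: R_def max_def field_simps power2_eq_square)
      qed
      then show ?thesis using 3 by (simp add: DERIV_def)
    qed
  qed
  define F where "F = (\<lambda>x. R p x - R (p + \<delta>) x - R q x + R (q + \<delta>) x)"
  have F: "DERIV F x :> trapezoid p q \<delta> x" for x
    unfolding F_def trapezoid_def by (intro derivative_intros R)
  have le: "p \<le> q + \<delta>" using assms by simp
  have "isCont (trapezoid p q \<delta>) x" for x
    unfolding trapezoid_def by (intro continuous_intros)
  then have "has_bochner_integral lborel (\<lambda>x. trapezoid p q \<delta> x * indicator {p..q + \<delta>} x) (F (q + \<delta>) - F p)"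
    by (intro has_bochner_integral_FTC_Icc_real le F) auto
  moreover have "(\<lambda>x. trapezoid p q \<delta> x * indicator {p..q + \<delta>} x) = trapezoid p q \<delta>"
  proof
    fix x
    show "trapezoid p q \<delta> x * indicator {p..q + \<delta>} x = trapezoid p q \<delta> x"
      using trapezoid_outside[OF _ assms, of x] by (cases "x \<in> {p..q + \<delta>}") auto
  qed
  moreover have "F (q + \<delta>) - F p = \<delta> * (q - p)"
    using assms by (simp add: F_def R_def power2_eq_square field_simps)
  ultimately have "has_bochner_integral lborel (trapezoid p q \<delta>) (\<delta> * (q - p))" by simp
  then have "has_bochner_integral lebesgue (trapezoid p q \<delta>) (\<delta> * (q - p))"
    by (auto simp: has_bochner_integral_iff integrable_completion integral_completion)
  then show "integrable lebesgue (trapezoid p q \<delta>)" "(LINT x|lebesgue. trapezoid p q \<delta> x) = \<delta> * (q - p)"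
    by (auto simp: has_bochner_integral_iff)
qed

lemma borel_imp_lebesgue_measurable: "f \<in> borel_measurable borel \<Longrightarrow> f \<in> borel_measurable lebesgue"
  by (simp add: measurable_completion)

lemma locally_integrable_mult_indicator:
  assumes "locally_integrable u" "compact K"
  shows "integrable lebesgue (\<lambda>x. indicator K x * u x)"
  using assms unfolding locally_integrable_def set_integrable_def by simp

lemma integrable_mult_bounded:
  fixes u g :: "real \<Rightarrow> real"
  assumes "integrable M u" "g \<in> borel_measurable M" "\<And>x. \<bar>g x\<bar> \<le> C"
  shows "integrable M (\<lambda>x. u x * g x)"
proof (rule Bochner_Integration.integrable_bound[of _ "\<lambda>x. C * u x"])
  show "AE x in M. norm (u x * g x) \<le> norm (C * u x)"
  proof (rule AE_I2)
    fix x
    have "\<bar>u x\<bar> * \<bar>g x\<bar> \<le> \<bar>u x\<bar> * \<bar>C\<bar>"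
      using assms(3)[of x] by (intro mult_left_mono) auto
    then show "norm (u x * g x) \<le> norm (C * u x)" by (simp add: abs_mult mult_ac)
  qed
qed (use assms in auto)

text \<open>
Trapezoids are not smooth, but replacing each \<open>max 0\<close> by a rescaled smooth ramp turns them into
admissible test functions that converge uniformly, with uniformly bounded derivatives that
converge pointwise. Dominated convergence carries the defining identity of the weak derivative
over.
\<close>
lemma weak_deriv_trapezoid:
  assumes wd: "has_weak_deriv u v" and "p \<le> q" "0 < \<delta>"
  shows "(LINT x|lebesgue. u x * (indicator {p<..p + \<delta>} x - indicator {q<..q + \<delta>} x))
    = - (LINT x|lebesgue. v x * trapezoid p q \<delta> x)"
proof -
  obtain \<theta> \<psi> :: "real \<Rightarrow> real" and k where
    sm: "smooth \<theta>" "smooth \<psi>" and \<theta>': "\<And>x. (\<theta> has_real_derivative \<psi> x) (at x)"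
    and \<psi>: "\<And>x. 0 \<le> \<psi> x" "\<And>x. \<psi> x \<le> 1" "\<And>x. x \<le> 0 \<Longrightarrow> \<psi> x = 0" "\<And>x. 1 \<le> x \<Longrightarrow> \<psi> x = 1"
    and \<theta>: "\<And>x. x \<le> 0 \<Longrightarrow> \<theta> x = 0" "\<And>x. 1 \<le> x \<Longrightarrow> \<theta> x = x - k" "\<And>x. \<bar>\<theta> x - max 0 x\<bar> \<le> 1"
    by (rule smooth_ramp_exists) (rule that; assumption)
  \<comment> \<open>The extra unit of length leaves room for the transition zones of the ramps, whose width is \<open>1 / m n\<close>.\<close>
  define K where "K = {p..q + \<delta> + 1}"
  have "compact K" by (simp add: K_def)
  define m where "m n = real (Suc n)" for n :: nat
  have m: "m n > 0" "m n \<ge> 1" for n by (auto simp: m_def)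
  define \<Theta> where "\<Theta> n a x = (1 / m n) * \<theta> (m n * x + (- (m n * a)))" for n a x
  define \<Psi> where "\<Psi> n a x = \<psi> (m n * x + (- (m n * a)))" for n a x
  have d\<Theta>: "(\<Theta> n a has_real_derivative \<Psi> n a x) (at x)" for n a x
    unfolding \<Theta>_def \<Psi>_def using m(1)[of n]
    by (auto intro!: derivative_eq_intros DERIV_chain2[OF \<theta>'])
  have \<Theta>_err: "\<bar>\<Theta> n a x - max 0 (x - a)\<bar> \<le> 1 / m n" for n a x
  proof -
    have "\<Theta> n a x - max 0 (x - a) = (1 / m n) * (\<theta> (m n * x + (- (m n * a))) - max 0 (m n * x + (- (m n * a))))"
    proof -
      have "max 0 (m n * x + (- (m n * a))) = m n * max 0 (x - a)"
        using m(1)[of n] by (simp add: max_def algebra_simps)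
      then show ?thesis using m(1)[of n] by (simp add: \<Theta>_def field_simps)
    qed
    also have "\<bar>\<dots>\<bar> \<le> (1 / m n) * 1"
      unfolding abs_mult using m(1)[of n] \<theta>(3) by (intro mult_mono) auto
    finally show ?thesis by simp
  qed
  have \<Theta>0: "\<Theta> n a x = 0" "\<Psi> n a x = 0" if "x \<le> a" for n a x
    using that m(1)[of n] by (auto simp: \<Theta>_def \<Psi>_def \<theta>(1) \<psi>(3) mult_left_mono)
  have \<Theta>1: "\<Theta> n a x = x - a - k / m n" "\<Psi> n a x = 1" if "a + 1 / m n \<le> x" for n a x
  proof -
    have "1 \<le> m n * x + (- (m n * a))" using that m(1)[of n] by (simp add: field_simps)
    then show "\<Theta> n a x = x - a - k / m n" "\<Psi> n a x = 1"
      using m(1)[of n] \<theta>(2)[of "m n * x + (- (m n * a))"] \<psi>(4)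
      by (auto simp: \<Theta>_def \<Psi>_def field_simps)
  qed
  define f where "f n x = \<Theta> n p x - \<Theta> n (p + \<delta>) x - \<Theta> n q x + \<Theta> n (q + \<delta>) x" for n x
  define f' where "f' n x = \<Psi> n p x - \<Psi> n (p + \<delta>) x - \<Psi> n q x + \<Psi> n (q + \<delta>) x" for n x
  have smf: "smooth (f n)" for n
    unfolding f_def \<Theta>_def by (intro smooth_add smooth_diff smooth_cmult smooth_affine sm)
  have df: "(f n has_real_derivative f' n x) (at x)" for n x
    unfolding f_def f'_def by (intro derivative_intros d\<Theta>)
  have sup: "f n x = 0 \<and> f' n x = 0" if "x \<notin> K" for n x
  proof -
    have "1 / m n \<le> 1" using m(2)[of n] by simp
    moreover have "x < p \<or> q + \<delta> + 1 < x" using that by (auto simp: K_def)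
    ultimately consider "x \<le> p" | "q + \<delta> + 1 / m n \<le> x" by linarith
    then show ?thesis
    proof cases
      case 1 then show ?thesis using assms by (simp add: f_def f'_def \<Theta>0)
    next
      case 2 then show ?thesis using assms by (simp add: f_def f'_def \<Theta>1)
    qed
  qed
  have test: "f n \<in> Cc_infinity UNIV" for n
    unfolding Cc_infinity_def using smooth_imp_smooth_on[OF smf] \<open>compact K\<close> sup by blast
  have \<Psi>b: "0 \<le> \<Psi> n a x" "\<Psi> n a x \<le> 1" for n a x by (auto simp: \<Psi>_def \<psi>)
  have f'b: "\<bar>f' n x\<bar> \<le> 2" for n x
    using \<Psi>b[of n p x] \<Psi>b[of n "p + \<delta>" x] \<Psi>b[of n q x] \<Psi>b[of n "q + \<delta>" x] by (simp add: f'_def)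
  have ferr: "\<bar>f n x - trapezoid p q \<delta> x\<bar> \<le> 4 * (1 / m n)" for n x
  proof -
    have "\<bar>a - b - c + d - (a' - b' - c' + d')\<bar> \<le> 4 * e"
      if "\<bar>a - a'\<bar> \<le> e" "\<bar>b - b'\<bar> \<le> e" "\<bar>c - c'\<bar> \<le> e" "\<bar>d - d'\<bar> \<le> e" for a b c d a' b' c' d' e :: real
      by (rule abs_leI) (use that[unfolded abs_le_iff] in linarith)+
    then show ?thesis
      unfolding f_def trapezoid_def using \<Theta>_err by blast
  qed
  have fb: "\<bar>f n x\<bar> \<le> \<delta> + 4" for n x
  proof -
    have "1 / m n \<le> 1" using m(2)[of n] by simp
    then show ?thesis using ferr[of n x] trapezoid_bounds[of p q \<delta> x] assms by linarith
  qed
  have [measurable]: "f n \<in> borel_measurable lebesgue" "f' n \<in> borel_measurable lebesgue" for n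
  proof -
    have "continuous_on UNIV (\<psi>)" by (rule smooth_imp_continuous) fact
    then have "continuous_on UNIV (\<Psi> n a)" for a
      unfolding \<Psi>_def by (rule continuous_on_compose2) (auto intro!: continuous_intros)
    then have "continuous_on UNIV (f' n)"
      unfolding f'_def by (intro continuous_on_add continuous_on_diff)
    then show "f' n \<in> borel_measurable lebesgue"
      by (intro borel_imp_lebesgue_measurable borel_measurable_continuous_onI)
    show "f n \<in> borel_measurable lebesgue"
      by (intro borel_imp_lebesgue_measurable borel_measurable_continuous_onI smooth_imp_continuous smf)
  qed
  define uK where "uK = (\<lambda>x. indicator K x * u x)"
  define vK where "vK = (\<lambda>x. indicator K x * v x)"
  have uK: "integrable lebesgue uK" and vK: "integrable lebesgue vK"
    unfolding uK_def vK_def using wd \<open>compact K\<close>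
    by (auto simp: has_weak_deriv_def intro!: locally_integrable_mult_indicator)
  have [measurable]: "uK \<in> borel_measurable lebesgue" "vK \<in> borel_measurable lebesgue"
    using uK vK by auto
  have m0: "(\<lambda>n. 1 / m n) \<longlonglongrightarrow> 0"
    unfolding m_def using LIMSEQ_inverse_real_of_nat by (simp add: inverse_eq_divide)
  have lim\<Psi>: "(\<lambda>n. \<Psi> n a x) \<longlonglongrightarrow> indicator {a<..} x" for a x
  proof (cases "a < x")
    case True
    have "\<forall>\<^sub>F n in sequentially. 1 / m n < x - a"
      using m0 True by (intro order_tendstoD) auto
    then have "\<forall>\<^sub>F n in sequentially. \<Psi> n a x = indicator {a<..} x"
      by eventually_elim (use True \<Theta>1 in auto)
    then show ?thesis by (rule tendsto_eventually)
  qed (simp add: \<Theta>0)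
  define g where "g x = (indicator {p<..p + \<delta>} x - indicator {q<..q + \<delta>} x :: real)" for x :: real
  have g: "g x = indicator {p<..} x - indicator {p + \<delta><..} x - indicator {q<..} x + indicator {q + \<delta><..} x" for x
    using assms by (auto simp: g_def indicator_def)
  have f'lim: "(\<lambda>n. f' n x) \<longlonglongrightarrow> g x" for x
    unfolding f'_def g by (intro tendsto_intros lim\<Psi>)
  have flim: "(\<lambda>n. f n x) \<longlonglongrightarrow> trapezoid p q \<delta> x" for x
  proof -
    have "(\<lambda>n. f n x - trapezoid p q \<delta> x) \<longlonglongrightarrow> 0"
      using m0 by (rule tendsto_0_le[where K = 4]) (use ferr in \<open>auto simp: m(1) less_imp_le mult_ac intro!: always_eventually\<close>)
    then show ?thesis by (simp add: LIM_zero_iff)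
  qed
  have gK: "g x = 0" if "x \<notin> K" for x using that assms by (auto simp: g_def K_def indicator_def)
  have tK: "trapezoid p q \<delta> x = 0" if "x \<notin> K" for x
    using that assms by (intro trapezoid_outside) (auto simp: K_def)
  have [measurable]: "g \<in> borel_measurable lebesgue" "trapezoid p q \<delta> \<in> borel_measurable lebesgue"
    unfolding g_def by (auto intro!: borel_measurable_diff borel_measurable_indicator simp: measurable_completion)
  have L: "(\<lambda>n. LINT x|lebesgue. uK x * f' n x) \<longlonglongrightarrow> (LINT x|lebesgue. uK x * g x)"
  proof (rule integral_dominated_convergence[where w = "\<lambda>x. 2 * \<bar>uK x\<bar>"])
    show "AE x in lebesgue. norm (uK x * f' n x) \<le> 2 * \<bar>uK x\<bar>" for n
      using f'b[of n] by (auto simp: abs_mult mult.commute[of 2] intro!: mult_left_mono)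
  qed (use uK in \<open>auto intro!: tendsto_intros f'lim\<close>)
  have R: "(\<lambda>n. LINT x|lebesgue. vK x * f n x) \<longlonglongrightarrow> (LINT x|lebesgue. vK x * trapezoid p q \<delta> x)"
  proof (rule integral_dominated_convergence[where w = "\<lambda>x. (\<delta> + 4) * \<bar>vK x\<bar>"])
    show "AE x in lebesgue. norm (vK x * f n x) \<le> (\<delta> + 4) * \<bar>vK x\<bar>" for n
      using fb[of n] by (auto simp: abs_mult mult.commute[of "\<delta> + 4"] intro!: mult_left_mono)
  qed (use vK in \<open>auto intro!: tendsto_intros flim\<close>)
  have eq: "(LINT x|lebesgue. uK x * f' n x) = - (LINT x|lebesgue. vK x * f n x)" for n
  proof -
    have "(\<lambda>x. uK x * f' n x) = (\<lambda>x. u x * deriv (f n) x)"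
      using DERIV_imp_deriv[OF df] sup by (auto simp: uK_def indicator_def fun_eq_iff)
    moreover have "(\<lambda>x. vK x * f n x) = (\<lambda>x. v x * f n x)"
      using sup by (auto simp: vK_def indicator_def fun_eq_iff)
    ultimately show ?thesis using wd test[of n] by (simp add: has_weak_deriv_def)
  qed
  have "(LINT x|lebesgue. uK x * g x) = - (LINT x|lebesgue. vK x * trapezoid p q \<delta> x)"
    using LIMSEQ_unique[OF L] tendsto_minus[OF R] by (simp add: eq)
  moreover have "(\<lambda>x. uK x * g x) = (\<lambda>x. u x * g x)"
    using gK by (auto simp: uK_def indicator_def fun_eq_iff)
  moreover have "(\<lambda>x. vK x * trapezoid p q \<delta> x) = (\<lambda>x. v x * trapezoid p q \<delta> x)"
    using tK by (auto simp: vK_def indicator_def fun_eq_iff)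
  ultimately show ?thesis by (simp add: g_def)
qed

lemma lborel_integrable_imp_lebesgue: "integrable lborel f \<Longrightarrow> integrable lebesgue f"
  for f :: "real \<Rightarrow> real"
  by (subst integrable_completion) (auto dest: borel_measurable_integrable)

text \<open>
Averages of a function with weak derivative bounded by 1 inherit its Lipschitz constant. This is
how the bound on the initial slope enters the discretisation.
\<close>
lemma integral_shift_le:
  assumes "has_weak_deriv u v" "AE x in lebesgue. \<bar>v x\<bar> \<le> 1" "p \<le> q" "0 < \<delta>"
  shows "\<bar>LINT x|lebesgue. u x * (indicator {p<..p + \<delta>} x - indicator {q<..q + \<delta>} x)\<bar> \<le> \<delta> * (q - p)"
proof -
  have "\<bar>LINT x|lebesgue. v x * trapezoid p q \<delta> x\<bar> \<le> (LINT x|lebesgue. trapezoid p q \<delta> x)"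
  proof (cases "integrable lebesgue (\<lambda>x. v x * trapezoid p q \<delta> x)")
    case True
    have "\<bar>LINT x|lebesgue. v x * trapezoid p q \<delta> x\<bar> \<le> (LINT x|lebesgue. \<bar>v x * trapezoid p q \<delta> x\<bar>)"
      by (rule integral_abs_bound)
    also have "\<dots> \<le> (LINT x|lebesgue. trapezoid p q \<delta> x)"
    proof (rule integral_mono_AE)
      show "AE x in lebesgue. \<bar>v x * trapezoid p q \<delta> x\<bar> \<le> trapezoid p q \<delta> x"
        using assms(2)
      proof eventually_elim
        case (elim x)
        have "\<bar>v x\<bar> * trapezoid p q \<delta> x \<le> 1 * trapezoid p q \<delta> x"
          using elim trapezoid_bounds(1)[of p q \<delta> x] assms by (intro mult_right_mono) auto
        then show ?case using trapezoid_bounds(1)[of p q \<delta> x] assms by (simp add: abs_mult)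
      qed
    qed (use True integral_trapezoid[of p q \<delta>] assms in auto)
    finally show ?thesis .
  next
    case False
    then show ?thesis using trapezoid_bounds(1)[of p q \<delta>] assms by (simp add: not_integrable_integral_eq)
  qed
  then show ?thesis using weak_deriv_trapezoid[OF assms(1,3,4)] integral_trapezoid[of p q \<delta>] assms by simp
qed

lemma integral_indicator_Ioc: "integrable lebesgue (indicator {p<..q} :: real \<Rightarrow> real)"
  "(LINT x|lebesgue. indicator {p<..q} x :: real) = max 0 (q - p)" for p q :: real
proof -
  show "integrable lebesgue (indicator {p<..q} :: real \<Rightarrow> real)"
    by (rule integrable_real_indicator) (cases "p \<le> q"; auto)+
  show "(LINT x|lebesgue. indicator {p<..q} x :: real) = max 0 (q - p)"
    by (cases "p \<le> q") auto
qed

lemma lipschitz_imp_measurable: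
  fixes u :: "real \<Rightarrow> real"
  assumes "\<And>x y. \<bar>u x - u y\<bar> \<le> \<bar>x - y\<bar>"
  shows "continuous_on A u" "u \<in> borel_measurable borel"
proof -
  have "1-lipschitz_on UNIV u"
    by (rule lipschitz_onI) (use assms in \<open>auto simp: dist_real_def\<close>)
  then have "continuous_on UNIV u" by (rule lipschitz_on_continuous_on)
  then show "continuous_on A u" "u \<in> borel_measurable borel"
    by (auto intro: continuous_on_subset borel_measurable_continuous_onI)
qed

lemma locally_integrable_continuous: "locally_integrable u" if "continuous_on UNIV u"
  unfolding locally_integrable_def set_integrable_def
  by (metis borel_integrable_compact continuous_on_subset integrable_completion subset_UNIV that
      borel_measurable_integrable)

text \<open>
Divide the trapezoid identity by \<open>\<delta>\<close> and let \<open>\<delta>\<close> tend to 0: the averages on the left converge to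
the values of the continuous function \<open>u\<close> at \<open>p\<close> and \<open>q\<close>, the trapezoids on the right to an
indicator.
\<close>
lemma weak_deriv_FTC:
  assumes wd: "has_weak_deriv u v" and lip: "\<And>x y. \<bar>u x - u y\<bar> \<le> \<bar>x - y\<bar>" and "p \<le> q"
  shows "(LINT x|lebesgue. v x * indicator {p<..q} x) = u q - u p"
proof -
  define e where "e n = 1 / real (Suc n)" for n
  have e: "0 < e n" "e n \<le> 1" for n by (auto simp: e_def)
  have e0: "e \<longlonglongrightarrow> 0" unfolding e_def using LIMSEQ_inverse_real_of_nat by (simp add: inverse_eq_divide)
  have [measurable]: "u \<in> borel_measurable borel" by (rule lipschitz_imp_measurable(2)[OF lip])
  have intu: "integrable lebesgue (\<lambda>x. u x * indicator {a<..b} x)" for a b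
  proof -
    have "integrable lborel (\<lambda>x. indicator {a..b} x *\<^sub>R u x)"
      by (rule borel_integrable_compact) (auto intro: lipschitz_imp_measurable(1)[OF lip])
    then have "integrable lborel (\<lambda>x. indicator {a<..b} x *\<^sub>R (indicator {a..b} x *\<^sub>R u x))"
      by (rule integrable_mult_indicator[rotated]) auto
    moreover have "(\<lambda>x. indicator {a<..b} x *\<^sub>R (indicator {a..b} x *\<^sub>R u x)) = (\<lambda>x. u x * indicator {a<..b} x)"
      by (auto simp: indicator_def)
    ultimately show ?thesis by (intro lborel_integrable_imp_lebesgue) (simp only:)
  qed
  have avg: "(\<lambda>n. (LINT x|lebesgue. u x * indicator {a<..a + e n} x) / e n) \<longlonglongrightarrow> u a" for a
  proof -
    have "\<bar>(LINT x|lebesgue. u x * indicator {a<..a + e n} x) / e n - u a\<bar> \<le> e n" for n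
    proof -
      have "(LINT x|lebesgue. u x * indicator {a<..a + e n} x) - e n * u a
          = (LINT x|lebesgue. u x * indicator {a<..a + e n} x - u a * indicator {a<..a + e n} x)"
        using e(1)[of n] integral_indicator_Ioc[of a "a + e n"] intu[of a "a + e n"]
        by (subst Bochner_Integration.integral_diff) auto
      then have "\<bar>(LINT x|lebesgue. u x * indicator {a<..a + e n} x) - e n * u a\<bar>
          = \<bar>LINT x|lebesgue. u x * indicator {a<..a + e n} x - u a * indicator {a<..a + e n} x\<bar>"
        by (rule arg_cong)
      also have "\<dots> \<le> (LINT x|lebesgue. \<bar>u x * indicator {a<..a + e n} x - u a * indicator {a<..a + e n} x\<bar>)"
        by (rule integral_abs_bound)
      also have "\<dots> \<le> (LINT x|lebesgue. e n * indicator {a<..a + e n} x)"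
      proof (rule integral_mono)
        fix x
        show "\<bar>u x * indicator {a<..a + e n} x - u a * indicator {a<..a + e n} x\<bar> \<le> e n * indicator {a<..a + e n} x"
          using lip[of x a] by (auto simp: indicator_def)
      qed (use intu integral_indicator_Ioc in \<open>auto intro!: integrable_abs Bochner_Integration.integrable_diff integrable_mult_right\<close>)
      also have "\<dots> = e n * e n" using e(1)[of n] integral_indicator_Ioc[of a "a + e n"] by simp
      finally have "\<bar>(LINT x|lebesgue. u x * indicator {a<..a + e n} x) - e n * u a\<bar> \<le> e n * e n" .
      moreover have "(LINT x|lebesgue. u x * indicator {a<..a + e n} x) / e n - u a =
         ((LINT x|lebesgue. u x * indicator {a<..a + e n} x) - e n * u a) / e n"
        using e(1)[of n] by (simp add: field_simps)
      ultimately show ?thesis using e(1)[of n] by (simp add: abs_divide divide_le_eq)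
    qed
    then have "(\<lambda>n. (LINT x|lebesgue. u x * indicator {a<..a + e n} x) / e n - u a) \<longlonglongrightarrow> 0"
      using e e0 by (intro tendsto_0_le[OF e0, where K = 1]) (auto simp: less_imp_le intro!: always_eventually)
    then show ?thesis by (simp add: LIM_zero_iff)
  qed
  have L: "(\<lambda>n. (LINT x|lebesgue. u x * (indicator {p<..p + e n} x - indicator {q<..q + e n} x)) / e n) \<longlonglongrightarrow> u p - u q"
  proof -
    have "(LINT x|lebesgue. u x * (indicator {p<..p + e n} x - indicator {q<..q + e n} x)) / e n =
      (LINT x|lebesgue. u x * indicator {p<..p + e n} x) / e n - (LINT x|lebesgue. u x * indicator {q<..q + e n} x) / e n" for n
      using intu by (simp add: right_diff_distrib diff_divide_distrib)
    then show ?thesis by (simp add: tendsto_diff[OF avg avg])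
  qed
  define K where "K = {p..q + 1}"
  define vK where "vK = (\<lambda>x. indicator K x * v x)"
  have vK: "integrable lebesgue vK"
    unfolding vK_def using wd by (auto simp: has_weak_deriv_def K_def intro!: locally_integrable_mult_indicator)
  have tlim: "(\<lambda>n. trapezoid p q (e n) x / e n) \<longlonglongrightarrow> indicator {p<..q} x" for x
  proof -
    define g where "g = (if x \<le> p then 1 else if x \<le> q then x - p else x - q)"
    have "g > 0" by (auto simp: g_def)
    then have "\<forall>\<^sub>F n in sequentially. e n < g" using e0 by (intro order_tendstoD) auto
    then have "\<forall>\<^sub>F n in sequentially. trapezoid p q (e n) x / e n = indicator {p<..q} x"
    proof eventually_elim
      case (elim n)
      show ?case using elim e(1)[of n] \<open>p \<le> q\<close>
        by (auto simp: g_def trapezoid_def indicator_def max_def split: if_splits)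
    qed
    then show ?thesis by (rule tendsto_eventually)
  qed
  have R: "(\<lambda>n. LINT x|lebesgue. vK x * (trapezoid p q (e n) x / e n)) \<longlonglongrightarrow> (LINT x|lebesgue. vK x * indicator {p<..q} x)"
  proof (rule integral_dominated_convergence[where w = "\<lambda>x. \<bar>vK x\<bar>"])
    show "AE x in lebesgue. norm (vK x * (trapezoid p q (e n) x / e n)) \<le> \<bar>vK x\<bar>" for n
    proof (rule AE_I2)
      fix x
      have "\<bar>trapezoid p q (e n) x / e n\<bar> \<le> 1"
        using trapezoid_bounds[of p q "e n" x] e(1)[of n] \<open>p \<le> q\<close> by (simp add: abs_divide divide_le_eq_1)
      then have "\<bar>vK x\<bar> * \<bar>trapezoid p q (e n) x / e n\<bar> \<le> \<bar>vK x\<bar> * 1" by (intro mult_left_mono) auto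
      then show "norm (vK x * (trapezoid p q (e n) x / e n)) \<le> \<bar>vK x\<bar>"
        unfolding real_norm_def abs_mult by simp
    qed
    show "AE x in lebesgue. (\<lambda>n. vK x * (trapezoid p q (e n) x / e n)) \<longlonglongrightarrow> vK x * indicator {p<..q} x"
      by (intro AE_I2 tendsto_mult tendsto_const tlim)
    have t: "trapezoid p q (e n) \<in> borel_measurable lebesgue" for n
      by (rule borel_imp_lebesgue_measurable) measurable
    show "(\<lambda>x. vK x * (trapezoid p q (e n) x / e n)) \<in> borel_measurable lebesgue" for n
      using vK t[of n] by (intro borel_measurable_times borel_measurable_divide) auto
    show "(\<lambda>x. vK x * indicator {p<..q} x) \<in> borel_measurable lebesgue"
      using vK by (intro borel_measurable_times borel_measurable_indicator) auto
  qed (use vK in \<open>rule integrable_abs\<close>)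
  have "(LINT x|lebesgue. vK x * (trapezoid p q (e n) x / e n)) =
    - ((LINT x|lebesgue. u x * (indicator {p<..p + e n} x - indicator {q<..q + e n} x)) / e n)" for n
  proof -
    have "(\<lambda>x. vK x * (trapezoid p q (e n) x / e n)) = (\<lambda>x. v x * trapezoid p q (e n) x / e n)"
    proof
      fix x
      show "vK x * (trapezoid p q (e n) x / e n) = v x * trapezoid p q (e n) x / e n"
      proof (cases "x \<in> K")
        case False
        then have "x \<le> p \<or> q + e n \<le> x" using e(2)[of n] unfolding K_def atLeastAtMost_iff by linarith
        then have "trapezoid p q (e n) x = 0"
          using e(1)[of n] \<open>p \<le> q\<close> by (intro trapezoid_outside) auto
        then show ?thesis by simp
      qed (simp add: vK_def)
    qed
    then show ?thesis using weak_deriv_trapezoid[OF wd \<open>p \<le> q\<close> e(1)] by simp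
  qed
  then have "(LINT x|lebesgue. vK x * indicator {p<..q} x) = u q - u p"
    using LIMSEQ_unique[OF R] tendsto_minus[OF L] by simp
  moreover have "(\<lambda>x. vK x * indicator {p<..q} x) = (\<lambda>x. v x * indicator {p<..q} x)"
    by (auto simp: vK_def K_def indicator_def)
  ultimately show ?thesis by simp
qed

section \<open>Bounds almost everywhere from integrals over intervals\<close>

text \<open>
A bounded open set is the increasing union of the dyadic half-open intervals of length \<open>2\<^sup>-\<^sup>n\<close>
that it contains. For fixed \<open>n\<close> these intervals are disjoint and finite in number.
\<close>
lemma integral_nonneg_on_open:
  fixes w :: "real \<Rightarrow> real"
  assumes w: "locally_integrable w" and I: "\<And>p q. p \<le> q \<Longrightarrow> 0 \<le> (LINT x|lebesgue. w x * indicator {p<..q} x)"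
    and U: "open U" "U \<subseteq> {-r<..<r}"
  shows "0 \<le> (LINT x|lebesgue. w x * indicator U x)"
proof -
  \<comment> \<open>The index of the dyadic interval \<open>D n k\<close> containing \<open>x\<close>.\<close>
  define c where "c n x = \<lceil>x * 2 ^ n\<rceil>" for n :: nat and x :: real
  define D where "D n k = {(real_of_int k - 1) / 2 ^ n<..real_of_int k / 2 ^ n}" for n :: nat and k :: int
  have mem: "x \<in> D n k \<longleftrightarrow> c n x = k" for n k x
    unfolding D_def c_def ceiling_eq_iff by (auto simp: field_simps)
  define S where "S n = {k \<in> {- \<lceil>\<bar>r\<bar>\<rceil> * 2 ^ n - 1..\<lceil>\<bar>r\<bar>\<rceil> * 2 ^ n + 1}. D n k \<subseteq> U}" for n
  have fin: "finite (S n)" for n unfolding S_def by (rule finite_subset[of _ "{- \<lceil>\<bar>r\<bar>\<rceil> * 2 ^ n - 1..\<lceil>\<bar>r\<bar>\<rceil> * 2 ^ n + 1}"]) auto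
  have S: "k \<in> S n \<longleftrightarrow> D n k \<subseteq> U" for n k
  proof
    assume sub: "D n k \<subseteq> U"
    have "real_of_int k / 2 ^ n \<in> D n k" by (simp add: D_def divide_strict_right_mono)
    then have "\<bar>real_of_int k / 2 ^ n\<bar> \<le> \<bar>r\<bar>" using sub U(2) by fastforce
    also have "\<dots> \<le> real_of_int \<lceil>\<bar>r\<bar>\<rceil>" by simp
    finally have "\<bar>real_of_int k\<bar> \<le> real_of_int \<lceil>\<bar>r\<bar>\<rceil> * 2 ^ n" by (simp add: abs_divide field_simps)
    also have "\<dots> = real_of_int (\<lceil>\<bar>r\<bar>\<rceil> * 2 ^ n)" by simp
    finally have "\<bar>k\<bar> \<le> \<lceil>\<bar>r\<bar>\<rceil> * 2 ^ n" by (simp only: of_int_abs[symmetric] of_int_le_iff)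
    then show "k \<in> S n" using sub by (auto simp: S_def)
  qed (simp add: S_def)
  define g where "g n x = (\<Sum>k\<in>S n. indicator (D n k) x :: real)" for n x
  have g: "g n x = indicator {x. D n (c n x) \<subseteq> U} x" for n x
  proof -
    have "g n x = (\<Sum>k\<in>S n. if k = c n x then 1 else 0)"
      unfolding g_def by (rule sum.cong) (auto simp: indicator_def mem)
    then show ?thesis using fin by (simp add: S indicator_def)
  qed
  define K where "K = {-r..r}"
  define wK where "wK = (\<lambda>x. indicator K x * w x)"
  have wK: "integrable lebesgue wK"
    unfolding wK_def using w by (auto simp: K_def intro!: locally_integrable_mult_indicator)
  have UK: "x \<in> K" if "x \<in> U" for x using U(2) that by (force simp: K_def)
  have wi: "integrable lebesgue (\<lambda>x. w x * indicator (D n k) x)" for n k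
  proof -
    define C where "C = {(real_of_int k - 1) / 2 ^ n..real_of_int k / 2 ^ n}"
    have "integrable lebesgue (\<lambda>x. indicator C x * w x)"
      using w by (auto simp: C_def intro!: locally_integrable_mult_indicator)
    then have "integrable lebesgue (\<lambda>x. (indicator C x * w x) * indicator (D n k) x)"
    proof (rule integrable_mult_bounded[where C = 1])
      show "indicator (D n k) \<in> borel_measurable lebesgue"
        by (rule borel_measurable_indicator) (simp add: D_def)
    qed (simp add: indicator_def)
    moreover have "(\<lambda>x. (indicator C x * w x) * indicator (D n k) x) = (\<lambda>x. w x * indicator (D n k) x)"
      by (auto simp: C_def D_def indicator_def)
    ultimately show ?thesis by simp
  qed
  have pos: "0 \<le> (LINT x|lebesgue. w x * g n x)" for n
  proof -
    have "(LINT x|lebesgue. w x * g n x) = (\<Sum>k\<in>S n. LINT x|lebesgue. w x * indicator (D n k) x)"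
      unfolding g_def sum_distrib_left by (rule Bochner_Integration.integral_sum) (rule wi)
    also have "\<dots> \<ge> 0"
    proof (rule sum_nonneg)
      fix k
      have "(real_of_int k - 1) / 2 ^ n \<le> real_of_int k / 2 ^ n" by (simp add: divide_right_mono)
      then show "0 \<le> (LINT x|lebesgue. w x * indicator (D n k) x)" unfolding D_def by (rule I)
    qed
    finally show ?thesis .
  qed
  have gU: "g n x = 0" if "x \<notin> U" for n x
    using that mem[of x n "c n x"] by (auto simp: g indicator_def)
  have glim: "(\<lambda>n. g n x) \<longlonglongrightarrow> indicator U x" for x
  proof (cases "x \<in> U")
    case True
    then obtain e where e: "e > 0" "ball x e \<subseteq> U" using U(1) openE by blast
    have "(\<lambda>n. (1 / 2) ^ n :: real) \<longlonglongrightarrow> 0" by (rule LIMSEQ_realpow_zero) auto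
    then have "\<forall>\<^sub>F n in sequentially. (1 / 2) ^ n < e" using e(1) by (rule order_tendstoD)
    then have "\<forall>\<^sub>F n in sequentially. g n x = indicator U x"
    proof eventually_elim
      case (elim n)
      have "D n (c n x) \<subseteq> ball x e"
      proof
        fix y assume "y \<in> D n (c n x)"
        moreover have "x \<in> D n (c n x)" by (simp add: mem)
        ultimately have "\<bar>x - y\<bar> < (1 / 2) ^ n"
          unfolding D_def by (auto simp: abs_less_iff field_simps power_one_over)
        then show "y \<in> ball x e" using elim by (simp add: dist_real_def)
      qed
      then show ?case using e True by (auto simp: g indicator_def)
    qed
    then show ?thesis by (rule tendsto_eventually)
  qed (simp add: gU)
  have [measurable]: "g n \<in> borel_measurable lebesgue" for n
    unfolding g_def D_def by (intro borel_measurable_sum borel_measurable_indicator) auto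
  have "(\<lambda>n. LINT x|lebesgue. wK x * g n x) \<longlonglongrightarrow> (LINT x|lebesgue. wK x * indicator U x)"
  proof (rule integral_dominated_convergence[where w = "\<lambda>x. \<bar>wK x\<bar>"])
    show "AE x in lebesgue. norm (wK x * g n x) \<le> \<bar>wK x\<bar>" for n
      by (rule AE_I2) (auto simp: g indicator_def)
  qed (use wK U in \<open>auto intro!: tendsto_mult tendsto_const glim borel_measurable_times borel_measurable_indicator integrable_abs\<close>)
  moreover have "(\<lambda>x. wK x * g n x) = (\<lambda>x. w x * g n x)" for n
  proof
    fix x show "wK x * g n x = w x * g n x" by (cases "x \<in> U") (auto simp: wK_def gU UK)
  qed
  moreover have "(\<lambda>x. wK x * indicator U x) = (\<lambda>x. w x * indicator U x)"
  proof
    fix x show "wK x * indicator U x = w x * indicator U x" by (cases "x \<in> U") (auto simp: wK_def UK)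
  qed
  ultimately have "(\<lambda>n. LINT x|lebesgue. w x * g n x) \<longlonglongrightarrow> (LINT x|lebesgue. w x * indicator U x)" by simp
  then show ?thesis by (rule LIMSEQ_le_const) (use pos in auto)
qed

text \<open>
The set where \<open>w\<close> is negative is, up to a null set, a decreasing intersection of open sets.
Hence the integral of \<open>w\<close> over it is nonnegative, which is only possible if the set is null.
\<close>
lemma AE_nonneg_of_interval_integrals:
  fixes w :: "real \<Rightarrow> real"
  assumes w: "locally_integrable w" and I: "\<And>p q. p \<le> q \<Longrightarrow> 0 \<le> (LINT x|lebesgue. w x * indicator {p<..q} x)"
  shows "AE x in lebesgue. 0 \<le> w x"
proof -
  have "AE x in lebesgue. x \<in> {- real n<..<real n} \<longrightarrow> 0 \<le> w x" for n :: nat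
  proof -
    define r where "r = real n"
    define K where "K = {-r..r}"
    define wK where "wK = (\<lambda>x. indicator K x * w x)"
    have wK: "integrable lebesgue wK"
      unfolding wK_def using w by (auto simp: K_def intro!: locally_integrable_mult_indicator)
    then have [measurable]: "wK \<in> borel_measurable lebesgue" by simp
    define A where "A = {x. wK x < 0} \<inter> {-r<..<r}"
    have "{x \<in> space lebesgue. wK x < 0} \<in> sets lebesgue" by measurable
    then have A: "A \<in> sets lebesgue" unfolding A_def by auto
    have "\<exists>T. open T \<and> A \<subseteq> T \<and> T - A \<in> lmeasurable \<and> emeasure lebesgue (T - A) < ennreal (1 / real (Suc k))" for k
      using sets_lebesgue_outer_open[OF A, of "1 / real (Suc k)"] by (metis divide_pos_pos of_nat_0_less_iff zero_less_Suc zero_less_one)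
    then obtain T where T: "\<And>k. open (T k)" "\<And>k. A \<subseteq> T k" "\<And>k. T k - A \<in> lmeasurable"
      "\<And>k. emeasure lebesgue (T k - A) < ennreal (1 / real (Suc k))" by metis
    define U where "U k = (\<Inter>i\<le>k. T i) \<inter> {-r<..<r}" for k
    have Uo: "open (U k)" for k unfolding U_def using T(1) by (intro open_Int open_INT) auto
    have Ur: "U k \<subseteq> {-r<..<r}" for k by (auto simp: U_def)
    define G where "G = (\<Inter>k. U k)"
    have AG: "A \<subseteq> G" using T(2) by (auto simp: G_def U_def A_def)
    have Gs: "G \<in> sets lebesgue" unfolding G_def using Uo by (intro sets.countable_INT) auto
    have null: "G - A \<in> null_sets lebesgue"
    proof -
      have "emeasure lebesgue (G - A) \<le> ennreal (1 / real (Suc k))" for k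
      proof -
        have "emeasure lebesgue (G - A) \<le> emeasure lebesgue (T k - A)"
          by (rule emeasure_mono) (use T(3) in \<open>auto simp: G_def U_def fmeasurableD\<close>)
        then show ?thesis using T(4)[of k] by simp
      qed
      moreover have "(\<lambda>k. ennreal (1 / real (Suc k))) \<longlonglongrightarrow> ennreal 0"
        using LIMSEQ_inverse_real_of_nat by (intro tendsto_ennrealI) (simp add: inverse_eq_divide)
      ultimately have "emeasure lebesgue (G - A) \<le> ennreal 0"
        by (intro LIMSEQ_le_const) auto
      then show ?thesis using Gs A by (auto simp: null_sets_def)
    qed
    have lim: "(\<lambda>k. LINT x|lebesgue. wK x * indicator (U k) x) \<longlonglongrightarrow> (LINT x|lebesgue. wK x * indicator G x)"
    proof (rule integral_dominated_convergence[where w = "\<lambda>x. \<bar>wK x\<bar>"])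
      show "AE x in lebesgue. (\<lambda>k. wK x * indicator (U k) x) \<longlonglongrightarrow> wK x * indicator G x"
      proof (rule AE_I2)
        fix x
        have "(\<lambda>k. indicator (U k) x :: real) \<longlonglongrightarrow> indicator (\<Inter>k. U k) x"
          by (rule LIMSEQ_indicator_decseq) (auto simp: decseq_def U_def)
        then show "(\<lambda>k. wK x * indicator (U k) x) \<longlonglongrightarrow> wK x * indicator G x"
          unfolding G_def by (intro tendsto_mult tendsto_const)
      qed
      show "AE x in lebesgue. norm (wK x * indicator (U k) x) \<le> \<bar>wK x\<bar>" for k
        by (rule AE_I2) (auto simp: indicator_def)
    qed (use wK Gs Uo in \<open>auto intro!: borel_measurable_times borel_measurable_indicator integrable_abs\<close>)
    have wKU: "(\<lambda>x. wK x * indicator (U k) x) = (\<lambda>x. w x * indicator (U k) x)" for k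
      using Ur[of k] by (auto simp: wK_def K_def indicator_def fun_eq_iff)
    have "0 \<le> (LINT x|lebesgue. wK x * indicator (U k) x)" for k
      unfolding wKU by (rule integral_nonneg_on_open[OF w I Uo Ur])
    then have "0 \<le> (LINT x|lebesgue. wK x * indicator G x)"
      by (intro LIMSEQ_le_const[OF lim]) auto
    also have "\<dots> = (LINT x|lebesgue. wK x * indicator A x)"
    proof (rule integral_cong_AE)
      have "AE x in lebesgue. x \<notin> G - A" using null by (rule AE_not_in)
      then show "AE x in lebesgue. wK x * indicator G x = wK x * indicator A x"
        by eventually_elim (use AG in \<open>auto simp: indicator_def\<close>)
    qed (use wK Gs A in \<open>auto intro!: borel_measurable_times borel_measurable_indicator\<close>)
    finally have nn: "(LINT x|lebesgue. - (wK x * indicator A x)) \<le> 0" by simp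
    have int: "integrable lebesgue (\<lambda>x. - (wK x * indicator A x))"
    proof (intro Bochner_Integration.integrable_minus integrable_mult_bounded[OF wK, where C = 1])
      show "indicator A \<in> borel_measurable lebesgue" using A by (rule borel_measurable_indicator)
    qed (simp add: indicator_def)
    have ge: "0 \<le> - (wK x * indicator A x)" for x by (auto simp: A_def indicator_def)
    have "(LINT x|lebesgue. - (wK x * indicator A x)) = 0"
      using nn ge by (intro antisym Bochner_Integration.integral_nonneg) auto
    then have "AE x in lebesgue. - (wK x * indicator A x) = 0"
      using integral_nonneg_eq_0_iff_AE[OF int] ge by simp
    then show ?thesis
      by eventually_elim (auto simp: A_def r_def wK_def K_def indicator_def split: if_splits)
  qed
  then have "AE x in lebesgue. \<forall>n. x \<in> {- real n<..<real n} \<longrightarrow> 0 \<le> w x"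
    unfolding AE_all_countable by blast
  then show ?thesis
  proof eventually_elim
    case (elim x)
    obtain n where "\<bar>x\<bar> < real n" using reals_Archimedean2 by blast
    then show ?case using elim by (auto simp: abs_less_iff)
  qed
qed

section \<open>Lipschitz functions are weakly differentiable\<close>

text \<open>
Adding \<open>2 * x\<close> makes \<open>u\<close> strictly increasing and bi-Lipschitz. The function \<open>F\<close> so obtained
assigns to each Borel set the measure of its image; Lipschitz maps preserve null sets, so this
measure is absolutely continuous and has a Radon-Nikodym density, from which 2 is subtracted
again. This avoids any pointwise differentiation of \<open>u\<close>.
\<close>
lemma lipschitz_has_density:
  fixes u :: "real \<Rightarrow> real"
  assumes lip: "\<And>x y. \<bar>u x - u y\<bar> \<le> \<bar>x - y\<bar>"
  obtains v where "v \<in> borel_measurable borel"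
    "\<And>a b. integrable lborel (\<lambda>x. v x * indicator {a<..b} x)"
    "\<And>a b. a \<le> b \<Longrightarrow> (LINT x|lborel. v x * indicator {a<..b} x) = u b - u a"
proof -
  define F where "F x = u x + 2 * x" for x
  have up: "F y - F x \<le> 3 * (y - x)" and lo: "y - x \<le> F y - F x" if "x \<le> y" for x y
    using lip[of x y] that by (auto simp: F_def abs_le_iff)
  have Fsm: "F x < F y \<longleftrightarrow> x < y" for x y using lo[of x y] lo[of y x] by (cases x y rule: linorder_cases) auto
  have Fm: "F x \<le> F y \<longleftrightarrow> x \<le> y" for x y using Fsm[of y x] by (auto simp: not_less[symmetric])
  have contF: "continuous_on A F" for A
    unfolding F_def by (intro continuous_intros lipschitz_imp_measurable(1)[OF lip])
  have surj: "\<exists>x. F x = y" for y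
  proof -
    define a where "a = - (\<bar>y\<bar> + \<bar>F 0\<bar>)"
    define b where "b = \<bar>y\<bar> + \<bar>F 0\<bar>"
    have "a \<le> 0" "0 \<le> b" by (auto simp: a_def b_def)
    have "F a \<le> y" using lo[OF \<open>a \<le> 0\<close>] by (simp add: a_def)
    moreover have "y \<le> F b" using lo[OF \<open>0 \<le> b\<close>] by (simp add: b_def)
    ultimately show ?thesis
      using IVT'[of F a y b] contF \<open>a \<le> 0\<close> \<open>0 \<le> b\<close> by auto
  qed
  define G where "G y = (SOME x. F x = y)" for y
  have FG: "F (G y) = y" for y unfolding G_def by (rule someI_ex[OF surj])
  have GF: "G (F x) = x" for x using FG[of "F x"] Fm[of "G (F x)" x] Fm[of x "G (F x)"] by auto
  have "mono G" by (rule monoI) (metis FG Fm)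
  then have [measurable]: "G \<in> borel_measurable borel" by (rule borel_measurable_mono)
  \<comment> \<open>Preimages under the inverse \<open>G\<close> are images under \<open>F\<close>, so that \<open>\<mu>\<close> measures images under \<open>F\<close>.\<close>
  define \<mu> where "\<mu> = distr lborel borel G"
  have vim: "G -` A = F ` A" for A
  proof -
    have "F (G y) \<in> F ` A" if "G y \<in> A" for y using that by (rule imageI)
    then show ?thesis by (auto simp: FG GF)
  qed
  have emu: "emeasure \<mu> A = emeasure lborel (F ` A)" if "A \<in> sets borel" for A
    using that by (simp add: \<mu>_def emeasure_distr vim)
  have ac: "absolutely_continuous lborel \<mu>"
    unfolding absolutely_continuous_def
  proof
    fix A assume A: "A \<in> null_sets (lborel :: real measure)"
    then have As: "A \<in> sets borel" by auto
    have "negligible A" using A null_sets_completionI negligible_iff_null_sets by blast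
    then have "negligible (F ` A)"
    proof (rule negligible_locally_Lipschitz_image[rotated])
      fix x assume "x \<in> A"
      have "norm (F y - F x) \<le> 3 * norm (y - x)" for y
        using up[of x y] up[of y x] lo[of x y] lo[of y x] by (cases "x \<le> y") auto
      then show "\<exists>T B. open T \<and> x \<in> T \<and> (\<forall>y\<in>A \<inter> T. norm (F y - F x) \<le> B * norm (y - x))"
        by (intro exI[of _ UNIV] exI[of _ 3]) auto
    qed simp
    then have "F ` A \<in> null_sets lebesgue" by (simp add: negligible_iff_null_sets)
    moreover have "F ` A \<in> sets borel"
      using measurable_sets[OF \<open>G \<in> borel_measurable borel\<close> As] by (simp add: vim)
    ultimately have "emeasure lborel (F ` A) = 0" by (auto simp: null_sets_def)
    then show "A \<in> null_sets \<mu>" using emu[OF As] As by (auto simp: null_sets_def \<mu>_def)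
  qed
  define w where "w = RN_deriv lborel \<mu>"
  have [measurable]: "w \<in> borel_measurable borel"
    unfolding w_def using borel_measurable_RN_deriv[of lborel \<mu>] by simp
  have dens: "density lborel w = \<mu>"
    unfolding w_def by (rule sigma_finite_measure.density_RN_deriv[OF _ ac])
      (auto simp: \<mu>_def intro: lborel.sigma_finite_measure_axioms)
  have I: "(\<integral>\<^sup>+x. w x * indicator {a<..b} x \<partial>lborel) = ennreal (F b - F a)" if "a \<le> b" for a b
  proof -
    have "F ` {a<..b} = {F a<..F b}"
    proof
      show "F ` {a<..b} \<subseteq> {F a<..F b}" by (auto simp: Fsm Fm)
      show "{F a<..F b} \<subseteq> F ` {a<..b}"
      proof
        fix y assume "y \<in> {F a<..F b}"
        then have "G y \<in> {a<..b}" using FG[of y] Fsm[of a "G y"] Fm[of "G y" b] by auto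
        then have "F (G y) \<in> F ` {a<..b}" by (rule imageI)
        then show "y \<in> F ` {a<..b}" by (simp add: FG)
      qed
    qed
    then have "emeasure \<mu> {a<..b} = ennreal (F b - F a)"
      using emu[of "{a<..b}"] that by (simp add: Fm)
    then show ?thesis unfolding dens[symmetric] by (simp add: emeasure_density)
  qed
  have fin: "AE x in lborel. w x \<noteq> \<infinity>"
  proof -
    have "AE x in lborel. w x * indicator {- real n<..real n} x \<noteq> \<infinity>" for n
      by (rule nn_integral_PInf_AE) (auto simp: I)
    then have "AE x in lborel. \<forall>n. w x * indicator {- real n<..real n} x \<noteq> \<infinity>"
      unfolding AE_all_countable by blast
    then show ?thesis
    proof eventually_elim
      case (elim x)
      obtain n where "\<bar>x\<bar> < real n" using reals_Archimedean2 by blast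
      then have "x \<in> {- real n<..real n}" by auto
      then show ?case using elim[rule_format, of n] by simp
    qed
  qed
  define r where "r x = enn2real (w x)" for x
  have [measurable]: "r \<in> borel_measurable borel" unfolding r_def by measurable
  have r: "integrable lborel (\<lambda>x. r x * indicator {a<..b} x) \<and> (LINT x|lborel. r x * indicator {a<..b} x) = F b - F a"
    if "a \<le> b" for a b
  proof -
    have "(\<integral>\<^sup>+x. ennreal (r x * indicator {a<..b} x) \<partial>lborel) = (\<integral>\<^sup>+x. w x * indicator {a<..b} x \<partial>lborel)"
    proof (rule nn_integral_cong_AE)
      show "AE x in lborel. ennreal (r x * indicator {a<..b} x) = w x * indicator {a<..b} x"
        using fin by eventually_elim (auto simp: r_def indicator_def top.not_eq_extremum)
    qed
    also have "\<dots> = ennreal (F b - F a)" by (rule I[OF that])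
    finally have e: "(\<integral>\<^sup>+x. ennreal (r x * indicator {a<..b} x) \<partial>lborel) = ennreal (F b - F a)" .
    have int: "integrable lborel (\<lambda>x. r x * indicator {a<..b} x)"
      by (rule integrableI_nn_integral_finite[OF _ _ e]) (auto simp: r_def)
    have "ennreal (LINT x|lborel. r x * indicator {a<..b} x) = ennreal (F b - F a)"
      by (subst nn_integral_eq_integral[symmetric]) (auto simp: int e, simp add: r_def)
    moreover have "0 \<le> (LINT x|lborel. r x * indicator {a<..b} x)"
      by (intro Bochner_Integration.integral_nonneg) (simp add: r_def)
    ultimately have "(LINT x|lborel. r x * indicator {a<..b} x) = F b - F a"
      using that Fm[of a b] by (subst (asm) ennreal_inj) auto
    with int show ?thesis by simp
  qed
  have ind: "integrable lborel (\<lambda>x. 2 * indicator {a<..b} x :: real)" for a b :: real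
    by (intro integrable_mult_right integrable_real_indicator) (cases "a \<le> b"; auto)+
  show ?thesis
  proof
    show "(\<lambda>x. r x - 2) \<in> borel_measurable borel" by measurable
    have eq: "(\<lambda>x. (r x - 2) * indicator {a<..b} x) = (\<lambda>x. r x * indicator {a<..b} x - 2 * indicator {a<..b} x)" for a b
      by (auto simp: algebra_simps)
    show "integrable lborel (\<lambda>x. (r x - 2) * indicator {a<..b} x)" for a b
    proof (cases "a \<le> b")
      case True
      show ?thesis unfolding eq using r[OF True] ind by (intro Bochner_Integration.integrable_diff) auto
    qed simp
    show "(LINT x|lborel. (r x - 2) * indicator {a<..b} x) = u b - u a" if "a \<le> b" for a b
      unfolding eq using r[OF that] ind[of a b] that
      by (subst Bochner_Integration.integral_diff) (auto simp: F_def)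
  qed
qed

lemma Cc_infinity_UNIV_E:
  assumes "\<phi> \<in> Cc_infinity (UNIV :: real set)"
  obtains S where "0 < S" "\<And>x. (\<phi> has_real_derivative deriv \<phi> x) (at x)" "continuous_on UNIV (deriv \<phi>)"
    "\<And>x. S \<le> \<bar>x\<bar> \<Longrightarrow> \<phi> x = 0" "\<And>x. S \<le> \<bar>x\<bar> \<Longrightarrow> deriv \<phi> x = 0"
proof -
  from assms obtain K where ck: "\<And>k. Ck_on k UNIV \<phi>" and K: "compact K" "\<And>x. x \<notin> K \<Longrightarrow> \<phi> x = 0"
    by (auto simp: Cc_infinity_def smooth_on_def)
  obtain B where B: "0 < B" "\<And>x. x \<in> K \<Longrightarrow> norm x \<le> B"
    using compact_imp_bounded[OF K(1)] bounded_pos by metis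
  have diff: "\<phi> differentiable (at x)" for x
    using ck[of "Suc 0"] by (simp add: differentiable_on_def)
  have der: "(\<phi> has_real_derivative deriv \<phi> x) (at x)" for x
    using diff[of x] by (simp add: DERIV_deriv_iff_real_differentiable)
  have fd: "frechet_derivative \<phi> (at x) 1 = deriv \<phi> x" for x
  proof -
    have "frechet_derivative \<phi> (at x) = (\<lambda>y. deriv \<phi> x * y)"
      using frechet_derivative_at[of \<phi> "\<lambda>y. deriv \<phi> x * y" x] der[of x]
      by (simp add: has_field_derivative_def)
    then show ?thesis by simp
  qed
  have "Ck_on 0 UNIV (\<lambda>x. frechet_derivative \<phi> (at x within UNIV) 1)"
    using ck[of "Suc 0"] by simp
  then have cont: "continuous_on UNIV (deriv \<phi>)" by (simp add: fd)
  have z: "\<phi> x = 0" if "B + 1 \<le> \<bar>x\<bar>" for x using that B(2)[of x] K(2)[of x] by force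
  have "deriv \<phi> x = 0" if "B + 1 \<le> \<bar>x\<bar>" for x
  proof -
    have o: "open {x::real. B < \<bar>x\<bar>}" by (intro open_Collect_less continuous_intros)
    have "((\<lambda>x. 0) has_real_derivative 0) (at x)" by simp
    then have "(\<phi> has_real_derivative 0) (at x)"
      by (rule has_field_derivative_transform_within_open[OF _ o])
        (use that B K(2) in force)+
    then show ?thesis by (rule DERIV_imp_deriv)
  qed
  with z B(1) der cont show ?thesis by (intro that[of "B + 1"]) auto
qed

text \<open>
Integration by parts for a function that is the integral of \<open>v\<close>: write both \<open>u\<close> and the test
function as integrals of their derivatives and exchange the order of integration over the
triangle \<open>y \<le> x\<close>.
\<close>
lemma FTC_imp_weak_deriv:
  assumes [measurable]: "v \<in> borel_measurable borel"
    and int: "\<And>a b. integrable lborel (\<lambda>x. v x * indicator {a<..b} x)"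
    and FTC: "\<And>a b. a \<le> b \<Longrightarrow> (LINT x|lborel. v x * indicator {a<..b} x) = u b - u a"
    and cu: "continuous_on UNIV u"
  shows "has_weak_deriv u v"
  unfolding has_weak_deriv_def
proof (intro conjI ballI)
  show "locally_integrable u" by (rule locally_integrable_continuous[OF cu])
  show "locally_integrable v"
    unfolding locally_integrable_def
  proof (intro allI impI)
    fix K :: "real set" assume "compact K"
    then obtain B where B: "\<And>x. x \<in> K \<Longrightarrow> norm x \<le> B" using compact_imp_bounded bounded_iff by metis
    have "integrable lborel (\<lambda>x. indicator K x *\<^sub>R (v x * indicator {- B - 1<..B} x))"
      using \<open>compact K\<close> int by (intro integrable_mult_indicator) (auto intro: borel_closed compact_imp_closed)
    moreover have "(\<lambda>x. indicator K x *\<^sub>R (v x * indicator {- B - 1<..B} x)) = (\<lambda>x. indicator K x *\<^sub>R v x)"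
    proof
      fix x show "indicator K x *\<^sub>R (v x * indicator {- B - 1<..B} x) = indicator K x *\<^sub>R v x"
      proof (cases "x \<in> K")
        case True
        then have "x \<in> {- B - 1<..B}" using B[of x] by (auto simp: abs_le_iff)
        then show ?thesis by simp
      qed simp
    qed
    ultimately have "integrable lborel (\<lambda>x. indicator K x *\<^sub>R v x)" by (simp only:)
    then show "set_integrable lebesgue K v"
      unfolding set_integrable_def by (rule lborel_integrable_imp_lebesgue)
  qed
  fix \<phi> assume "\<phi> \<in> Cc_infinity (UNIV :: real set)"
  then obtain S where S: "0 < S" and der: "\<And>x. (\<phi> has_real_derivative deriv \<phi> x) (at x)"
    and cd: "continuous_on UNIV (deriv \<phi>)"
    and z: "\<And>x. S \<le> \<bar>x\<bar> \<Longrightarrow> \<phi> x = 0" "\<And>x. S \<le> \<bar>x\<bar> \<Longrightarrow> deriv \<phi> x = 0"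
    by (rule Cc_infinity_UNIV_E) (rule that; assumption)
  have [measurable]: "deriv \<phi> \<in> borel_measurable borel" "\<phi> \<in> borel_measurable borel" "u \<in> borel_measurable borel"
    using cd cu der DERIV_isCont
    by (auto intro!: borel_measurable_continuous_onI continuous_at_imp_continuous_on)
  obtain C where C: "\<And>x. \<bar>deriv \<phi> x\<bar> \<le> C"
  proof -
    have "compact (deriv \<phi> ` {-S..S})"
      by (intro compact_continuous_image continuous_on_subset[OF cd]) auto
    then obtain C where C: "\<And>x. x \<in> {-S..S} \<Longrightarrow> norm (deriv \<phi> x) \<le> C"
      using compact_imp_bounded bounded_iff by (metis imageI)
    have "\<bar>deriv \<phi> x\<bar> \<le> max C 0" for x
      using C[of x] z(2)[of x] by (cases "x \<in> {-S..S}") (auto simp: max_def)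
    then show ?thesis by (rule that)
  qed
  define f where "f x y = v y * indicator {-S<..S} y * (deriv \<phi> x * indicator {-S<..S} x * indicator {y..} x)" for x y
  have vS: "integrable lborel (\<lambda>y. v y * indicator {-S<..S} y)" by (rule int)
  have indS: "integrable lborel (\<lambda>x. indicator {-S<..S} x :: real)"
    using S by (intro integrable_real_indicator) auto
  have fb: "\<bar>f x y\<bar> \<le> (C * indicator {-S<..S} x) * \<bar>v y * indicator {-S<..S} y\<bar>" for x y
  proof -
    have "\<bar>f x y\<bar> = \<bar>v y * indicator {-S<..S} y\<bar> * (\<bar>deriv \<phi> x\<bar> * indicator {-S<..S} x * indicator {y..} x)"
      by (simp add: f_def abs_mult)
    also have "\<dots> \<le> \<bar>v y * indicator {-S<..S} y\<bar> * (C * indicator {-S<..S} x * 1)"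
      using C[of x] C[of 0] by (intro mult_left_mono mult_mono) (auto simp: indicator_def)
    finally show ?thesis by (simp add: mult_ac)
  qed
  have fm: "(\<lambda>(x, y). f x y) \<in> borel_measurable (lborel \<Otimes>\<^sub>M lborel)"
  proof -
    have "(\<lambda>(x, y). f x y) = (\<lambda>p. v (snd p) * indicator {-S<..S} (snd p) *
      (deriv \<phi> (fst p) * indicator {-S<..S} (fst p) * (if snd p \<le> fst p then 1 else 0)))"
      by (auto simp: f_def indicator_def fun_eq_iff)
    also have "\<dots> \<in> borel_measurable (lborel \<Otimes>\<^sub>M lborel)" by measurable
    finally show ?thesis .
  qed
  have fx: "integrable lborel (\<lambda>y. f x y)" for x
  proof (rule Bochner_Integration.integrable_bound[of _ "\<lambda>y. (C * indicator {-S<..S} x) * \<bar>v y * indicator {-S<..S} y\<bar>"])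
    show "integrable lborel (\<lambda>y. (C * indicator {-S<..S} x) * \<bar>v y * indicator {-S<..S} y\<bar>)"
      by (intro integrable_mult_right integrable_abs vS)
    have "(\<lambda>y. f x y) = (\<lambda>y. v y * indicator {-S<..S} y * (deriv \<phi> x * indicator {-S<..S} x * (if y \<le> x then 1 else 0)))"
      by (auto simp: f_def indicator_def fun_eq_iff)
    also have "\<dots> \<in> borel_measurable lborel" by measurable
    finally show "(\<lambda>y. f x y) \<in> borel_measurable lborel" .
    show "AE y in lborel. norm (f x y) \<le> norm (C * indicator {-S<..S} x * \<bar>v y * indicator {-S<..S} y\<bar>)"
      by (rule AE_I2) (use fb in \<open>auto intro: order_trans[OF _ abs_ge_self]\<close>)
  qed
  have "integrable (lborel \<Otimes>\<^sub>M lborel) (\<lambda>(x, y). f x y)"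
  proof (rule lborel_pair.Fubini_integrable[OF fm])
    show "AE x in lborel. integrable lborel (\<lambda>y. case (x, y) of (x, y) \<Rightarrow> f x y)" using fx by simp
    have "integrable lborel (\<lambda>x. LINT y|lborel. norm (f x y))"
    proof (rule Bochner_Integration.integrable_bound[of _ "\<lambda>x. (C * (LINT y|lborel. \<bar>v y * indicator {-S<..S} y\<bar>)) * indicator {-S<..S} x"])
      show "integrable lborel (\<lambda>x. (C * (LINT y|lborel. \<bar>v y * indicator {-S<..S} y\<bar>)) * indicator {-S<..S} x)"
        by (intro integrable_mult_right indS)
      show "(\<lambda>x. LINT y|lborel. norm (f x y)) \<in> borel_measurable lborel"
        using fm by (intro lborel.borel_measurable_lebesgue_integral) (simp add: split_def)
      show "AE x in lborel. norm (LINT y|lborel. norm (f x y)) \<le>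
          norm (C * (LINT y|lborel. \<bar>v y * indicator {-S<..S} y\<bar>) * indicator {-S<..S} x)"
      proof (rule AE_I2)
        fix x
        have "(LINT y|lborel. norm (f x y)) \<le> (LINT y|lborel. (C * indicator {-S<..S} x) * \<bar>v y * indicator {-S<..S} y\<bar>)"
          using fb fx vS by (intro integral_mono integrable_norm integrable_mult_right integrable_abs) auto
        also have "\<dots> = C * (LINT y|lborel. \<bar>v y * indicator {-S<..S} y\<bar>) * indicator {-S<..S} x"
          by (simp add: mult_ac)
        finally show "norm (LINT y|lborel. norm (f x y)) \<le>
          norm (C * (LINT y|lborel. \<bar>v y * indicator {-S<..S} y\<bar>) * indicator {-S<..S} x)"
          using Bochner_Integration.integral_nonneg[of lborel "\<lambda>y. norm (f x y)"] by simp
      qed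
    qed
    then show "integrable lborel (\<lambda>x. LINT y|lborel. norm (case (x, y) of (x, y) \<Rightarrow> f x y))" by simp
  qed
  then have Fub: "(LINT y|lborel. LINT x|lborel. f x y) = (LINT x|lborel. LINT y|lborel. f x y)"
    by (rule lborel_pair.Fubini_integral)
  have intd: "(LINT x|lborel. deriv \<phi> x * indicator {a..b} x) = \<phi> b - \<phi> a" if "a \<le> b" for a b
    using cd by (intro integral_FTC_Icc_real that der) (simp add: continuous_on_eq_continuous_at)
  have L: "(LINT x|lborel. f x y) = - (v y * \<phi> y)" for y
  proof (cases "y \<in> {-S<..S}")
    case True
    have "(\<lambda>x. f x y) = (\<lambda>x. v y * (deriv \<phi> x * indicator {y..S} x))"
      using True by (auto simp: f_def indicator_def fun_eq_iff)
    then have "(LINT x|lborel. f x y) = v y * (\<phi> S - \<phi> y)" using True intd[of y S] by simp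
    then show ?thesis using z(1)[of S] S by simp
  next
    case False
    then have "S \<le> \<bar>y\<bar>" by auto
    then show ?thesis using False by (simp add: f_def z)
  qed
  \<comment> \<open>The constant \<open>u (- S)\<close> drops out in the end because the derivative of the test function has integral 0.\<close>
  have R: "(LINT y|lborel. f x y) = u x * deriv \<phi> x - u (-S) * deriv \<phi> x" for x
  proof (cases "x \<in> {-S<..S}")
    case True
    have "(\<lambda>y. f x y) = (\<lambda>y. (v y * indicator {-S<..x} y) * deriv \<phi> x)"
      using True by (auto simp: f_def indicator_def fun_eq_iff)
    then have "(LINT y|lborel. f x y) = (u x - u (-S)) * deriv \<phi> x" using True FTC[of "-S" x] by simp
    then show ?thesis by (simp add: algebra_simps)
  next
    case False
    then have "S \<le> \<bar>x\<bar>" by auto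
    then show ?thesis using False by (simp add: f_def z)
  qed
  have supp: "deriv \<phi> x * indicator {-S..S} x = deriv \<phi> x" for x
    using z(2)[of x] by (cases "x \<in> {-S..S}") auto
  have cont_int: "integrable lborel (\<lambda>x. g x * deriv \<phi> x)" if "continuous_on UNIV g" for g
  proof -
    have "integrable lborel (\<lambda>x. indicator {-S..S} x *\<^sub>R (g x * deriv \<phi> x))"
      by (intro borel_integrable_compact continuous_on_mult continuous_on_subset[OF cd] continuous_on_subset[OF that]) auto
    moreover have "(\<lambda>x. indicator {-S..S} x *\<^sub>R (g x * deriv \<phi> x)) = (\<lambda>x. g x * deriv \<phi> x)"
    proof
      fix x show "indicator {-S..S} x *\<^sub>R (g x * deriv \<phi> x) = g x * deriv \<phi> x"
        using supp[of x] by (metis mult.assoc mult.commute real_scaleR_def)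
    qed
    ultimately show ?thesis by simp
  qed
  have "(LINT x|lborel. u x * deriv \<phi> x - u (-S) * deriv \<phi> x) = (LINT x|lborel. u x * deriv \<phi> x) - u (-S) * (LINT x|lborel. deriv \<phi> x)"
    using cont_int[OF cu] cont_int[of "\<lambda>x. u (-S)"] by (subst Bochner_Integration.integral_diff) auto
  also have "(LINT x|lborel. deriv \<phi> x) = 0"
    using intd[of "-S" S] S z(1)[of S] z(1)[of "-S"] by (simp add: supp)
  finally have "(LINT x|lborel. u x * deriv \<phi> x) = - (LINT x|lborel. v x * \<phi> x)"
    using Fub by (simp add: L R)
  then show "(LINT x|lebesgue. u x * deriv \<phi> x) = - (LINT x|lebesgue. v x * \<phi> x)"
    by (subst (1 2) integral_completion) auto
qed

lemma lipschitz_weakly_differentiable: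
  assumes "\<And>x y. \<bar>u x - u y\<bar> \<le> \<bar>x - y\<bar>"
  shows "has_weak_deriv u (weak_deriv u)"
proof -
  obtain v where "v \<in> borel_measurable borel"
    "\<And>a b. integrable lborel (\<lambda>x. v x * indicator {a<..b} x)"
    "\<And>a b. a \<le> b \<Longrightarrow> (LINT x|lborel. v x * indicator {a<..b} x) = u b - u a"
    using lipschitz_has_density[OF assms] by metis
  then have "has_weak_deriv u v"
    using lipschitz_imp_measurable(1)[OF assms] by (intro FTC_imp_weak_deriv) auto
  then show ?thesis unfolding weak_deriv_def using someI[of "has_weak_deriv u" v] by simp
qed

section \<open>Sobolev norms of Lipschitz functions\<close>

text \<open>
Restricting to rational end points makes the supremum of the difference quotients countable,
which is what measurability in time of the norm relies on.
\<close>
definition slope_pairs :: "(real \<times> real) set" where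
  "slope_pairs = {(p, q). p \<in> \<rat> \<and> q \<in> \<rat> \<and> p < q}"

lemma countable_slope_pairs: "countable slope_pairs"
  by (rule countable_subset[of _ "\<rat> \<times> \<rat>"]) (auto simp: slope_pairs_def countable_rat)

lemma slope_pairs_nonempty: "(0, 1) \<in> slope_pairs"
  by (simp add: slope_pairs_def)

lemma rational_dense_le:
  fixes g :: "real \<Rightarrow> real"
  assumes "continuous_on UNIV g" "\<And>q. q \<in> \<rat> \<Longrightarrow> g q \<le> c"
  shows "g x \<le> c"
proof -
  have "closed {x. g x \<le> c}" using assms(1) by (intro closed_Collect_le continuous_intros)
  then have "closure \<rat> \<subseteq> {x. g x \<le> c}" using assms(2) by (intro closure_minimal) auto
  then show ?thesis using Rats_closure_real by auto
qed

lemma Linf_norm_not_MInf: "Linf_norm u \<noteq> - \<infinity>"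
proof
  assume MInf: "Linf_norm u = - \<infinity>"
  have "AE x in lebesgue. ereal \<bar>u x\<bar> \<le> Linf_norm u" unfolding Linf_norm_def by (rule esssup_AE)
  then have "AE x in lebesgue. x \<notin> (UNIV :: real set)" unfolding MInf by eventually_elim simp
  then have "UNIV \<in> null_sets (lebesgue :: real measure)" by (subst AE_iff_null_sets) auto
  then show False by (simp add: null_sets_def)
qed

text \<open>
For a continuous function the set where a bound is violated is open, hence empty as soon as it
is null.
\<close>
lemma Linf_norm_continuous:
  assumes "continuous_on UNIV u"
  shows "Linf_norm u = (SUP q\<in>\<rat>. ereal \<bar>u q\<bar>)"
proof (rule antisym)
  have m: "(\<lambda>x. ereal \<bar>u x\<bar>) \<in> borel_measurable lebesgue"
    using borel_measurable_continuous_onI[OF assms] by (intro borel_measurable_ereal borel_imp_lebesgue_measurable borel_measurable_abs)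
  show "Linf_norm u \<le> (SUP q\<in>\<rat>. ereal \<bar>u q\<bar>)" (is "_ \<le> ?S")
    unfolding Linf_norm_def
  proof (rule esssup_I[OF m], rule AE_I2)
    fix x
    show "ereal \<bar>u x\<bar> \<le> ?S"
    proof (cases ?S)
      case (real c)
      have "ereal \<bar>u q\<bar> \<le> ereal c" if "q \<in> \<rat>" for q
        unfolding real[symmetric] using that by (rule SUP_upper)
      then have "\<bar>u q\<bar> \<le> c" if "q \<in> \<rat>" for q using that by simp
      then have "\<bar>u x\<bar> \<le> c"
        by (rule rational_dense_le[of "\<lambda>x. \<bar>u x\<bar>" c x, rotated]) (assumption, intro continuous_on_rabs assms)
      then show ?thesis using real by simp
    next
      case MInf
      have "ereal \<bar>u 0\<bar> \<le> ?S" by (rule SUP_upper) auto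
      then show ?thesis using MInf by simp
    qed simp
  qed
  show "?S \<le> Linf_norm u"
  proof (rule SUP_least)
    fix q :: real
    have ae: "AE x in lebesgue. ereal \<bar>u x\<bar> \<le> Linf_norm u" unfolding Linf_norm_def by (rule esssup_AE)
    show "ereal \<bar>u q\<bar> \<le> Linf_norm u"
    proof (cases "Linf_norm u")
      case (real c)
      have o: "open {x. c < \<bar>u x\<bar>}" using assms by (intro open_Collect_less continuous_intros)
      have "AE x in lebesgue. \<not> c < \<bar>u x\<bar>" using ae real by (simp add: not_less)
      moreover have "{x. c < \<bar>u x\<bar>} \<in> sets lebesgue"
        using o by (intro sets_completionI_sets) simp
      ultimately have "{x. c < \<bar>u x\<bar>} \<in> null_sets lebesgue"
        by (subst AE_iff_null_sets) auto
      then have "negligible {x. c < \<bar>u x\<bar>}" by (simp add: negligible_iff_null_sets)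
      then have "{x. c < \<bar>u x\<bar>} = {}" using open_not_negligible[OF o] by blast
      then show ?thesis using real by (auto simp: not_less)
    next
      case MInf
      then show ?thesis using Linf_norm_not_MInf by blast
    qed simp
  qed
qed

lemma locally_integrable_interval:
  assumes "locally_integrable v"
  shows "integrable lebesgue (\<lambda>x. v x * indicator {p<..q} x)"
proof -
  have "integrable lebesgue (\<lambda>x. (indicator {p..q} x * v x) * indicator {p<..q} x)"
  proof (rule integrable_mult_bounded[where C = 1])
    show "integrable lebesgue (\<lambda>x. indicator {p..q} x * v x)"
      using assms by (rule locally_integrable_mult_indicator) simp
    show "indicator {p<..q} \<in> borel_measurable lebesgue" by (rule borel_measurable_indicator) simp
  qed (simp add: indicator_def)
  moreover have "(\<lambda>x. (indicator {p..q} x * v x) * indicator {p<..q} x) = (\<lambda>x. v x * indicator {p<..q} x)"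
    by (auto simp: indicator_def)
  ultimately show ?thesis by simp
qed

lemma locally_integrable_affine:
  assumes "locally_integrable v"
  shows "locally_integrable (\<lambda>x. c + d * v x)"
  unfolding locally_integrable_def set_integrable_def
proof (intro allI impI)
  fix K :: "real set" assume K: "compact K"
  have 1: "integrable lebesgue (\<lambda>x. indicator K x * v x)" by (rule locally_integrable_mult_indicator[OF assms K])
  have "integrable lborel (\<lambda>x. indicator K x *\<^sub>R c)"
    by (rule borel_integrable_compact[OF K]) (rule continuous_on_const)
  then have 2: "integrable lebesgue (\<lambda>x. indicator K x *\<^sub>R c)" by (rule lborel_integrable_imp_lebesgue)
  have "integrable lebesgue (\<lambda>x. indicator K x *\<^sub>R c + d * (indicator K x * v x))"
    by (rule Bochner_Integration.integrable_add[OF 2 integrable_mult_right[OF 1]])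
  moreover have "(\<lambda>x. indicator K x *\<^sub>R c + d * (indicator K x * v x)) = (\<lambda>x. indicator K x *\<^sub>R (c + d * v x))"
    by (auto simp: algebra_simps)
  ultimately show "integrable lebesgue (\<lambda>x. indicator K x *\<^sub>R (c + d * v x))" by simp
qed

lemma AE_abs_le_of_interval_integrals:
  assumes v: "locally_integrable v"
    and le: "\<And>p q. p \<le> q \<Longrightarrow> \<bar>LINT x|lebesgue. v x * indicator {p<..q} x\<bar> \<le> c * (q - p)"
  shows "AE x in lebesgue. \<bar>v x\<bar> \<le> c"
proof -
  have I: "(LINT x|lebesgue. (c + d * v x) * indicator {p<..q} x) = c * (q - p) + d * (LINT x|lebesgue. v x * indicator {p<..q} x)"
    if "p \<le> q" for p q d
  proof -
    have "(\<lambda>x. (c + d * v x) * indicator {p<..q} x) = (\<lambda>x. c * indicator {p<..q} x + d * (v x * indicator {p<..q} x))"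
      by (auto simp: algebra_simps)
    then show ?thesis
      using locally_integrable_interval[OF v, of p q] integral_indicator_Ioc[of p q] that
      by (simp only:) (subst Bochner_Integration.integral_add; simp)
  qed
  have "AE x in lebesgue. 0 \<le> c + d * v x" if d: "d = 1 \<or> d = - 1" for d
  proof (rule AE_nonneg_of_interval_integrals[OF locally_integrable_affine[OF v]])
    fix p q :: real assume pq: "p \<le> q"
    show "0 \<le> (LINT x|lebesgue. (c + d * v x) * indicator {p<..q} x)"
      unfolding I[OF pq] using le[OF pq] d by (auto simp: abs_le_iff)
  qed
  then have "AE x in lebesgue. 0 \<le> c + 1 * v x" "AE x in lebesgue. 0 \<le> c + (- 1) * v x"
    by blast+
  then show ?thesis by eventually_elim (simp add: abs_le_iff)
qed

text \<open>
Difference quotients are averages of the weak derivative and therefore at most its essential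
bound; conversely a bound on all averages over intervals bounds the function almost everywhere.
\<close>
lemma Linf_norm_weak_deriv:
  assumes lip: "\<And>x y. \<bar>u x - u y\<bar> \<le> \<bar>x - y\<bar>" and wd: "has_weak_deriv u v"
  shows "Linf_norm v = (SUP (p, q)\<in>slope_pairs. ereal (\<bar>u q - u p\<bar> / (q - p)))"
    "(SUP (p, q)\<in>slope_pairs. ereal (\<bar>u q - u p\<bar> / (q - p))) \<le> 1"
proof -
  let ?S = "SUP (p, q)\<in>slope_pairs. ereal (\<bar>u q - u p\<bar> / (q - p))"
  note FTC = weak_deriv_FTC[OF wd lip]
  have v: "locally_integrable v" using wd by (simp add: has_weak_deriv_def)
  have vm: "v \<in> borel_measurable lebesgue"
  proof (rule borel_measurable_LIMSEQ_real)
    show "(\<lambda>n. indicator {- real n..real n} x * v x) \<longlonglongrightarrow> v x" for x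
    proof (rule tendsto_eventually)
      obtain m where m: "\<bar>x\<bar> < real m" using reals_Archimedean2 by blast
      show "\<forall>\<^sub>F n in sequentially. indicator {- real n..real n} x * v x = v x"
        using eventually_ge_at_top[of m]
      proof eventually_elim
        case (elim n)
        then have "real m \<le> real n" by simp
        then have "x \<in> {- real n..real n}" using m by auto
        then show ?case by simp
      qed
    qed
    show "(\<lambda>x. indicator {- real n..real n} x * v x) \<in> borel_measurable lebesgue" for n
      using locally_integrable_mult_indicator[OF v, of "{- real n..real n}"] by auto
  qed
  show S1: "?S \<le> 1"
  proof (rule SUP_least, clarify)
    fix p q :: real assume "(p, q) \<in> slope_pairs"
    then have "p < q" by (simp add: slope_pairs_def)
    then have "\<bar>u q - u p\<bar> / (q - p) \<le> 1" using lip[of q p] by (simp add: divide_le_eq_1)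
    then show "ereal (\<bar>u q - u p\<bar> / (q - p)) \<le> 1" by (simp add: one_ereal_def)
  qed
  have S0: "0 \<le> ?S"
    by (rule SUP_upper2[OF slope_pairs_nonempty]) (simp add: zero_ereal_def)
  obtain c where c: "?S = ereal c" using S0 S1 by (cases ?S) auto
  have up: "\<bar>u q - u p\<bar> \<le> c * \<bar>q - p\<bar>" for p q
  proof -
    have rat: "\<bar>u q - u p\<bar> \<le> c * \<bar>q - p\<bar>" if "p \<in> \<rat>" "q \<in> \<rat>" for p q
    proof -
      have lt: "\<bar>u q - u p\<bar> \<le> c * (q - p)" if "p \<in> \<rat>" "q \<in> \<rat>" "p < q" for p q
      proof -
        have "(p, q) \<in> slope_pairs" using that by (simp add: slope_pairs_def)
        then have "ereal (\<bar>u q - u p\<bar> / (q - p)) \<le> ?S" by (rule SUP_upper2) simp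
        then show ?thesis unfolding c using that by (simp add: divide_le_eq)
      qed
      show ?thesis using lt[of p q] lt[of q p] that
        by (cases p q rule: linorder_cases) (auto simp: abs_minus_commute)
    qed
    have cu: "continuous_on UNIV u" by (rule lipschitz_imp_measurable(1)[OF lip])
    have 1: "\<bar>u q - u p\<bar> - c * \<bar>q - p\<bar> \<le> 0" if "q \<in> \<rat>" for p q
      by (rule rational_dense_le[of "\<lambda>p. \<bar>u q - u p\<bar> - c * \<bar>q - p\<bar>"])
        (use rat that in \<open>auto intro!: continuous_intros cu\<close>)
    have "\<bar>u q - u p\<bar> - c * \<bar>q - p\<bar> \<le> 0" for q
      by (rule rational_dense_le[of "\<lambda>q. \<bar>u q - u p\<bar> - c * \<bar>q - p\<bar>"])
        (use 1 in \<open>auto intro!: continuous_intros cu\<close>)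
    then show ?thesis by simp
  qed
  show "Linf_norm v = ?S"
  proof (rule antisym)
    have "AE x in lebesgue. \<bar>v x\<bar> \<le> c"
    proof (rule AE_abs_le_of_interval_integrals[OF v])
      fix p q :: real assume "p \<le> q"
      then show "\<bar>LINT x|lebesgue. v x * indicator {p<..q} x\<bar> \<le> c * (q - p)"
        using up[of q p] FTC[of p q] by simp
    qed
    then show "Linf_norm v \<le> ?S"
      unfolding Linf_norm_def c
      using vm by (intro esssup_I borel_measurable_ereal borel_measurable_abs) auto
    show "?S \<le> Linf_norm v"
    proof (rule SUP_least, clarify)
      fix p q assume pq: "(p, q) \<in> slope_pairs"
      then have "p < q" by (simp add: slope_pairs_def)
      have ae: "AE x in lebesgue. ereal \<bar>v x\<bar> \<le> Linf_norm v" unfolding Linf_norm_def by (rule esssup_AE)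
      show "ereal (\<bar>u q - u p\<bar> / (q - p)) \<le> Linf_norm v"
      proof (cases "Linf_norm v")
        case (real b)
        have "u q - u p = (LINT x|lebesgue. v x * indicator {p<..q} x)" using FTC[of p q] \<open>p < q\<close> by simp
        then have "\<bar>u q - u p\<bar> \<le> (LINT x|lebesgue. \<bar>v x * indicator {p<..q} x\<bar>)"
          by (simp only: integral_abs_bound)
        also have "\<dots> \<le> (LINT x|lebesgue. b * indicator {p<..q} x)"
        proof (rule integral_mono_AE)
          show "integrable lebesgue (\<lambda>x. \<bar>v x * indicator {p<..q} x\<bar>)"
            by (rule integrable_abs) (rule locally_integrable_interval[OF v])
          show "integrable lebesgue (\<lambda>x. b * indicator {p<..q} x)"
            by (rule integrable_mult_right) (rule integral_indicator_Ioc)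
          show "AE x in lebesgue. \<bar>v x * indicator {p<..q} x\<bar> \<le> b * indicator {p<..q} x"
            using ae unfolding real by eventually_elim (auto simp: indicator_def)
        qed
        also have "\<dots> = b * (q - p)" using integral_indicator_Ioc[of p q] \<open>p < q\<close> by simp
        finally show ?thesis using real \<open>p < q\<close> by (simp add: divide_le_eq)
      next
        case MInf
        then show ?thesis using Linf_norm_not_MInf by blast
      qed simp
    qed
  qed
qed

text \<open>
Finiteness is immediate from the two bounds. The point is measurability in time: the weak
derivative is only chosen separately for each time, but its norm is a countable supremum of
difference quotients, each of which is continuous in time.
\<close>
lemma lipschitz_in_x_imp_Linf_W1inf:
  fixes f :: "real \<Rightarrow> real \<Rightarrow> real"
  assumes cont: "continuous_on (UNIV \<times> {0..T}) (\<lambda>(x, t). f x t)"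
    and lip: "\<And>t x y. 0 \<le> t \<Longrightarrow> \<bar>f x t - f y t\<bar> \<le> \<bar>x - y\<bar>"
    and B: "\<And>t x. 0 \<le> t \<Longrightarrow> \<bar>f x t\<bar> \<le> B"
  shows "f \<in> Linf_W1inf T"
proof -
  define n0 where "n0 t = (SUP q\<in>\<rat>. ereal \<bar>f q t\<bar>)" for t
  define n1 where "n1 t = (SUP (p, q)\<in>slope_pairs. ereal (\<bar>f q t - f p t\<bar> / (q - p)))" for t
  have wd: "has_weak_deriv (\<lambda>x. f x t) (weak_deriv (\<lambda>x. f x t))" if "0 \<le> t" for t
    by (rule lipschitz_weakly_differentiable) (rule lip[OF that])
  have norm: "W1inf_norm (\<lambda>x. f x t) = n0 t + n1 t" "n1 t \<le> 1" if "0 \<le> t" for t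
    using Linf_norm_continuous[of "\<lambda>x. f x t"] lipschitz_imp_measurable(1)[of "\<lambda>x. f x t", OF lip[OF that]]
      Linf_norm_weak_deriv[of "\<lambda>x. f x t", OF lip[OF that] wd[OF that]]
    by (auto simp: W1inf_norm_def n0_def n1_def)
  have n0: "n0 t \<le> ereal B" if "0 \<le> t" for t
    unfolding n0_def by (rule SUP_least) (use B[OF that] in simp)
  have le: "W1inf_norm (\<lambda>x. f x t) \<le> ereal (B + 1)" if "0 \<le> t" for t
    using add_mono[OF n0[OF that] norm(2)[OF that]] unfolding norm(1)[OF that] by (simp add: one_ereal_def)
  have fm: "(\<lambda>t. f x t) \<in> borel_measurable (lebesgue_on {0..T})" for x
  proof -
    have "continuous_on {0..T} (\<lambda>t. (\<lambda>(x, t). f x t) (x, t))"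
      by (rule continuous_on_compose2[OF cont]) (auto intro!: continuous_intros)
    then show ?thesis by (intro continuous_imp_measurable_on_sets_lebesgue) auto
  qed
  have "n0 \<in> borel_measurable (lebesgue_on {0..T})"
    unfolding n0_def using fm by (intro borel_measurable_SUP countable_rat borel_measurable_ereal borel_measurable_abs)
  moreover have "n1 \<in> borel_measurable (lebesgue_on {0..T})"
    unfolding n1_def split_def using fm
    by (intro borel_measurable_SUP countable_slope_pairs borel_measurable_ereal borel_measurable_abs
        borel_measurable_divide borel_measurable_diff borel_measurable_const)
  ultimately have "(\<lambda>t. n0 t + n1 t) \<in> borel_measurable (lebesgue_on {0..T})"
    by (rule borel_measurable_ereal_add)
  then have meas: "(\<lambda>t. W1inf_norm (\<lambda>x. f x t)) \<in> borel_measurable (lebesgue_on {0..T})"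
    by (rule measurable_cong[THEN iffD1, rotated]) (simp add: norm)
  have "esssup (lebesgue_on {0..T}) (\<lambda>t. W1inf_norm (\<lambda>x. f x t)) \<le> ereal (B + 1)"
    by (rule esssup_I[OF meas], rule AE_I2) (simp add: le)
  then have "esssup (lebesgue_on {0..T}) (\<lambda>t. W1inf_norm (\<lambda>x. f x t)) < \<infinity>"
    by (rule le_less_trans) simp
  moreover have "AE t in lebesgue_on {0..T}. (\<lambda>x. f x t) \<in> W1inf"
  proof (rule AE_I2)
    fix t assume "t \<in> space (lebesgue_on {0..T})"
    then have "0 \<le> t" by simp
    then show "(\<lambda>x. f x t) \<in> W1inf"
      using wd[of t] le_less_trans[OF le[of t], of \<infinity>] by (auto simp: W1inf_def weakly_differentiable_def)
  qed
  moreover have "(\<lambda>(x, t). f x t) \<in> borel_measurable (lebesgue_on (UNIV \<times> {0..T}))"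
    by (rule continuous_imp_measurable_on_sets_lebesgue[OF cont])
      (intro sets_completionI_sets, simp add: borel_closed closed_Times)
  ultimately show ?thesis by (simp add: Linf_W1inf_def)
qed

section \<open>A difference scheme with two maximum principles\<close>

text \<open>
The heights \<open>g\<close> live on the integers and are measured in units of the mesh width, so that
differences of neighbours are slopes. The flux between \<open>i\<close> and \<open>i + 1\<close> is seen from the midpoint
of that cell, which stays at distance at least \<open>1 / 2\<close> from all lattice points.
\<close>
definition mid :: "(int \<Rightarrow> real) \<Rightarrow> int \<Rightarrow> real" where
  "mid g i = (g i + g (i + 1)) / 2"

definition gap :: "int \<Rightarrow> int \<Rightarrow> real" where
  "gap i j = real_of_int i - real_of_int j + 1 / 2"

definition ang :: "(int \<Rightarrow> real) \<Rightarrow> int \<Rightarrow> int \<Rightarrow> real" where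
  "ang g i j = arctan ((mid g i - g j) / gap i j)"

text \<open>
The range of integration is cut off independently of the position \<open>i\<close>. A window moving along
with \<open>i\<close> would contribute boundary terms to the second differences of the flux.
\<close>
definition window :: "nat \<Rightarrow> int set" where
  "window J = {- int J..int J}"

text \<open>
A bound for the sum of \<open>1 / \<bar>gap i j\<bar>\<close> over the window, uniform in \<open>i\<close>; it grows like the
logarithm of \<open>J\<close>.
\<close>
definition kernel_mass :: "nat \<Rightarrow> real" where
  "kernel_mass J = 2 * (\<Sum>k\<le>2 * J. 1 / (real k + 1 / 2))"

text \<open>
One explicit Euler step. The last summand is numerical viscosity; it pays for the errors in the
maximum principles, and its coefficient is matched to the factor in front of the flux.
\<close>
definition step :: "nat \<Rightarrow> (int \<Rightarrow> real) \<Rightarrow> int \<Rightarrow> real" where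
  "step J g i = g i
     + 1 / (3 * kernel_mass J) * (\<Sum>j\<in>window J. ang g i j - ang g (i - 1) j)
     + 1 / 6 * (g (i + 1) - 2 * g i + g (i - 1))"

lemma finite_window [simp]: "finite (window J)" by (simp add: window_def)

lemma kernel_mass_ge: "4 \<le> kernel_mass J"
proof -
  have "(\<Sum>k\<in>{0}. 1 / (real k + 1 / 2)) \<le> (\<Sum>k\<le>2 * J. 1 / (real k + 1 / 2))"
    by (intro sum_mono2) auto
  then show ?thesis by (simp add: kernel_mass_def)
qed

lemma gap_nonzero [simp]: "gap i j \<noteq> 0"
proof
  assume "gap i j = 0"
  then have "real_of_int (2 * (i - j) + 1) = 0" by (simp add: gap_def)
  then have "2 * (i - j) + 1 = 0" by linarith
  then show False by presburger
qed

lemma gap_pos_iff: "0 < gap i j \<longleftrightarrow> j \<le> i" "gap i j < 0 \<longleftrightarrow> i < j"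
  by (auto simp: gap_def; linarith)+

text \<open>
Moving \<open>i\<close> to the nearest position adjacent to the window only shortens the gaps. From there the
gaps to either side are distinct numbers among \<open>1 / 2, 3 / 2, 5 / 2\<close> and so on.
\<close>
lemma sum_inverse_gap: "(\<Sum>j\<in>window J. 1 / \<bar>gap i j\<bar>) \<le> kernel_mass J"
proof -
  define c where "c = max (- int J - 1) (min i (int J))"
  have "1 / \<bar>gap i j\<bar> \<le> 1 / \<bar>gap c j\<bar>" if "j \<in> window J" for j
  proof (rule divide_left_mono)
    consider "i > int J" "c = int J" | "i < - int J - 1" "c = - int J - 1" | "c = i"
      unfolding c_def by linarith
    then show "\<bar>gap c j\<bar> \<le> \<bar>gap i j\<bar>"
    proof cases
      case 1
      then have "real_of_int j \<le> real_of_int c" "real_of_int c \<le> real_of_int i" using that by (auto simp: window_def)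
      then show ?thesis by (simp add: gap_def)
    next
      case 2
      then have "real_of_int (c + 1) \<le> real_of_int j" "real_of_int i \<le> real_of_int c"
        using that by (auto simp: window_def)
      then show ?thesis by (simp add: gap_def)
    qed simp
    show "0 < \<bar>gap i j\<bar> * \<bar>gap c j\<bar>" by simp
  qed simp
  then have "(\<Sum>j\<in>window J. 1 / \<bar>gap i j\<bar>) \<le> (\<Sum>j\<in>window J. 1 / \<bar>gap c j\<bar>)"
    by (rule sum_mono)
  also have "\<dots> = (\<Sum>j\<in>window J \<inter> {..c}. 1 / \<bar>gap c j\<bar>) + (\<Sum>j\<in>window J - {..c}. 1 / \<bar>gap c j\<bar>)"
    by (rule sum.Int_Diff) simp
  also have "(\<Sum>j\<in>window J \<inter> {..c}. 1 / \<bar>gap c j\<bar>) = (\<Sum>k\<in>(\<lambda>j. nat (c - j)) ` (window J \<inter> {..c}). 1 / (real k + 1 / 2))"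
    by (subst sum.reindex) (auto simp: inj_on_def gap_def intro!: sum.cong)
  also have "\<dots> \<le> (\<Sum>k\<le>2 * J. 1 / (real k + 1 / 2))"
    by (intro sum_mono2) (auto simp: window_def c_def)
  also have "(\<Sum>j\<in>window J - {..c}. 1 / \<bar>gap c j\<bar>) = (\<Sum>k\<in>(\<lambda>j. nat (j - c - 1)) ` (window J - {..c}). 1 / (real k + 1 / 2))"
  proof (subst sum.reindex)
    show "inj_on (\<lambda>j. nat (j - c - 1)) (window J - {..c})" by (auto simp: inj_on_def)
    show "(\<Sum>j\<in>window J - {..c}. 1 / \<bar>gap c j\<bar>) =
      sum ((\<lambda>k. 1 / (real k + 1 / 2)) \<circ> (\<lambda>j. nat (j - c - 1))) (window J - {..c})"
    proof (rule sum.cong[OF refl])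
      fix j assume "j \<in> window J - {..c}"
      then have "c + 1 \<le> j" by simp
      then have "real_of_int (c + 1) \<le> real_of_int j" "real (nat (j - c - 1)) = real_of_int j - real_of_int c - 1"
        by (auto simp only: of_int_le_iff)
      then show "1 / \<bar>gap c j\<bar> = ((\<lambda>k. 1 / (real k + 1 / 2)) \<circ> (\<lambda>j. nat (j - c - 1))) j"
        by (simp add: gap_def)
    qed
  qed
  also have "\<dots> \<le> (\<Sum>k\<le>2 * J. 1 / (real k + 1 / 2))"
    by (intro sum_mono2) (auto simp: window_def c_def)
  finally show ?thesis by (simp add: kernel_mass_def)
qed

lemma arctan_lipschitz: "arctan x \<le> arctan y + \<bar>x - y\<bar>"
proof (cases "y \<le> x")
  case True
  have "y - arctan y \<le> x - arctan x"
  proof (rule DERIV_nonneg_imp_nondecreasing[OF True])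
    fix z :: real
    have "inverse (1 + z\<^sup>2) \<le> 1" by (simp add: field_simps add_pos_nonneg)
    then show "\<exists>d. DERIV (\<lambda>x. x - arctan x) z :> d \<and> 0 \<le> d"
      by (intro exI[of _ "1 - inverse (1 + z\<^sup>2)"]) (auto intro!: derivative_eq_intros)
  qed
  then show ?thesis using True by simp
next
  case False
  then have "arctan x \<le> arctan y" by (simp add: arctan_le_iff)
  then show ?thesis by simp
qed

lemma arctan_lipschitz_abs: "\<bar>arctan x - arctan y\<bar> \<le> \<bar>x - y\<bar>"
  using arctan_lipschitz[of x y] arctan_lipschitz[of y x] by simp

text \<open>
The heart of the matter: the second difference, in the position of the observer, of the angle
under which a fixed point is seen is nonpositive when the observer moves along a line of slope 1
and the secants have slopes in \<open>[-1, 1]\<close>. With the fixed point as origin the observer sits at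
\<open>(\<alpha> + t, s * \<alpha> + t)\<close>. The angle changes at a rate inversely proportional to the squared
distance, and the distance at time \<open>t\<close> is at least the distance at time \<open>- t\<close>.
\<close>
lemma arctan_second_difference:
  fixes s \<alpha> :: real
  assumes "\<bar>s\<bar> \<le> 1" "1 < \<alpha>"
  shows "arctan ((s * \<alpha> + 1) / (\<alpha> + 1)) + arctan ((s * \<alpha> - 1) / (\<alpha> - 1)) \<le> 2 * arctan s"
proof -
  define k where "k t = arctan ((s * \<alpha> + t) / (\<alpha> + t))" for t
  define d where "d t = ((1 - s) * \<alpha>) / ((\<alpha> + t)\<^sup>2 + (s * \<alpha> + t)\<^sup>2)" for t
  have k: "(k has_real_derivative d t) (at t)" if "\<bar>t\<bar> \<le> 1" for t
  proof -
    have p: "\<alpha> + t > 0" using that assms by linarith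
    have "(k has_real_derivative
       inverse (1 + ((s * \<alpha> + t) / (\<alpha> + t))\<^sup>2) * ((1 * (\<alpha> + t) - (s * \<alpha> + t) * 1) / ((\<alpha> + t) * (\<alpha> + t)))) (at t)"
      unfolding k_def using p by (auto intro!: derivative_eq_intros)
    moreover have "inverse (1 + ((s * \<alpha> + t) / (\<alpha> + t))\<^sup>2) * ((1 * (\<alpha> + t) - (s * \<alpha> + t) * 1) / ((\<alpha> + t) * (\<alpha> + t))) = d t"
    proof -
      have "1 + ((s * \<alpha> + t) / (\<alpha> + t))\<^sup>2 = ((\<alpha> + t)\<^sup>2 + (s * \<alpha> + t)\<^sup>2) / (\<alpha> + t)\<^sup>2"
        using p by (simp only: power_divide) (simp add: add_divide_distrib)
      moreover have "1 * (\<alpha> + t) - (s * \<alpha> + t) * 1 = (1 - s) * \<alpha>" by (simp add: algebra_simps)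
      moreover have "inverse (A / (\<alpha> + t)\<^sup>2) * (B / ((\<alpha> + t) * (\<alpha> + t))) = B / A" for A B
        using p by (simp add: power2_eq_square divide_inverse mult_ac)
      ultimately show ?thesis unfolding d_def by metis
    qed
    ultimately show ?thesis by simp
  qed
  have "k 1 + k (- 1) \<le> k 0 + k (- 0)"
  proof (rule DERIV_nonpos_imp_nonincreasing[of 0 1 "\<lambda>t. k t + k (- t)"])
    fix t :: real assume t: "0 \<le> t" "t \<le> 1"
    have "((\<lambda>t. k t + k (- t)) has_real_derivative d t + d (- t) * (-1)) (at t)"
    proof (rule DERIV_add)
      show "(k has_real_derivative d t) (at t)" using t by (intro k) auto
      show "((\<lambda>t. k (- t)) has_real_derivative d (- t) * (-1)) (at t)"
        by (rule DERIV_chain2[OF k]) (use t in \<open>auto intro!: derivative_eq_intros\<close>)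
    qed
    moreover have "d t \<le> d (- t)"
      unfolding d_def
    proof (rule divide_left_mono)
      have "0 \<le> 4 * t * (\<alpha> * (1 + s))" using t assms by (intro mult_nonneg_nonneg) auto
      then show "(\<alpha> + - t)\<^sup>2 + (s * \<alpha> + - t)\<^sup>2 \<le> (\<alpha> + t)\<^sup>2 + (s * \<alpha> + t)\<^sup>2"
        by (simp add: power2_eq_square algebra_simps)
      have "(\<alpha> + t)\<^sup>2 > 0" "(\<alpha> + - t)\<^sup>2 > 0" using t assms by (auto simp: zero_less_power2)
      then show "0 < ((\<alpha> + t)\<^sup>2 + (s * \<alpha> + t)\<^sup>2) * ((\<alpha> + - t)\<^sup>2 + (s * \<alpha> + - t)\<^sup>2)"
        by (intro mult_pos_pos add_pos_nonneg) auto
    qed (use assms in auto)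
    ultimately show "\<exists>y. ((\<lambda>t. k t + k (- t)) has_real_derivative y) (at t) \<and> y \<le> 0"
      by (intro exI[of _ "d t + d (- t) * (-1)"]) auto
  qed simp
  then show ?thesis using assms by (simp add: k_def)
qed

text \<open>
The bookkeeping common to both maximum principles, where \<open>d\<close> is the distance to the extremal
value. The flux may lower \<open>d i\<close> by multiples of \<open>d i\<close> and of its neighbours. The factor \<open>1 /
(3 * kernel_mass J)\<close> makes the own part at most \<open>2 / 3\<close>, because the kernel mass is at least 4,
and the neighbours' parts equal to \<open>1 / 6\<close>; after the viscosity has acted, \<open>d\<close> consists of
exactly these amounts.
\<close>
lemma absorb_deficits:
  fixes d :: "int \<Rightarrow> real"
  assumes S: "S \<le> 4 * d i + kernel_mass J * (d i + (d (i + 1) + d (i - 1)) / 2)"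
    and d: "\<And>i. 0 \<le> d i"
  shows "1 / (3 * kernel_mass J) * S \<le> d i + 1 / 6 * (d (i + 1) - 2 * d i + d (i - 1))"
proof -
  have H: "4 \<le> kernel_mass J" by (rule kernel_mass_ge)
  have "1 / (3 * kernel_mass J) * S \<le> 1 / (3 * kernel_mass J) * (4 * d i + kernel_mass J * (d i + (d (i + 1) + d (i - 1)) / 2))"
    using S H by (intro mult_left_mono) auto
  also have "\<dots> = 4 / kernel_mass J * (d i / 3) + (d i + (d (i + 1) + d (i - 1)) / 2) / 3"
    using H by (simp add: field_simps)
  also have "\<dots> \<le> 1 * (d i / 3) + (d i + (d (i + 1) + d (i - 1)) / 2) / 3"
    using H d[of i] by (intro add_mono mult_right_mono) auto
  also have "\<dots> = d i + 1 / 6 * (d (i + 1) - 2 * d i + d (i - 1))" by (simp add: field_simps)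
  finally show ?thesis .
qed

lemma sum_delta_le: "(\<Sum>j\<in>window J. if j = i then c else 0) \<le> (c::real)" if "0 \<le> c"
  using that by (simp add: sum.delta)

text \<open>
Seen from a maximum of \<open>g\<close>, all other points lie below, and moving from \<open>i - 1\<close> to \<open>i\<close> decreases
the angle under which a point below the observer's height is seen. If the observer is lower by
\<open>c1\<close> or \<open>c0\<close>, the angle to the point \<open>j\<close> changes by at most that deficit over the gap.
\<close>
lemma step_le_bound:
  assumes "\<And>i. g i \<le> B"
  shows "step J g i \<le> B"
proof -
  define d where "d i = B - g i" for i
  have d: "0 \<le> d i" for i using assms by (simp add: d_def)
  define c1 where "c1 = (d i + d (i + 1)) / 2"
  define c0 where "c0 = (d i + d (i - 1)) / 2"
  have c: "0 \<le> c1" "0 \<le> c0" using d by (auto simp: c1_def c0_def add_nonneg_nonneg)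
  have T: "ang g i j - ang g (i - 1) j \<le> (if j = i then 2 * d i else 0) + (c1 * (1 / \<bar>gap i j\<bar>) + c0 * (1 / \<bar>gap (i - 1) j\<bar>))" for j
  proof (cases "j = i")
    case True
    have "(mid g i - g j) / gap i j = g (i + 1) - g i"
      by (simp add: True mid_def gap_def field_simps)
    then have "ang g i j = arctan (g (i + 1) - g i)"
      by (simp add: ang_def)
    also have "\<dots> \<le> arctan (d i)" using assms[of "i + 1"] by (simp add: d_def arctan_le_iff)
    also have "\<dots> \<le> d i" using arctan_lipschitz[of "d i" 0] d[of i] by simp
    finally have 1: "ang g i j \<le> d i" .
    have "(mid g (i - 1) - g j) / gap (i - 1) j = g i - g (i - 1)"
      by (simp add: True mid_def gap_def field_simps)
    then have "ang g (i - 1) j = arctan (g i - g (i - 1))"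
      by (simp add: ang_def)
    moreover have "arctan (- d i) \<le> arctan (g i - g (i - 1))"
      using assms[of "i - 1"] by (simp only: d_def arctan_le_iff)
    moreover have "arctan (d i) \<le> d i" using arctan_lipschitz[of "d i" 0] d[of i] by simp
    ultimately have 2: "- d i \<le> ang g (i - 1) j" by (simp add: arctan_minus)
    have "0 \<le> c1 * (1 / \<bar>gap i j\<bar>) + c0 * (1 / \<bar>gap (i - 1) j\<bar>)" using c by simp
    then show ?thesis using 1 2 True by simp
  next
    case False
    have "ang g i j \<le> arctan (d j / gap i j) + \<bar>(mid g i - g j) / gap i j - d j / gap i j\<bar>"
      unfolding ang_def by (rule arctan_lipschitz)
    also have "(mid g i - g j) / gap i j - d j / gap i j = - c1 / gap i j"
      by (simp add: mid_def d_def c1_def field_simps)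
    also have "\<bar>- c1 / gap i j\<bar> = c1 * (1 / \<bar>gap i j\<bar>)" using c by (simp add: abs_divide)
    finally have 1: "ang g i j \<le> arctan (d j / gap i j) + c1 * (1 / \<bar>gap i j\<bar>)" .
    have "arctan (d j / gap (i - 1) j) \<le> ang g (i - 1) j + \<bar>d j / gap (i - 1) j - (mid g (i - 1) - g j) / gap (i - 1) j\<bar>"
      unfolding ang_def by (rule arctan_lipschitz)
    also have "d j / gap (i - 1) j - (mid g (i - 1) - g j) / gap (i - 1) j = c0 / gap (i - 1) j"
      by (simp add: mid_def d_def c0_def field_simps)
    also have "\<bar>c0 / gap (i - 1) j\<bar> = c0 * (1 / \<bar>gap (i - 1) j\<bar>)" using c by (simp add: abs_divide)
    finally have 2: "arctan (d j / gap (i - 1) j) \<le> ang g (i - 1) j + c0 * (1 / \<bar>gap (i - 1) j\<bar>)" .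
    \<comment> \<open>The gaps to \<open>j\<close> have equal sign except at \<open>j = i\<close>, where the difference of angles has to be estimated directly.\<close>
    have "1 / gap i j \<le> 1 / gap (i - 1) j"
    proof (cases "j < i")
      case True
      then have "0 < gap (i - 1) j" "0 < gap i j" by (auto simp: gap_pos_iff)
      moreover have "gap (i - 1) j \<le> gap i j" by (simp add: gap_def)
      ultimately show ?thesis by (intro divide_left_mono) auto
    next
      case False
      with \<open>j \<noteq> i\<close> have "gap i j < 0" "gap (i - 1) j < 0" by (auto simp: gap_pos_iff)
      moreover have "gap (i - 1) j \<le> gap i j" by (simp add: gap_def)
      ultimately show ?thesis by (intro divide_left_mono) (auto intro: mult_neg_neg)
    qed
    then have "d j * (1 / gap i j) \<le> d j * (1 / gap (i - 1) j)"
      using d by (intro mult_left_mono) auto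
    then have "arctan (d j / gap i j) \<le> arctan (d j / gap (i - 1) j)"
      by (simp add: arctan_le_iff)
    then show ?thesis using 1 2 False by simp
  qed
  have "(\<Sum>j\<in>window J. ang g i j - ang g (i - 1) j)
      \<le> (\<Sum>j\<in>window J. (if j = i then 2 * d i else 0) + (c1 * (1 / \<bar>gap i j\<bar>) + c0 * (1 / \<bar>gap (i - 1) j\<bar>)))"
    by (intro sum_mono T)
  also have "\<dots> = (\<Sum>j\<in>window J. if j = i then 2 * d i else 0)
      + (c1 * (\<Sum>j\<in>window J. 1 / \<bar>gap i j\<bar>) + c0 * (\<Sum>j\<in>window J. 1 / \<bar>gap (i - 1) j\<bar>))"
    by (simp only: sum.distrib sum_distrib_left)
  also have "\<dots> \<le> 2 * d i + (c1 * kernel_mass J + c0 * kernel_mass J)"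
    using c d by (intro add_mono mult_left_mono sum_inverse_gap sum_delta_le) auto
  also have "\<dots> \<le> 4 * d i + kernel_mass J * (d i + (d (i + 1) + d (i - 1)) / 2)"
    using d[of i] by (simp add: c1_def c0_def field_simps)
  finally have "1 / (3 * kernel_mass J) * (\<Sum>j\<in>window J. ang g i j - ang g (i - 1) j)
      \<le> d i + 1 / 6 * (d (i + 1) - 2 * d i + d (i - 1))"
    using d by (rule absorb_deficits)
  moreover define X where "X = 1 / (3 * kernel_mass J) * (\<Sum>j\<in>window J. ang g i j - ang g (i - 1) j)"
  ultimately have "X \<le> d i + 1 / 6 * (d (i + 1) - 2 * d i + d (i - 1))" by simp
  moreover have "step J g i = g i + X + 1 / 6 * (g (i + 1) - 2 * g i + g (i - 1))"
    by (simp only: step_def X_def)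
  ultimately show ?thesis unfolding d_def by argo
qed

lemma slope_bound_imp_lipschitz:
  assumes v: "\<And>i. \<bar>g (i + 1) - g i\<bar> \<le> (1::real)"
  shows "\<bar>g i - g j\<bar> \<le> \<bar>real_of_int (i - j)\<bar>"
proof -
  have *: "\<bar>g (j + int n) - g j\<bar> \<le> real n" for n :: nat and j
  proof (induction n)
    case (Suc n)
    have "\<bar>g (j + int (Suc n)) - g j\<bar> \<le> \<bar>g (j + int n + 1) - g (j + int n)\<bar> + \<bar>g (j + int n) - g j\<bar>"
      by (simp add: add.assoc add.commute[of 1])
    then show ?case using Suc v[of "j + int n"] by simp
  qed simp
  show ?thesis
  proof (cases "j \<le> i")
    case True then show ?thesis using *[of j "nat (i - j)"] by simp
  next
    case False then show ?thesis using *[of i "nat (j - i)"] by (simp add: abs_minus_commute)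
  qed
qed

lemma secant_slope:
  assumes v: "\<And>i. \<bar>g (i + 1) - g i\<bar> \<le> (1::real)"
  shows "\<bar>mid g i - g j\<bar> \<le> \<bar>gap i j\<bar>"
proof -
  note i = slope_bound_imp_lipschitz[of g, OF v]
  have "\<bar>mid g i - g j\<bar> \<le> (\<bar>g i - g j\<bar> + \<bar>g (i + 1) - g j\<bar>) / 2"
    unfolding mid_def by (simp add: field_simps abs_if)
  also have "\<dots> \<le> (\<bar>real_of_int (i - j)\<bar> + \<bar>real_of_int (i + 1 - j)\<bar>) / 2"
    by (intro divide_right_mono add_mono i) auto
  also have "\<dots> = \<bar>gap i j\<bar>"
  proof (cases "j \<le> i")
    case True
    then have "real_of_int j \<le> real_of_int i" by simp
    then show ?thesis by (simp add: gap_def)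
  next
    case False
    then have "real_of_int (i + 1) \<le> real_of_int j" by (simp only: of_int_le_iff)
    then show ?thesis by (simp add: gap_def field_simps)
  qed
  finally show ?thesis .
qed

lemma secant_slope_le_1:
  assumes v: "\<And>i. \<bar>g (i + 1) - g i\<bar> \<le> (1::real)"
  shows "\<bar>(mid g i - g j) / gap i j\<bar> \<le> 1"
  using secant_slope[of g, OF v, of i j] by (simp add: abs_divide divide_le_eq_1)

text \<open>
The same argument for the slopes, with the second difference of the angle in place of the first.
At a point of slope 1 the midpoints to the right and left are \<open>mid g i + 1\<close> and \<open>mid g i - 1\<close>,
and \<open>arctan_second_difference\<close> applies; in general they are off by the averaged deficits \<open>a\<close> and
\<open>b\<close>. The bound on all secant slopes is needed too, so both bounds on the slope have to be
assumed at once.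
\<close>
lemma step_slope_le:
  assumes v: "\<And>i. \<bar>g (i + 1) - g i\<bar> \<le> (1::real)"
  shows "step J g (i + 1) - step J g i \<le> 1"
proof -
  define d where "d i = 1 - (g (i + 1) - g i)" for i
  have d: "0 \<le> d i" for i using v[of i] by (simp add: d_def)
  define a where "a = (d i + d (i + 1)) / 2"
  define b where "b = (d i + d (i - 1)) / 2"
  have c: "0 \<le> a" "0 \<le> b" using d by (auto simp: a_def b_def add_nonneg_nonneg)
  let ?T = "\<lambda>j. ang g (i + 1) j - 2 * ang g i j + ang g (i - 1) j"
  have mids: "mid g (i + 1) = mid g i + 1 - a" "mid g (i - 1) = mid g i - 1 + b"
    by (auto simp: mid_def a_def b_def d_def field_simps)
  have gaps: "gap (i + 1) j = gap i j + 1" "gap (i - 1) j = gap i j - 1" for j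
    by (auto simp: gap_def)
  have T: "?T j \<le> ((if j = i then 2 * d i else 0) + (if j = i + 1 then 2 * d i else 0))
     + (a * (1 / \<bar>gap (i + 1) j\<bar>) + b * (1 / \<bar>gap (i - 1) j\<bar>))" for j
  proof -
    have nn: "0 \<le> a * (1 / \<bar>gap (i + 1) j\<bar>) + b * (1 / \<bar>gap (i - 1) j\<bar>)" using c by simp
    show ?thesis
    \<comment> \<open>At the end points of the cell the gap is \<open>1 / 2\<close> in size and the angle is that of the slope of the cell itself.\<close>
    proof (cases "j = i \<or> j = i + 1")
      case True
      have le: "ang g k j \<le> arctan 1" for k
        unfolding ang_def arctan_le_iff using secant_slope_le_1[of g, OF v, of k j] by linarith
      have "(mid g i - g j) / gap i j = g (i + 1) - g i"
        using True by (auto simp: mid_def gap_def field_simps)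
      then have "arctan 1 \<le> ang g i j + \<bar>1 - (g (i + 1) - g i)\<bar>"
        using arctan_lipschitz[of 1 "g (i + 1) - g i"] by (simp add: ang_def)
      then have "arctan 1 \<le> ang g i j + d i" using d[of i] by (simp add: d_def)
      then have "?T j \<le> 2 * d i" using le[of "i + 1"] le[of "i - 1"] by linarith
      then show ?thesis using nn True d[of i] by auto
    next
      case False
      define \<alpha> where "\<alpha> = gap i j"
      define s where "s = (mid g i - g j) / \<alpha>"
      have s: "\<bar>s\<bar> \<le> 1" using secant_slope_le_1[of g, OF v] by (simp add: s_def \<alpha>_def)
      have D: "mid g i - g j = s * \<alpha>" by (simp add: s_def \<alpha>_def)
      have G: "gap (i + 1) j = \<alpha> + 1" "gap (i - 1) j = \<alpha> - 1" by (simp_all only: gaps \<alpha>_def)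
      have nz: "\<alpha> + 1 \<noteq> 0" "\<alpha> - 1 \<noteq> 0" using gap_nonzero[of "i + 1" j] gap_nonzero[of "i - 1" j] by (auto simp: gaps \<alpha>_def)
      have "ang g (i + 1) j \<le> arctan ((s * \<alpha> + 1) / (\<alpha> + 1)) + \<bar>(mid g (i + 1) - g j) / gap (i + 1) j - (s * \<alpha> + 1) / (\<alpha> + 1)\<bar>"
        unfolding ang_def by (rule arctan_lipschitz)
      also have "(mid g (i + 1) - g j) / gap (i + 1) j - (s * \<alpha> + 1) / (\<alpha> + 1) = - a / gap (i + 1) j"
        unfolding G mids D[symmetric] using nz by (simp add: divide_simps)
      also have "\<bar>- a / gap (i + 1) j\<bar> = a * (1 / \<bar>gap (i + 1) j\<bar>)" using c by (simp add: abs_divide)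
      finally have 1: "ang g (i + 1) j \<le> arctan ((s * \<alpha> + 1) / (\<alpha> + 1)) + a * (1 / \<bar>gap (i + 1) j\<bar>)" .
      have "ang g (i - 1) j \<le> arctan ((s * \<alpha> - 1) / (\<alpha> - 1)) + \<bar>(mid g (i - 1) - g j) / gap (i - 1) j - (s * \<alpha> - 1) / (\<alpha> - 1)\<bar>"
        unfolding ang_def by (rule arctan_lipschitz)
      also have "(mid g (i - 1) - g j) / gap (i - 1) j - (s * \<alpha> - 1) / (\<alpha> - 1) = b / gap (i - 1) j"
        unfolding G mids D[symmetric] using nz by (simp add: divide_simps)
      also have "\<bar>b / gap (i - 1) j\<bar> = b * (1 / \<bar>gap (i - 1) j\<bar>)" using c by (simp add: abs_divide)
      finally have 2: "ang g (i - 1) j \<le> arctan ((s * \<alpha> - 1) / (\<alpha> - 1)) + b * (1 / \<bar>gap (i - 1) j\<bar>)" .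
      have 3: "ang g i j = arctan s" by (simp add: ang_def s_def \<alpha>_def)
      have "arctan ((s * \<alpha> + 1) / (\<alpha> + 1)) + arctan ((s * \<alpha> - 1) / (\<alpha> - 1)) \<le> 2 * arctan s"
      proof (cases "j < i")
        case True
        then have "j + 1 \<le> i" by simp
        then have "real_of_int (j + 1) \<le> real_of_int i" by (simp only: of_int_le_iff)
        then have "1 < \<alpha>" by (simp add: \<alpha>_def gap_def)
        then show ?thesis by (rule arctan_second_difference[OF s])
      next
        case F: False
        then have "i + 2 \<le> j" using False by simp
        then have "real_of_int (i + 2) \<le> real_of_int j" by (simp only: of_int_le_iff)
        then have "1 < - \<alpha>" by (simp add: \<alpha>_def gap_def)
        from arctan_second_difference[OF s this]
        have "arctan ((s * (- \<alpha>) + 1) / (- \<alpha> + 1)) + arctan ((s * (- \<alpha>) - 1) / (- \<alpha> - 1)) \<le> 2 * arctan s" .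
        moreover have "(s * (- \<alpha>) + 1) / (- \<alpha> + 1) = (s * \<alpha> - 1) / (\<alpha> - 1)"
          "(s * (- \<alpha>) - 1) / (- \<alpha> - 1) = (s * \<alpha> + 1) / (\<alpha> + 1)"
          using nz by (auto simp: divide_simps) (auto simp: algebra_simps)
        ultimately show ?thesis by simp
      qed
      with 1 2 3 False show ?thesis by simp
    qed
  qed
  have "(\<Sum>j\<in>window J. ?T j) \<le> (\<Sum>j\<in>window J. ((if j = i then 2 * d i else 0) + (if j = i + 1 then 2 * d i else 0))
     + (a * (1 / \<bar>gap (i + 1) j\<bar>) + b * (1 / \<bar>gap (i - 1) j\<bar>)))"
    by (intro sum_mono T)
  also have "\<dots> = ((\<Sum>j\<in>window J. if j = i then 2 * d i else 0) + (\<Sum>j\<in>window J. if j = i + 1 then 2 * d i else 0))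
      + (a * (\<Sum>j\<in>window J. 1 / \<bar>gap (i + 1) j\<bar>) + b * (\<Sum>j\<in>window J. 1 / \<bar>gap (i - 1) j\<bar>))"
    by (simp only: sum.distrib sum_distrib_left)
  also have "\<dots> \<le> (2 * d i + 2 * d i) + (a * kernel_mass J + b * kernel_mass J)"
    using c d by (intro add_mono mult_left_mono sum_inverse_gap sum_delta_le) auto
  also have "\<dots> = 4 * d i + kernel_mass J * (d i + (d (i + 1) + d (i - 1)) / 2)"
    by (simp add: a_def b_def field_simps)
  finally have "1 / (3 * kernel_mass J) * (\<Sum>j\<in>window J. ?T j)
      \<le> d i + 1 / 6 * (d (i + 1) - 2 * d i + d (i - 1))"
    using d by (rule absorb_deficits)
  moreover have "(\<Sum>j\<in>window J. ?T j) = (\<Sum>j\<in>window J. ang g (i + 1) j - ang g i j) - (\<Sum>j\<in>window J. ang g i j - ang g (i - 1) j)"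
    unfolding sum_subtractf[symmetric] by (rule sum.cong) auto
  ultimately have "1 / (3 * kernel_mass J) * (\<Sum>j\<in>window J. ang g (i + 1) j - ang g i j)
      - 1 / (3 * kernel_mass J) * (\<Sum>j\<in>window J. ang g i j - ang g (i - 1) j)
      \<le> d i + 1 / 6 * (d (i + 1) - 2 * d i + d (i - 1))"
    by (simp only: right_diff_distrib)
  moreover define X where "X = 1 / (3 * kernel_mass J) * (\<Sum>j\<in>window J. ang g (i + 1) j - ang g i j)"
  moreover define Y where "Y = 1 / (3 * kernel_mass J) * (\<Sum>j\<in>window J. ang g i j - ang g (i - 1) j)"
  ultimately have "X - Y \<le> d i + 1 / 6 * (d (i + 1) - 2 * d i + d (i - 1))" by simp
  moreover have "step J g i = g i + Y + 1 / 6 * (g (i + 1) - 2 * g i + g (i - 1))"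
    by (simp only: step_def Y_def)
  moreover have "step J g (i + 1) = g (i + 1) + X + 1 / 6 * (g (i + 1 + 1) - 2 * g (i + 1) + g i)"
    by (simp add: step_def X_def)
  moreover have "g (i - 1 + 1) = g i" by simp
  ultimately show ?thesis unfolding d_def by argo
qed

text \<open>
The scheme commutes with reflection, so upper bounds imply lower bounds.
\<close>
lemma step_uminus: "step J (\<lambda>i. - g i) i = - step J g i"
proof -
  have "ang (\<lambda>i. - g i) i j = - ang g i j" for i j
  proof -
    have "(mid (\<lambda>i. - g i) i - - g j) / gap i j = - ((mid g i - g j) / gap i j)"
      by (simp add: mid_def field_simps)
    then show ?thesis by (simp add: ang_def arctan_minus)
  qed
  then show ?thesis by (simp add: step_def sum_subtractf algebra_simps)
qed

lemma step_slope_bound: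
  assumes v: "\<And>i. \<bar>g (i + 1) - g i\<bar> \<le> (1::real)"
  shows "\<bar>step J g (i + 1) - step J g i\<bar> \<le> 1"
proof -
  have "step J (\<lambda>i. - g i) (i + 1) - step J (\<lambda>i. - g i) i \<le> 1"
    by (rule step_slope_le) (use v in \<open>simp add: abs_minus_commute\<close>)
  then show ?thesis using step_slope_le[of g, OF v, of J i] by (simp add: step_uminus)
qed

lemma step_bound:
  assumes v: "\<And>i. \<bar>g i\<bar> \<le> B"
  shows "\<bar>step J g i\<bar> \<le> B"
proof -
  have "step J (\<lambda>i. - g i) i \<le> B"
    by (rule step_le_bound) (use v in \<open>simp add: abs_le_iff\<close>)
  moreover have "step J g i \<le> B"
    by (rule step_le_bound) (use v in \<open>simp add: abs_le_iff\<close>)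
  ultimately show ?thesis by (simp add: step_uminus abs_le_iff)
qed

section \<open>The flux from far away\<close>

text \<open>
Far and near are measured from the origin, not from the observer, so that the same points \<open>j\<close>
are summed for all observers and the sums can be subtracted term by term.
\<close>
definition far :: "nat \<Rightarrow> real \<Rightarrow> real \<Rightarrow> int set" where
  "far J h N = {j \<in> window J. N < \<bar>h * of_int j\<bar>}"

lemma finite_far [simp]: "finite (far J h N)" by (simp add: far_def)

lemma inverse_square_le_telescope: "1 / m\<^sup>2 \<le> 2 / m - 2 / (m + 1)" if "1 \<le> m" for m :: real
proof -
  have "2 / m - 2 / (m + 1) = 2 / (m * (m + 1))" using that by (simp add: divide_simps)
  moreover have "1 / m\<^sup>2 = 2 / (m * (2 * m))" by (simp add: power2_eq_square)
  moreover have "2 / (m * (2 * m)) \<le> 2 / (m * (m + 1))"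
    using that by (intro divide_left_mono mult_left_mono mult_pos_pos) auto
  ultimately show ?thesis by simp
qed

lemma sum_inverse_squares_tail:
  assumes "1 \<le> p"
  shows "(\<Sum>j=p..J. 1 / (real j)\<^sup>2) \<le> 2 / real p"
proof (cases "p \<le> J")
  case True
  have "(\<Sum>j=p..J. 1 / (real j)\<^sup>2) \<le> (\<Sum>j=p..J. 2 / real j - 2 / real (Suc j))"
  proof (rule sum_mono)
    fix j assume "j \<in> {p..J}"
    then have "1 \<le> real j" using assms by simp
    from inverse_square_le_telescope[OF this]
    show "1 / (real j)\<^sup>2 \<le> 2 / real j - 2 / real (Suc j)" by (simp add: add.commute)
  qed
  also have "\<dots> = 2 / real p - 2 / real (Suc J)"
    using sum_Suc_diff[of p J "\<lambda>j. - (2 / real j)"] True by simp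
  also have "\<dots> \<le> 2 / real p" by simp
  finally show ?thesis .
qed simp

lemma sum_far_inverse_squares:
  assumes h: "0 < h" and N: "0 < N"
  shows "(\<Sum>j\<in>far J h N. h * (1 / (h * of_int j)\<^sup>2)) \<le> 4 / N"
proof -
  define p where "p = nat \<lfloor>N / h\<rfloor> + 1"
  have p1: "1 \<le> p" by (simp add: p_def)
  have "0 \<le> \<lfloor>N / h\<rfloor>" using assms by simp
  then have p2: "N / h \<le> real p" unfolding p_def by (simp; linarith)
  let ?w = "\<lambda>j. 1 / (real_of_int j)\<^sup>2"
  have sub: "far J h N \<subseteq> int ` {p..J} \<union> (\<lambda>n. - int n) ` {p..J}"
  proof
    fix j assume j: "j \<in> far J h N"
    then have "N < h * real_of_int \<bar>j\<bar>" using h by (simp add: far_def abs_mult)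
    then have "N / h < real_of_int \<bar>j\<bar>" using h by (simp add: field_simps)
    then have "\<lfloor>N / h\<rfloor> < \<bar>j\<bar>" by (simp add: floor_less_iff)
    then have "p \<le> nat \<bar>j\<bar>" using \<open>0 \<le> \<lfloor>N / h\<rfloor>\<close> unfolding p_def by linarith
    moreover have "nat \<bar>j\<bar> \<le> J" using j by (auto simp: far_def window_def)
    ultimately have "nat \<bar>j\<bar> \<in> {p..J}" by simp
    moreover have "j = int (nat \<bar>j\<bar>) \<or> j = - int (nat \<bar>j\<bar>)" by auto
    ultimately show "j \<in> int ` {p..J} \<union> (\<lambda>n. - int n) ` {p..J}" by blast
  qed
  have "(\<Sum>j\<in>far J h N. ?w j) \<le> (\<Sum>j\<in>int ` {p..J} \<union> (\<lambda>n. - int n) ` {p..J}. ?w j)"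
    using sub by (intro sum_mono2) auto
  also have "\<dots> \<le> (\<Sum>j\<in>int ` {p..J}. ?w j) + (\<Sum>j\<in>(\<lambda>n. - int n) ` {p..J}. ?w j)"
    by (subst sum_Un) (auto intro!: sum_nonneg)
  also have "(\<Sum>j\<in>int ` {p..J}. ?w j) = (\<Sum>j=p..J. 1 / (real j)\<^sup>2)"
    by (subst sum.reindex) (auto simp: inj_on_def)
  also have "(\<Sum>j\<in>(\<lambda>n. - int n) ` {p..J}. ?w j) = (\<Sum>j=p..J. 1 / (real j)\<^sup>2)"
    by (subst sum.reindex) (auto simp: inj_on_def)
  also have "(\<Sum>j=p..J. 1 / (real j)\<^sup>2) + (\<Sum>j=p..J. 1 / (real j)\<^sup>2) \<le> 2 / real p + 2 / real p"
    by (intro add_mono sum_inverse_squares_tail p1)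
  also have "\<dots> = 4 / real p" by simp
  also have "\<dots> \<le> 4 / (N / h)" using p2 assms p1 by (intro divide_left_mono) auto
  finally have *: "(\<Sum>j\<in>far J h N. ?w j) \<le> 4 * h / N" by simp
  have "(\<Sum>j\<in>far J h N. h * (1 / (h * of_int j)\<^sup>2)) = (1 / h) * (\<Sum>j\<in>far J h N. ?w j)"
    unfolding sum_distrib_left using h by (intro sum.cong) (auto simp: power2_eq_square divide_simps)
  also have "\<dots> \<le> (1 / h) * (4 * h / N)" using h by (intro mult_left_mono *) auto
  finally show ?thesis using h by simp
qed

text \<open>
Quadratic accuracy suffices: the slopes of secants to a point at distance \<open>y\<close> are of order \<open>1 /
y\<close>, and their squares are summable.
\<close>
lemma arctan_linear_error: "\<bar>arctan s - s\<bar> \<le> s\<^sup>2"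
proof -
  have pos: "s - arctan s \<le> s\<^sup>2 \<and> arctan s \<le> s" if "0 \<le> s" for s
  proof -
    have "0\<^sup>2 - 0 + arctan 0 \<le> s\<^sup>2 - s + arctan s"
    proof (rule DERIV_nonneg_imp_nondecreasing[OF that])
      fix x :: real assume x: "0 \<le> x"
      have "1 - inverse (1 + x\<^sup>2) \<le> 2 * x"
      proof -
        have "0 \<le> x * (2 + x * (2 * x - 1))"
        proof (rule mult_nonneg_nonneg[OF x])
          have "2 + x * (2 * x - 1) = (3 / 2) + x\<^sup>2 + (x - 1 / 2)\<^sup>2 + 1 / 4" by (simp add: power2_eq_square algebra_simps)
          also have "\<dots> \<ge> 0" by (intro add_nonneg_nonneg) auto
          finally show "0 \<le> 2 + x * (2 * x - 1)" .
        qed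
        then have "x\<^sup>2 \<le> 2 * x * (1 + x\<^sup>2)" by (simp add: power2_eq_square algebra_simps)
        moreover have "0 < 1 + x\<^sup>2" by (simp add: add_pos_nonneg)
        ultimately have "x\<^sup>2 / (1 + x\<^sup>2) \<le> 2 * x" by (simp add: divide_le_eq)
        moreover have "1 - inverse (1 + x\<^sup>2) = x\<^sup>2 / (1 + x\<^sup>2)"
          using \<open>0 < 1 + x\<^sup>2\<close> by (simp add: divide_simps)
        ultimately show ?thesis by simp
      qed
      then show "\<exists>y. ((\<lambda>x. x\<^sup>2 - x + arctan x) has_real_derivative y) (at x) \<and> 0 \<le> y"
        by (intro exI[of _ "2 * x - 1 + inverse (1 + x\<^sup>2)"]) (auto intro!: derivative_eq_intros)
    qed
    then show ?thesis using arctan_lipschitz[of s 0] that by simp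
  qed
  show ?thesis
  proof (cases "0 \<le> s")
    case True then show ?thesis using pos[of s] by simp
  next
    case False then show ?thesis using pos[of "- s"] by (simp add: arctan_minus)
  qed
qed

lemma far_symmetric: "uminus ` far J h N = far J h N"
proof -
  have "- j \<in> far J h N" if "j \<in> far J h N" for j using that by (auto simp: far_def window_def)
  then show ?thesis by (force simp: image_iff)
qed

lemma far_distance:
  assumes "j \<in> far J h N" "\<bar>x\<bar> \<le> S" "2 * S \<le> N"
  shows "\<bar>h * real_of_int j\<bar> / 2 \<le> \<bar>x - h * real_of_int j\<bar>" "\<bar>h * real_of_int j\<bar> / 2 \<le> \<bar>x + h * real_of_int j\<bar>"
proof -
  have "N < \<bar>h * real_of_int j\<bar>" using assms(1) by (simp add: far_def)
  moreover define y where "y = h * real_of_int j"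
  ultimately have "N < \<bar>y\<bar>" by simp
  then have "\<bar>y\<bar> / 2 \<le> \<bar>x - y\<bar>" "\<bar>y\<bar> / 2 \<le> \<bar>x + y\<bar>" using assms(2,3) by linarith+
  then show "\<bar>h * real_of_int j\<bar> / 2 \<le> \<bar>x - h * real_of_int j\<bar>" "\<bar>h * real_of_int j\<bar> / 2 \<le> \<bar>x + h * real_of_int j\<bar>"
    by (simp_all add: y_def)
qed

lemma inverse_product_far:
  fixes y a b :: real
  assumes "0 < \<bar>y\<bar>" "\<bar>y\<bar> / 2 \<le> \<bar>a\<bar>" "\<bar>y\<bar> / 2 \<le> \<bar>b\<bar>"
  shows "1 / (\<bar>a\<bar> * \<bar>b\<bar>) \<le> 4 * (1 / y\<^sup>2)"
proof -
  have "1 / (\<bar>a\<bar> * \<bar>b\<bar>) \<le> 1 / ((\<bar>y\<bar> / 2) * (\<bar>y\<bar> / 2))"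
    using assms by (intro divide_left_mono mult_mono mult_pos_pos) auto
  also have "(\<bar>y\<bar> / 2) * (\<bar>y\<bar> / 2) = y\<^sup>2 / 4" by (simp add: power2_eq_square)
  finally show ?thesis by simp
qed

text \<open>
The kernel \<open>1 / (x - y)\<close> is not absolutely integrable at infinity. Pairing \<open>y\<close> with \<open>- y\<close> leaves
\<open>2 * x / (x\<^sup>2 - y\<^sup>2)\<close>, which is; here the symmetry of the window is used.
\<close>
lemma far_hilbert_kernel:
  assumes h: "0 < h" and N: "0 < N" and x: "\<bar>x\<bar> \<le> S" "2 * S \<le> N"
  shows "\<bar>\<Sum>j\<in>far J h N. h * (1 / (x - h * of_int j))\<bar> \<le> 16 * S / N"
proof -
  let ?s = "\<Sum>j\<in>far J h N. h * (1 / (x - h * of_int j))"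
  have S: "0 \<le> S" using x by linarith
  have "?s = (\<Sum>j\<in>uminus ` far J h N. h * (1 / (x - h * of_int j)))" by (simp add: far_symmetric)
  also have "\<dots> = (\<Sum>j\<in>far J h N. h * (1 / (x + h * of_int j)))"
    by (subst sum.reindex) (auto simp: inj_on_def)
  finally have "2 * ?s = (\<Sum>j\<in>far J h N. h * (1 / (x - h * of_int j)) + h * (1 / (x + h * of_int j)))"
    by (simp add: sum.distrib)
  then have "\<bar>2 * ?s\<bar> = \<bar>\<Sum>j\<in>far J h N. h * (1 / (x - h * of_int j)) + h * (1 / (x + h * of_int j))\<bar>"
    by (rule arg_cong)
  also have "\<dots> \<le> (\<Sum>j\<in>far J h N. \<bar>h * (1 / (x - h * of_int j)) + h * (1 / (x + h * of_int j))\<bar>)"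
    by (rule sum_abs)
  also have "\<dots> \<le> (\<Sum>j\<in>far J h N. 8 * S * (h * (1 / (h * of_int j)\<^sup>2)))"
  proof (rule sum_mono)
    fix j assume j: "j \<in> far J h N"
    define y where "y = h * real_of_int j"
    have "N < \<bar>y\<bar>" using j by (simp add: far_def y_def)
    then have y: "0 < \<bar>y\<bar>" using N by linarith
    have d: "\<bar>y\<bar> / 2 \<le> \<bar>x - y\<bar>" "\<bar>y\<bar> / 2 \<le> \<bar>x + y\<bar>" using far_distance[OF j x] by (auto simp: y_def)
    then have nz: "x - y \<noteq> 0" "x + y \<noteq> 0" using y by auto
    have "h * (1 / (x - y)) + h * (1 / (x + y)) = h * (2 * x) * (1 / ((x - y) * (x + y)))"
      using nz by (simp add: divide_simps) (simp add: algebra_simps)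
    then have "\<bar>h * (1 / (x - y)) + h * (1 / (x + y))\<bar> = \<bar>h * (2 * x) * (1 / ((x - y) * (x + y)))\<bar>"
      by (rule arg_cong)
    also have "\<dots> = h * (2 * \<bar>x\<bar>) * (1 / (\<bar>x - y\<bar> * \<bar>x + y\<bar>))"
      using h by (simp add: abs_mult)
    also have "\<dots> \<le> h * (2 * S) * (4 * (1 / y\<^sup>2))"
      using h x S y d by (intro mult_mono inverse_product_far) auto
    finally show "\<bar>h * (1 / (x - h * of_int j)) + h * (1 / (x + h * of_int j))\<bar> \<le> 8 * S * (h * (1 / (h * of_int j)\<^sup>2))"
      by (simp add: y_def mult_ac)
  qed
  also have "\<dots> = 8 * S * (\<Sum>j\<in>far J h N. h * (1 / (h * of_int j)\<^sup>2))"
    by (rule sum_distrib_left[symmetric])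
  also have "\<dots> \<le> 8 * S * (4 / N)"
    using S by (intro mult_left_mono sum_far_inverse_squares h N) auto
  finally show ?thesis by (simp add: abs_mult)
qed

text \<open>
The flux itself does not converge as the window grows, since a bounded height only gives
integrands of order \<open>1 / y\<close>. Differences between two positions do, with a tail of order \<open>1 / N\<close>.
Linearise the arctangent and split the secant slope \<open>(P i - h * g j) / (X i - h * j)\<close>: the part
with \<open>P i\<close> is the symmetric sum of \<open>far_hilbert_kernel\<close>, and in the part with \<open>g j\<close> the
difference of the two kernels decays quadratically.
\<close>
lemma far_flux_difference:
  assumes h: "0 < h" and N: "0 < N" and S: "2 * S \<le> N"
    and x: "\<bar>h * (of_int i + 1 / 2)\<bar> \<le> S" and x': "\<bar>h * (of_int i' + 1 / 2)\<bar> \<le> S"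
    and B: "\<And>i. \<bar>h * g i\<bar> \<le> B"
  shows "\<bar>h * (\<Sum>j\<in>far J h N. ang g i j - ang g i' j)\<bar> \<le> (128 * B\<^sup>2 + 64 * B * S) / N"
proof -
  have S0: "0 \<le> S" using x by linarith
  have B0: "0 \<le> B" using B[of 0] by linarith
  define X where "X i = h * (real_of_int i + 1 / 2)" for i
  define P where "P i = h * mid g i" for i
  have P: "\<bar>P i\<bar> \<le> B" for i
  proof -
    have P: "P i = (h * g i + h * g (i + 1)) / 2" by (simp add: P_def mid_def field_simps)
    have "\<bar>(a + b) / 2\<bar> \<le> B" if "\<bar>a\<bar> \<le> B" "\<bar>b\<bar> \<le> B" for a b :: real
      using that by (simp add: abs_le_iff)
    then show ?thesis unfolding P using B by blast
  qed
  define s where "s i j = (P i - h * g j) / (X i - h * of_int j)" for i j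
  have ang: "ang g i j = arctan (s i j)" for i j
  proof -
    have "s i j = (h * (mid g i - g j)) / (h * gap i j)"
      by (simp add: s_def P_def X_def gap_def algebra_simps)
    then show ?thesis using h by (simp add: ang_def)
  qed
  define w where "w j = h * (1 / (h * real_of_int j)\<^sup>2)" for j
  have W: "(\<Sum>j\<in>far J h N. w j) \<le> 4 / N" unfolding w_def by (rule sum_far_inverse_squares[OF h N])
  have E: "h * \<bar>arctan (s k j) - s k j\<bar> \<le> 16 * B\<^sup>2 * w j" if j: "j \<in> far J h N" and k: "\<bar>X k\<bar> \<le> S" for j k
  proof -
    define y where "y = h * real_of_int j"
    have "N < \<bar>y\<bar>" using j by (simp add: far_def y_def)
    then have y: "0 < \<bar>y\<bar>" using N by linarith
    have d: "\<bar>y\<bar> / 2 \<le> \<bar>X k - y\<bar>" using far_distance[OF j k S] by (auto simp: y_def)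
    have "(s k j)\<^sup>2 = (P k - h * g j)\<^sup>2 * (1 / (\<bar>X k - y\<bar> * \<bar>X k - y\<bar>))"
      by (simp add: s_def y_def power2_eq_square)
    also have "\<dots> \<le> (2 * B)\<^sup>2 * (4 * (1 / y\<^sup>2))"
    proof (intro mult_mono inverse_product_far y d)
      have "\<bar>P k - h * g j\<bar> \<le> 2 * B" using P[of k] B[of j] by linarith
      then show "(P k - h * g j)\<^sup>2 \<le> (2 * B)\<^sup>2" using B0 power_mono[of "\<bar>P k - h * g j\<bar>" "2 * B" 2] by simp
    qed auto
    finally have "\<bar>arctan (s k j) - s k j\<bar> \<le> 16 * B\<^sup>2 * (1 / y\<^sup>2)"
      using arctan_linear_error[of "s k j"] by (simp add: power2_eq_square)
    then have "h * \<bar>arctan (s k j) - s k j\<bar> \<le> h * (16 * B\<^sup>2 * (1 / y\<^sup>2))"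
      using h by (intro mult_left_mono) auto
    then show ?thesis by (simp add: w_def y_def mult_ac)
  qed
  define K where "K k = (\<Sum>j\<in>far J h N. h * (1 / (X k - h * of_int j)))" for k
  have K: "\<bar>P k * K k\<bar> \<le> B * (16 * S / N)" if k: "\<bar>X k\<bar> \<le> S" for k
    unfolding abs_mult K_def using P far_hilbert_kernel[OF h N k S] B0 by (intro mult_mono) auto
  define R where "R = (\<Sum>j\<in>far J h N. h * (h * g j) * (1 / (X i' - h * of_int j) - 1 / (X i - h * of_int j)))"
  have R: "\<bar>R\<bar> \<le> 8 * B * S * (4 / N)"
  proof -
    have "\<bar>R\<bar> \<le> (\<Sum>j\<in>far J h N. \<bar>h * (h * g j) * (1 / (X i' - h * of_int j) - 1 / (X i - h * of_int j))\<bar>)"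
      unfolding R_def by (rule sum_abs)
    also have "\<dots> \<le> (\<Sum>j\<in>far J h N. 8 * B * S * w j)"
    proof (rule sum_mono)
      fix j assume j: "j \<in> far J h N"
      define y where "y = h * real_of_int j"
      have "N < \<bar>y\<bar>" using j by (simp add: far_def y_def)
    then have y: "0 < \<bar>y\<bar>" using N by linarith
      have d: "\<bar>y\<bar> / 2 \<le> \<bar>X i - y\<bar>" "\<bar>y\<bar> / 2 \<le> \<bar>X i' - y\<bar>"
        using far_distance(1)[OF j _ S, of "X i"] far_distance(1)[OF j _ S, of "X i'"] x x' by (auto simp: y_def X_def)
      then have nz: "X i - y \<noteq> 0" "X i' - y \<noteq> 0" using y by auto
      have "1 / (X i' - y) - 1 / (X i - y) = (X i - X i') * (1 / ((X i - y) * (X i' - y)))"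
        using nz by (simp add: divide_simps)
      then have "\<bar>1 / (X i' - y) - 1 / (X i - y)\<bar> = \<bar>X i - X i'\<bar> * (1 / (\<bar>X i - y\<bar> * \<bar>X i' - y\<bar>))"
        by (simp add: abs_mult)
      also have "\<dots> \<le> (2 * S) * (4 * (1 / y\<^sup>2))"
        using x x' S0 by (intro mult_mono inverse_product_far y d) (auto simp: X_def)
      finally have q: "\<bar>1 / (X i' - y) - 1 / (X i - y)\<bar> \<le> (2 * S) * (4 * (1 / y\<^sup>2))" .
      have "\<bar>h * (h * g j) * (1 / (X i' - y) - 1 / (X i - y))\<bar> = h * (\<bar>h * g j\<bar> * \<bar>1 / (X i' - y) - 1 / (X i - y)\<bar>)"
        using h by (simp add: abs_mult)
      also have "\<dots> \<le> h * (B * ((2 * S) * (4 * (1 / y\<^sup>2))))"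
        using h B0 by (intro mult_left_mono mult_mono B q) auto
      finally show "\<bar>h * (h * g j) * (1 / (X i' - h * of_int j) - 1 / (X i - h * of_int j))\<bar> \<le> 8 * B * S * w j"
        by (simp add: w_def y_def mult_ac)
    qed
    also have "\<dots> \<le> 8 * B * S * (4 / N)"
      unfolding sum_distrib_left[symmetric] using B0 S0 by (intro mult_left_mono W) auto
    finally show ?thesis .
  qed
  define A where "A k = (\<Sum>j\<in>far J h N. h * (arctan (s k j) - s k j))" for k
  have A: "\<bar>A k\<bar> \<le> 16 * B\<^sup>2 * (4 / N)" if k: "\<bar>X k\<bar> \<le> S" for k
  proof -
    have "\<bar>A k\<bar> \<le> (\<Sum>j\<in>far J h N. \<bar>h * (arctan (s k j) - s k j)\<bar>)"
      unfolding A_def by (rule sum_abs)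
    also have "\<dots> \<le> (\<Sum>j\<in>far J h N. 16 * B\<^sup>2 * w j)"
      using E[OF _ k] h by (intro sum_mono) (auto simp: abs_mult)
    also have "\<dots> \<le> 16 * B\<^sup>2 * (4 / N)"
      unfolding sum_distrib_left[symmetric] by (intro mult_left_mono W) auto
    finally show ?thesis .
  qed
  have "h * (\<Sum>j\<in>far J h N. ang g i j - ang g i' j) = A i - A i' + P i * K i - P i' * K i' + R"
  proof -
    have "h * (ang g i j - ang g i' j) = h * (arctan (s i j) - s i j) - h * (arctan (s i' j) - s i' j)
        + P i * (h * (1 / (X i - h * of_int j))) - P i' * (h * (1 / (X i' - h * of_int j)))
        + h * (h * g j) * (1 / (X i' - h * of_int j) - 1 / (X i - h * of_int j))" for j
      by (simp add: ang s_def diff_divide_distrib algebra_simps)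
    then have "h * (\<Sum>j\<in>far J h N. ang g i j - ang g i' j) =
      (\<Sum>j\<in>far J h N. h * (arctan (s i j) - s i j) - h * (arctan (s i' j) - s i' j)
        + P i * (h * (1 / (X i - h * of_int j))) - P i' * (h * (1 / (X i' - h * of_int j)))
        + h * (h * g j) * (1 / (X i' - h * of_int j) - 1 / (X i - h * of_int j)))"
      unfolding sum_distrib_left by (intro sum.cong refl)
    then show ?thesis
      by (simp only: sum_distrib_left A_def K_def R_def sum.distrib sum_subtractf)
  qed
  then have "\<bar>h * (\<Sum>j\<in>far J h N. ang g i j - ang g i' j)\<bar> \<le> \<bar>A i\<bar> + \<bar>A i'\<bar> + \<bar>P i * K i\<bar> + \<bar>P i' * K i'\<bar> + \<bar>R\<bar>"
    by linarith
  also have "\<dots> \<le> 16 * B\<^sup>2 * (4 / N) + 16 * B\<^sup>2 * (4 / N) + B * (16 * S / N) + B * (16 * S / N) + 8 * B * S * (4 / N)"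
    using x x' by (intro add_mono A K R) (auto simp: X_def)
  also have "\<dots> = (128 * B\<^sup>2 + 64 * B * S) / N" by (simp add: add_divide_distrib)
  finally show ?thesis .
qed

definition near :: "nat \<Rightarrow> real \<Rightarrow> real \<Rightarrow> int set" where
  "near J h N = {j \<in> window J. \<bar>h * of_int j\<bar> \<le> N}"

lemma finite_near [simp]: "finite (near J h N)" by (simp add: near_def)

lemma sum_near_far: "sum f (window J) = sum f (near J h N) + sum f (far J h N)" for f :: "int \<Rightarrow> real"
proof -
  have "window J = near J h N \<union> far J h N" "near J h N \<inter> far J h N = {}"
    by (auto simp: near_def far_def)
  then show ?thesis by (metis sum.union_disjoint finite_near finite_far)
qed

lemma card_near: "h * real (card (near J h N)) \<le> 2 * N + h" if h: "0 < h" and N: "0 \<le> N"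
proof -
  define m where "m = \<lfloor>N / h\<rfloor>"
  have m: "0 \<le> m" "real_of_int m \<le> N / h" using h N by (auto simp: m_def)
  have "near J h N \<subseteq> {- m..m}"
  proof
    fix j assume "j \<in> near J h N"
    then have "h * real_of_int \<bar>j\<bar> \<le> N" using h by (simp add: near_def abs_mult)
    then have "real_of_int \<bar>j\<bar> \<le> N / h" using h by (simp add: field_simps)
    then have "\<bar>j\<bar> \<le> m" by (simp add: m_def le_floor_iff)
    then show "j \<in> {- m..m}" by auto
  qed
  then have "card (near J h N) \<le> card {- m..m}" by (intro card_mono) auto
  also have "\<dots> = nat (2 * m + 1)" by simp
  finally have "real (card (near J h N)) \<le> 2 * real_of_int m + 1" using m(1) by linarith
  also have "\<dots> \<le> 2 * (N / h) + 1" using m(2) by simp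
  finally have "h * real (card (near J h N)) \<le> h * (2 * (N / h) + 1)" using h by (intro mult_left_mono) auto
  then show ?thesis using h by (simp add: algebra_simps)
qed

lemma ang_bound: "\<bar>ang g i j\<bar> \<le> pi / 2"
  unfolding ang_def
  using arctan_lbound[of "(mid g i - g j) / gap i j"] arctan_ubound[of "(mid g i - g j) / gap i j"] by linarith

lemma near_flux_difference:
  assumes "0 < h" "0 \<le> N"
  shows "\<bar>h * (\<Sum>j\<in>near J h N. ang g i j - ang g i' j)\<bar> \<le> pi * (2 * N + h)"
proof -
  have "\<bar>\<Sum>j\<in>near J h N. ang g i j - ang g i' j\<bar> \<le> (\<Sum>j\<in>near J h N. \<bar>ang g i j - ang g i' j\<bar>)"
    by (rule sum_abs)
  also have "\<dots> \<le> (\<Sum>j\<in>near J h N. pi)"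
  proof (rule sum_mono)
    fix j show "\<bar>ang g i j - ang g i' j\<bar> \<le> pi" using ang_bound[of g i j] ang_bound[of g i' j] by linarith
  qed
  also have "\<dots> = pi * real (card (near J h N))" by simp
  finally have "h * \<bar>\<Sum>j\<in>near J h N. ang g i j - ang g i' j\<bar> \<le> h * (pi * real (card (near J h N)))"
    using assms by (intro mult_left_mono) auto
  also have "\<dots> = pi * (h * real (card (near J h N)))" by simp
  also have "\<dots> \<le> pi * (2 * N + h)" by (intro mult_left_mono card_near assms) auto
  finally show ?thesis using assms by (simp add: abs_mult)
qed

section \<open>Averages over windows\<close>

definition evolve :: "nat \<Rightarrow> (int \<Rightarrow> real) \<Rightarrow> nat \<Rightarrow> int \<Rightarrow> real" where
  "evolve J g n = (step J ^^ n) g"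

lemma evolve_0 [simp]: "evolve J g 0 = g" and evolve_Suc [simp]: "evolve J g (Suc n) = step J (evolve J g n)"
  by (auto simp: evolve_def)

lemma evolve_slope: "\<bar>evolve J g n (i + 1) - evolve J g n i\<bar> \<le> 1" if "\<And>i. \<bar>g (i + 1) - g i\<bar> \<le> 1"
proof (induction n arbitrary: i)
  case (Suc n)
  then show ?case using step_slope_bound[of "evolve J g n" J i] by simp
qed (simp add: that)

lemma evolve_bound: "\<bar>evolve J g n i\<bar> \<le> B" if "\<And>i. \<bar>g i\<bar> \<le> B"
proof (induction n arbitrary: i)
  case (Suc n)
  then show ?case using step_bound[of "evolve J g n" B J i] by simp
qed (simp add: that)

lemma sum_telescope_shift:
  fixes F :: "int \<Rightarrow> real"
  shows "(\<Sum>m<w. F (i + int m) - F (i + int m - 1)) = F (i + int w - 1) - F (i - 1)"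
proof (induction w)
  case (Suc w)
  have e: "i + int (Suc w) - 1 = i + int w" by simp
  show ?case unfolding sum.lessThan_Suc Suc e by simp
qed simp

text \<open>
A single value may move at an unbounded rate, as the flux varies only continuously in space.
Summed over \<open>w\<close> neighbouring cells, the differences of the flux and of the viscosity telescope
to the two ends of the range, and the flux difference between these is bounded uniformly in the
mesh and in \<open>J\<close>.
\<close>
lemma window_average_step:
  assumes h: "0 < h" "h \<le> 1" and N: "0 < N" "2 * S \<le> N"
    and B: "\<And>i. \<bar>h * g i\<bar> \<le> B" and v: "\<And>i. \<bar>g (i + 1) - g i\<bar> \<le> 1"
    and x: "\<bar>h * (of_int (i + int w - 1) + 1 / 2)\<bar> \<le> S" "\<bar>h * (of_int (i - 1) + 1 / 2)\<bar> \<le> S"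
  shows "\<bar>\<Sum>m<w. h * (step J g (i + int m) - g (i + int m))\<bar>
    \<le> 1 / (3 * kernel_mass J) * (pi * (2 * N + 1) + (128 * B\<^sup>2 + 64 * B * S) / N + h * kernel_mass J)"
proof -
  define H where "H = kernel_mass J"
  have H: "4 \<le> H" unfolding H_def by (rule kernel_mass_ge)
  define \<Phi> where "\<Phi> i = (\<Sum>j\<in>window J. ang g i j)" for i
  define V where "V i = g (i + 1) - g i" for i
  have "step J g k - g k = 1 / (3 * H) * (\<Phi> k - \<Phi> (k - 1)) + 1 / 6 * (V k - V (k - 1))" for k
    by (simp add: step_def H_def \<Phi>_def V_def sum_subtractf)
  then have "(\<Sum>m<w. h * (step J g (i + int m) - g (i + int m)))
     = (\<Sum>m<w. h * (1 / (3 * H) * (\<Phi> (i + int m) - \<Phi> (i + int m - 1)) + 1 / 6 * (V (i + int m) - V (i + int m - 1))))"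
    by simp
  also have "\<dots> = h * (1 / (3 * H) * (\<Sum>m<w. \<Phi> (i + int m) - \<Phi> (i + int m - 1)) + 1 / 6 * (\<Sum>m<w. V (i + int m) - V (i + int m - 1)))"
    by (simp only: sum_distrib_left sum.distrib distrib_left)
  also have "\<dots> = 1 / (3 * H) * (h * (\<Phi> (i + int w - 1) - \<Phi> (i - 1))) + h / 6 * (V (i + int w - 1) - V (i - 1))"
    unfolding sum_telescope_shift by (simp add: algebra_simps)
  finally have eq: "(\<Sum>m<w. h * (step J g (i + int m) - g (i + int m))) = \<dots>" .
  have "h * (\<Phi> (i + int w - 1) - \<Phi> (i - 1)) =
     h * (\<Sum>j\<in>near J h N. ang g (i + int w - 1) j - ang g (i - 1) j) + h * (\<Sum>j\<in>far J h N. ang g (i + int w - 1) j - ang g (i - 1) j)"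
    by (simp add: \<Phi>_def sum_subtractf sum_near_far[of _ J h N] algebra_simps)
  then have "\<bar>h * (\<Phi> (i + int w - 1) - \<Phi> (i - 1))\<bar> \<le> pi * (2 * N + h) + (128 * B\<^sup>2 + 64 * B * S) / N"
    using near_flux_difference[where h = h and N = N and J = J and g = g and i = "i + int w - 1" and i' = "i - 1"] far_flux_difference[where J = J and g = g, OF h(1) N x B] h N by linarith
  moreover have "pi * (2 * N + h) \<le> pi * (2 * N + 1)" using h by (intro mult_left_mono) auto
  ultimately have 1: "\<bar>h * (\<Phi> (i + int w - 1) - \<Phi> (i - 1))\<bar> \<le> pi * (2 * N + 1) + (128 * B\<^sup>2 + 64 * B * S) / N"
    by linarith
  have 2: "\<bar>V (i + int w - 1) - V (i - 1)\<bar> \<le> 2"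
    using v[of "i + int w - 1"] v[of "i - 1"] unfolding V_def by linarith
  have "\<bar>1 / (3 * H) * (h * (\<Phi> (i + int w - 1) - \<Phi> (i - 1))) + h / 6 * (V (i + int w - 1) - V (i - 1))\<bar>
     \<le> 1 / (3 * H) * \<bar>h * (\<Phi> (i + int w - 1) - \<Phi> (i - 1))\<bar> + h / 6 * \<bar>V (i + int w - 1) - V (i - 1)\<bar>"
    using H h by (intro order_trans[OF abs_triangle_ineq]) (simp add: abs_mult)
  also have "\<dots> \<le> 1 / (3 * H) * (pi * (2 * N + 1) + (128 * B\<^sup>2 + 64 * B * S) / N) + h / 6 * 2"
    using H h by (intro add_mono mult_left_mono 1 2) auto
  also have "\<dots> = 1 / (3 * H) * (pi * (2 * N + 1) + (128 * B\<^sup>2 + 64 * B * S) / N + h * H)"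
    using H by (simp add: field_simps)
  finally show ?thesis unfolding eq H_def .
qed

section \<open>Initial data\<close>

text \<open>
Dividing by \<open>h\<^sup>2\<close> rather than \<open>h\<close> expresses the mean value in units of the mesh width.
\<close>
definition cell_average :: "(real \<Rightarrow> real) \<Rightarrow> real \<Rightarrow> int \<Rightarrow> real" where
  "cell_average f0 h i = (LINT x|lebesgue. f0 x * indicator {h * of_int i<..h * of_int i + h} x) / h\<^sup>2"

lemma cell_average_slope:
  assumes wd: "has_weak_deriv f0 v" and v: "AE x in lebesgue. \<bar>v x\<bar> \<le> 1" and h: "0 < h"
  shows "\<bar>cell_average f0 h (i + 1) - cell_average f0 h i\<bar> \<le> 1"
proof -
  let ?I = "\<lambda>i. LINT x|lebesgue. f0 x * indicator {h * of_int i<..h * of_int i + h} x"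
  define p where "p = h * real_of_int i"
  have q: "h * real_of_int (i + 1) = p + h" by (simp add: p_def algebra_simps)
  have l: "locally_integrable f0" using wd by (simp add: has_weak_deriv_def)
  have "(LINT x|lebesgue. f0 x * (indicator {p<..p + h} x - indicator {p + h<..p + h + h} x)) = ?I i - ?I (i + 1)"
    unfolding q p_def[symmetric] right_diff_distrib
    by (rule Bochner_Integration.integral_diff) (rule locally_integrable_interval[OF l])+
  moreover have "\<bar>LINT x|lebesgue. f0 x * (indicator {p<..p + h} x - indicator {p + h<..p + h + h} x)\<bar> \<le> h * (p + h - p)"
    by (rule integral_shift_le[OF wd v]) (use h in auto)
  ultimately have "\<bar>?I i - ?I (i + 1)\<bar> \<le> h\<^sup>2" by (simp add: power2_eq_square)
  then have "\<bar>?I (i + 1) - ?I i\<bar> / h\<^sup>2 \<le> 1" using h by (simp add: abs_minus_commute divide_le_eq_1)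
  then show ?thesis using h by (simp add: cell_average_def diff_divide_distrib[symmetric] abs_divide)
qed

lemma cell_average_bound:
  assumes l: "locally_integrable f0" and B: "AE x in lebesgue. \<bar>f0 x\<bar> \<le> B" and h: "0 < h"
  shows "\<bar>h * cell_average f0 h i\<bar> \<le> B"
proof -
  define p where "p = h * real_of_int i"
  have "\<bar>LINT x|lebesgue. f0 x * indicator {p<..p + h} x\<bar> \<le> (LINT x|lebesgue. \<bar>f0 x * indicator {p<..p + h} x\<bar>)"
    by (rule integral_abs_bound)
  also have "\<dots> \<le> (LINT x|lebesgue. B * indicator {p<..p + h} x)"
  proof (rule integral_mono_AE)
    show "integrable lebesgue (\<lambda>x. \<bar>f0 x * indicator {p<..p + h} x\<bar>)"
      by (rule integrable_abs) (rule locally_integrable_interval[OF l])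
    show "integrable lebesgue (\<lambda>x. B * indicator {p<..p + h} x)"
      by (rule integrable_mult_right) (rule integral_indicator_Ioc)
    show "AE x in lebesgue. \<bar>f0 x * indicator {p<..p + h} x\<bar> \<le> B * indicator {p<..p + h} x"
      using B by eventually_elim (auto simp: indicator_def)
  qed
  also have "\<dots> = B * h" using integral_indicator_Ioc[of p "p + h"] h by simp
  finally have "\<bar>LINT x|lebesgue. f0 x * indicator {p<..p + h} x\<bar> \<le> B * h" .
  moreover have "h * cell_average f0 h i = (LINT x|lebesgue. f0 x * indicator {p<..p + h} x) / h"
    using h by (simp add: cell_average_def p_def power2_eq_square)
  ultimately show ?thesis using h by (simp add: abs_divide divide_le_eq)
qed

section \<open>Regularity in time\<close>

text \<open>
The square root is a crude substitute for the logarithm. It is enough, because the mesh width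
may be chosen as a power of the window size.
\<close>
lemma kernel_mass_le: "kernel_mass J \<le> 8 * sqrt (2 * real J + 1)"
proof -
  have "(\<Sum>k\<le>n. 1 / (real k + 1 / 2)) \<le> 4 * sqrt (real n + 1)" for n
  proof (induction n)
    case (Suc n)
    define a where "a = sqrt (real n + 1)"
    define b where "b = sqrt (real n + 2)"
    have ab: "0 < b" "a \<le> b" "b\<^sup>2 = real n + 2" "a\<^sup>2 = real n + 1" by (auto simp: a_def b_def)
    have "(b - a) * (2 * b) \<ge> (b - a) * (b + a)" using ab by (intro mult_left_mono) auto
    also have "(b - a) * (b + a) = b\<^sup>2 - a\<^sup>2" by (simp add: power2_eq_square algebra_simps)
    finally have 1: "1 \<le> (b - a) * (2 * b)" using ab by simp
    have b2: "b \<le> 2 * (real n + 3 / 2)"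
    proof (rule power2_le_imp_le)
      show "b\<^sup>2 \<le> (2 * (real n + 3 / 2))\<^sup>2" unfolding ab by (simp add: power2_eq_square algebra_simps)
    qed simp
    have "1 / (real n + 3 / 2) \<le> 2 / b" using b2 ab by (simp add: divide_simps)
    also have "\<dots> \<le> 4 * (b - a)" using 1 ab by (simp add: divide_simps algebra_simps)
    finally have "1 / (real (Suc n) + 1 / 2) \<le> 4 * b - 4 * a" by (simp add: algebra_simps)
    then show ?case using Suc by (simp add: a_def b_def add.commute)
  qed simp
  from this[of "2 * J"] show ?thesis by (simp add: kernel_mass_def)
qed

text \<open>
The average over a range of length \<open>r\<close> moves at most by a constant times \<open>T / r\<close> during a time
\<open>T\<close>, and the slope bound keeps each value within \<open>r\<close> of its neighbours in the range. With \<open>r\<close>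
close to the square root of \<open>T\<close> both errors are of that order: the solution is Hoelder
continuous in time with exponent \<open>1 / 2\<close>.
\<close>
lemma evolve_time_modulus:
  assumes h: "0 < h" "h \<le> 1" and c: "0 < c" and \<tau>: "\<tau> = h / (3 * c * kernel_mass J)"
    and hH: "h * kernel_mass J \<le> L"
    and B: "\<And>i. \<bar>h * g i\<bar> \<le> B" and v: "\<And>i. \<bar>g (i + 1) - g i\<bar> \<le> 1"
    and S: "0 \<le> S" "\<bar>h * of_int i\<bar> \<le> S" and n: "n \<le> n'" "(real n' - real n) * \<tau> \<le> 1"
  shows "\<bar>h * evolve J g n' i - h * evolve J g n i\<bar> \<le>
    (2 + c * (pi * (2 * (2 * (S + 3)) + 1) + (128 * B\<^sup>2 + 64 * B * (S + 3)) / (2 * (S + 3)) + L)) * sqrt ((real n' - real n) * \<tau>) + 2 * h"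
proof (cases "n = n'")
  case False
  define H where "H = kernel_mass J"
  have H: "4 \<le> H" unfolding H_def by (rule kernel_mass_ge)
  have \<tau>0: "0 < \<tau>" using h c H by (simp add: \<tau> H_def)
  define T where "T = (real n' - real n) * \<tau>"
  have T: "0 < T" "T \<le> 1" using n False \<tau>0 by (auto simp: T_def)
  \<comment> \<open>The least number of cells covering a length of at least \<open>sqrt T\<close>.\<close>
  define w where "w = nat \<lceil>sqrt T / h\<rceil>"
  have sT: "0 < sqrt T" "sqrt T \<le> 1" using T by auto
  have "0 < sqrt T / h" using sT h by simp
  then have w0: "0 < w" and wl: "sqrt T / h \<le> real w" and wu: "real w < sqrt T / h + 1"
    by (auto simp: w_def) (linarith)+
  define r where "r = h * real w"
  have r: "sqrt T \<le> r" "r \<le> sqrt T + h" "0 < r"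
    using wl wu h w0 by (auto simp: r_def field_simps)
  define f where "f m i = h * evolve J g m i" for m i
  define S' where "S' = S + 3"
  define N where "N = 2 * S'"
  define C1 where "C1 = pi * (2 * N + 1) + (128 * B\<^sup>2 + 64 * B * S') / N + L"
  have N: "0 < N" "2 * S' \<le> N" using S by (auto simp: N_def S'_def)
  have fB: "\<bar>h * evolve J g m i\<bar> \<le> B" for m i
  proof -
    have "\<bar>g i\<bar> \<le> B / h" for i using B[of i] h by (simp add: abs_mult field_simps)
    then have "\<bar>evolve J g m i\<bar> \<le> B / h" by (rule evolve_bound)
    then show ?thesis using h by (simp add: abs_mult field_simps)
  qed
  have fv: "\<bar>evolve J g m (i + 1) - evolve J g m i\<bar> \<le> 1" for m i by (rule evolve_slope[of g, OF v])
  have x1: "\<bar>h * (of_int (i + int w - 1) + 1 / 2)\<bar> \<le> S'"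
  proof -
    have "h * (of_int (i + int w - 1) + 1 / 2) = h * of_int i + r - h / 2"
      by (simp add: r_def algebra_simps)
    then show ?thesis using S r sT h unfolding S'_def by linarith
  qed
  have x2: "\<bar>h * (of_int (i - 1) + 1 / 2)\<bar> \<le> S'"
  proof -
    have "h * (of_int (i - 1) + 1 / 2) = h * of_int i - h / 2" by (simp add: algebra_simps)
    then show ?thesis using S h unfolding S'_def by linarith
  qed
  have one: "\<bar>\<Sum>m<w. f (Suc k) (i + int m) - f k (i + int m)\<bar> \<le> \<tau> * (c / h * C1)" for k
  proof -
    have "(\<Sum>m<w. f (Suc k) (i + int m) - f k (i + int m)) = (\<Sum>m<w. h * (step J (evolve J g k) (i + int m) - evolve J g k (i + int m)))"
      by (simp add: f_def algebra_simps)
    moreover have "\<bar>\<Sum>m<w. h * (step J (evolve J g k) (i + int m) - evolve J g k (i + int m))\<bar>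
        \<le> 1 / (3 * kernel_mass J) * (pi * (2 * N + 1) + (128 * B\<^sup>2 + 64 * B * S') / N + h * kernel_mass J)"
      by (rule window_average_step[where g = "evolve J g k" and J = J, OF h N fB fv x1 x2])
    moreover have "\<dots> \<le> 1 / (3 * kernel_mass J) * C1"
      using hH H by (intro mult_left_mono) (auto simp: C1_def H_def)
    moreover have "\<dots> = \<tau> * (c / h * C1)" using h c H by (simp add: \<tau> H_def)
    ultimately show ?thesis by linarith
  qed
  \<comment> \<open>Summing the one-step bound over the time steps: \<open>c / h * C1\<close> is the rate at which the sum over the range can change.\<close>
  have tel: "\<bar>\<Sum>m<w. f (n + d) (i + int m) - f n (i + int m)\<bar> \<le> real d * (\<tau> * (c / h * C1))" for d
  proof (induction d)
    case (Suc d)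
    have "(\<Sum>m<w. f (n + Suc d) (i + int m) - f n (i + int m)) =
      (\<Sum>m<w. f (Suc (n + d)) (i + int m) - f (n + d) (i + int m)) + (\<Sum>m<w. f (n + d) (i + int m) - f n (i + int m))"
      by (simp add: sum.distrib[symmetric])
    then have "\<bar>\<Sum>m<w. f (n + Suc d) (i + int m) - f n (i + int m)\<bar> \<le> \<tau> * (c / h * C1) + real d * (\<tau> * (c / h * C1))"
      using one[of "n + d"] Suc by linarith
    also have "\<dots> = real (Suc d) * (\<tau> * (c / h * C1))"
      by (simp only: of_nat_Suc distrib_right mult_1_left)
    finally show ?case .
  qed simp
  have Teq: "real (n' - n) * (\<tau> * (c / h * C1)) = T * (c / h * C1)" using n by (simp add: T_def of_nat_diff)
  then have avg: "\<bar>\<Sum>m<w. f n' (i + int m) - f n (i + int m)\<bar> \<le> T * (c / h * C1)"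
    using tel[of "n' - n"] n unfolding Teq by (simp only: le_add_diff_inverse)
  have near: "\<bar>f m i - f m (i + int j)\<bar> \<le> r" if "j < w" for m j
  proof -
    have "\<bar>evolve J g m i - evolve J g m (i + int j)\<bar> \<le> \<bar>real_of_int (i - (i + int j))\<bar>"
      by (rule slope_bound_imp_lipschitz) (rule fv)
    also have "\<dots> \<le> real w" using that by simp
    finally have "h * \<bar>evolve J g m i - evolve J g m (i + int j)\<bar> \<le> h * real w" using h by (intro mult_left_mono) auto
    then show ?thesis using h by (simp add: f_def r_def right_diff_distrib[symmetric] abs_mult)
  qed
  have "real w * (f n' i - f n i) = (\<Sum>m<w. f n' (i + int m) - f n (i + int m))
      + (\<Sum>m<w. (f n' i - f n' (i + int m)) - (f n i - f n (i + int m)))"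
    by (simp add: sum.distrib[symmetric])
  moreover have "\<bar>\<Sum>m<w. (f n' i - f n' (i + int m)) - (f n i - f n (i + int m))\<bar> \<le> real w * (2 * r)"
  proof -
    have "\<bar>\<Sum>m<w. (f n' i - f n' (i + int m)) - (f n i - f n (i + int m))\<bar>
      \<le> (\<Sum>m<w. \<bar>(f n' i - f n' (i + int m)) - (f n i - f n (i + int m))\<bar>)" by (rule sum_abs)
    also have "\<dots> \<le> (\<Sum>m<w. 2 * r)"
    proof (rule sum_mono)
      fix m assume "m \<in> {..<w}"
      then have "m < w" by simp
      from near[OF this, of n'] near[OF this, of n]
      show "\<bar>(f n' i - f n' (i + int m)) - (f n i - f n (i + int m))\<bar> \<le> 2 * r" by linarith
    qed
    finally show ?thesis by simp
  qed
  ultimately have "\<bar>real w * (f n' i - f n i)\<bar> \<le> T * (c / h * C1) + real w * (2 * r)"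
    using avg by linarith
  then have "real w * \<bar>f n' i - f n i\<bar> \<le> T * (c / h * C1) + real w * (2 * r)" by (simp add: abs_mult)
  then have "\<bar>f n' i - f n i\<bar> \<le> (T * (c / h * C1) + real w * (2 * r)) / real w"
    using w0 by (simp add: field_simps)
  also have "\<dots> = T / r * (c * C1) + 2 * r" using w0 h by (simp add: r_def field_simps)
  also have "\<dots> \<le> sqrt T * (c * C1) + 2 * (sqrt T + h)"
  proof (intro add_mono mult_right_mono)
    have "T = sqrt T * sqrt T" using T by simp
    also have "\<dots> \<le> sqrt T * r" using r sT by (intro mult_left_mono) auto
    finally show "T / r \<le> sqrt T" using r by (simp add: divide_le_eq)
    have "0 \<le> B" using B[of 0] by linarith
    moreover have "0 \<le> L" using hH h H unfolding H_def by (intro order_trans[OF _ hH] mult_nonneg_nonneg) auto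
    ultimately have "0 \<le> C1" using N S unfolding C1_def S'_def by (intro add_nonneg_nonneg mult_nonneg_nonneg divide_nonneg_nonneg) auto
    then show "0 \<le> c * C1" using c by simp
  qed (use r in auto)
  also have "\<dots> = (2 + c * C1) * sqrt T + 2 * h" by (simp add: algebra_simps)
  finally show ?thesis by (simp add: f_def T_def C1_def N_def S'_def)
qed (use h in simp)

section \<open>Compactness\<close>

text \<open>
A diagonal subsequence converges at all rational points. The approximations are discontinuous,
but their jumps tend to 0 with \<open>\<epsilon> k\<close>, so that the modulus of continuity extends convergence to
all points and becomes a true modulus in the limit.
\<close>
lemma pointwise_compactness:
  fixes F :: "nat \<Rightarrow> real \<Rightarrow> real \<Rightarrow> real"
  assumes B: "\<And>k x t. 0 \<le> t \<Longrightarrow> \<bar>F k x t\<bar> \<le> B"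
    and modulus: "\<And>S. \<exists>C\<ge>0. \<forall>k x x' t t'. \<bar>x\<bar> \<le> S \<longrightarrow> 0 \<le> t \<longrightarrow> 0 \<le> t' \<longrightarrow> \<bar>t - t'\<bar> + \<epsilon> k \<le> 1 \<longrightarrow>
        \<bar>F k x t - F k x' t'\<bar> \<le> \<bar>x - x'\<bar> + C * sqrt (\<bar>t - t'\<bar> + \<epsilon> k) + C * \<epsilon> k"
    and \<epsilon>: "\<epsilon> \<longlonglongrightarrow> 0" "\<And>k. 0 \<le> \<epsilon> k"
  obtains \<sigma> f where "strict_mono (\<sigma> :: nat \<Rightarrow> nat)"
    "\<And>x t. 0 \<le> t \<Longrightarrow> (\<lambda>k. F (\<sigma> k) x t) \<longlonglongrightarrow> f x t"
    "\<And>x t. 0 \<le> t \<Longrightarrow> \<bar>f x t\<bar> \<le> B"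
    "\<And>x y t. 0 \<le> t \<Longrightarrow> \<bar>f x t - f y t\<bar> \<le> \<bar>x - y\<bar>"
    "continuous_on (UNIV \<times> {0..}) (\<lambda>(x, t). f x t)"
proof -
  define Q where "Q = (\<rat> :: real set) \<times> (\<rat> \<inter> {0..} :: real set)"
  have "countable Q" unfolding Q_def by (intro countable_SIGMA countable_Int1 countable_rat)
  then obtain \<sigma> where \<sigma>: "strict_mono (\<sigma> :: nat \<Rightarrow> nat)"
    and conv: "\<And>p. p \<in> Q \<Longrightarrow> \<exists>l. (\<lambda>k. F (\<sigma> k) (fst p) (snd p)) \<longlonglongrightarrow> l"
    by (rule function_convergent_subsequence[of Q "\<lambda>k p. F k (fst p) (snd p)" B])
      (use B in \<open>auto simp: Q_def\<close>)
  have \<epsilon>\<sigma>: "(\<lambda>k. \<epsilon> (\<sigma> k)) \<longlonglongrightarrow> 0" using LIMSEQ_subseq_LIMSEQ[OF \<epsilon>(1) \<sigma>] by (simp add: o_def)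
  have mod_lim: "(\<lambda>k. a + C * sqrt (s + \<epsilon> (\<sigma> k)) + C * \<epsilon> (\<sigma> k)) \<longlonglongrightarrow> a + C * sqrt s" for a C s
  proof -
    have "(\<lambda>k. a + C * sqrt (s + \<epsilon> (\<sigma> k)) + C * \<epsilon> (\<sigma> k)) \<longlonglongrightarrow> a + C * sqrt (s + 0) + C * 0"
      by (intro tendsto_intros \<epsilon>\<sigma>)
    then show ?thesis by simp
  qed
  have "\<exists>l. (\<lambda>k. F (\<sigma> k) x t) \<longlonglongrightarrow> l" if t: "0 \<le> t" for x t
  proof -
    obtain C where C0: "0 \<le> C" and C: "\<And>k x' t'. 0 \<le> t' \<Longrightarrow> \<bar>t - t'\<bar> + \<epsilon> k \<le> 1 \<Longrightarrow>
        \<bar>F k x t - F k x' t'\<bar> \<le> \<bar>x - x'\<bar> + C * sqrt (\<bar>t - t'\<bar> + \<epsilon> k) + C * \<epsilon> k"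
      using modulus[of "\<bar>x\<bar>"] t by blast
    have "Cauchy (\<lambda>k. F (\<sigma> k) x t)"
      unfolding Cauchy_def dist_real_def
    proof (intro allI impI)
      fix e :: real assume e: "0 < e"
      have "((\<lambda>s. s + C * sqrt s) \<longlongrightarrow> 0 + C * sqrt 0) (at_right 0)" by (intro tendsto_intros)
      then have "\<forall>\<^sub>F s in at_right 0. s + C * sqrt s < e / 4"
        by (rule order_tendstoD) (use e in simp)
      moreover have "\<forall>\<^sub>F s in at_right (0::real). s < 1" by (rule eventually_at_right_real[THEN eventually_mono]) auto
      moreover have "\<forall>\<^sub>F s in at_right (0::real). 0 < s" by (rule eventually_at_right_less)
      ultimately have "\<forall>\<^sub>F s in at_right (0::real). s + C * sqrt s < e / 4 \<and> s < 1 \<and> 0 < s" by eventually_elim auto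
      then obtain s where s: "s + C * sqrt s < e / 4" "s < 1" "0 < s"
        using eventually_happens'[OF trivial_limit_at_right_real] by blast
      obtain x' where x': "x' \<in> \<rat>" "x < x'" "x' < x + s" using Rats_dense_in_real[of x "x + s"] s by auto
      obtain t' where t': "t' \<in> \<rat>" "t < t'" "t' < t + s" using Rats_dense_in_real[of t "t + s"] s by auto
      have "(x', t') \<in> Q" using x' t' t by (auto simp: Q_def)
      then have "Cauchy (\<lambda>k. F (\<sigma> k) x' t')" using conv[of "(x', t')"] LIMSEQ_imp_Cauchy by auto
      then obtain M1 where M1: "\<And>m n. m \<ge> M1 \<Longrightarrow> n \<ge> M1 \<Longrightarrow> \<bar>F (\<sigma> m) x' t' - F (\<sigma> n) x' t'\<bar> < e / 4"
        unfolding Cauchy_def dist_real_def using e by (metis zero_less_divide_iff zero_less_numeral)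
      define a where "a = \<bar>x - x'\<bar>"
      define b where "b = \<bar>t - t'\<bar>"
      have ab: "a \<le> s" "b < s" using x' t' by (auto simp: a_def b_def)
      have "0 \<le> b" by (simp add: b_def)
      have lim: "(\<lambda>k. a + C * sqrt (b + \<epsilon> (\<sigma> k)) + C * \<epsilon> (\<sigma> k)) \<longlonglongrightarrow> a + C * sqrt b" by (rule mod_lim)
      have "a + C * sqrt b < 3 * e / 8"
      proof -
        have "C * sqrt b \<le> C * sqrt s" using ab C0 by (intro mult_left_mono) auto
        then show ?thesis using ab s e by linarith
      qed
      then have "\<forall>\<^sub>F k in sequentially. a + C * sqrt (b + \<epsilon> (\<sigma> k)) + C * \<epsilon> (\<sigma> k) < 3 * e / 8"
        by (rule order_tendstoD(2)[OF lim])
      moreover have "\<forall>\<^sub>F k in sequentially. \<epsilon> (\<sigma> k) < 1 - b" using s ab by (intro order_tendstoD(2)[OF \<epsilon>\<sigma>]) auto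
      ultimately have "\<forall>\<^sub>F k in sequentially. \<bar>F (\<sigma> k) x t - F (\<sigma> k) x' t'\<bar> < 3 * e / 8"
      proof eventually_elim
        case (elim k)
        have "0 \<le> t'" "\<bar>t - t'\<bar> + \<epsilon> (\<sigma> k) \<le> 1" using t t' elim by (auto simp: b_def)
        from C[OF this, of x'] elim show ?case by (simp add: a_def b_def)
      qed
      then obtain M2 where M2: "\<And>k. k \<ge> M2 \<Longrightarrow> \<bar>F (\<sigma> k) x t - F (\<sigma> k) x' t'\<bar> < 3 * e / 8"
        by (auto simp: eventually_sequentially)
      show "\<exists>M. \<forall>m\<ge>M. \<forall>n\<ge>M. \<bar>F (\<sigma> m) x t - F (\<sigma> n) x t\<bar> < e"
      proof (intro exI[of _ "max M1 M2"] allI impI)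
        fix m n assume "max M1 M2 \<le> m" "max M1 M2 \<le> n"
        then have "\<bar>F (\<sigma> m) x t - F (\<sigma> m) x' t'\<bar> < 3 * e / 8" "\<bar>F (\<sigma> n) x t - F (\<sigma> n) x' t'\<bar> < 3 * e / 8"
          "\<bar>F (\<sigma> m) x' t' - F (\<sigma> n) x' t'\<bar> < e / 4"
          using M1 M2 by auto
        then show "\<bar>F (\<sigma> m) x t - F (\<sigma> n) x t\<bar> < e" by linarith
      qed
    qed
    then show ?thesis using Cauchy_convergent_iff convergent_def by blast
  qed
  then have conv_all: "convergent (\<lambda>k. F (\<sigma> k) x t)" if "0 \<le> t" for x t
    using that unfolding convergent_def by blast
  define f where "f x t = lim (\<lambda>k. F (\<sigma> k) x t)" for x t
  have f: "(\<lambda>k. F (\<sigma> k) x t) \<longlonglongrightarrow> f x t" if "0 \<le> t" for x t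
    using conv_all[OF that] unfolding f_def by (simp add: convergent_LIMSEQ_iff)
  have fmod: "\<exists>C. \<forall>x x' t t'. \<bar>x\<bar> \<le> S \<longrightarrow> 0 \<le> t \<longrightarrow> 0 \<le> t' \<longrightarrow> \<bar>t - t'\<bar> < 1 \<longrightarrow>
      \<bar>f x t - f x' t'\<bar> \<le> \<bar>x - x'\<bar> + C * sqrt \<bar>t - t'\<bar>" for S
  proof -
    obtain C where C: "\<And>k x x' t t'. \<bar>x\<bar> \<le> S \<Longrightarrow> 0 \<le> t \<Longrightarrow> 0 \<le> t' \<Longrightarrow> \<bar>t - t'\<bar> + \<epsilon> k \<le> 1 \<Longrightarrow>
        \<bar>F k x t - F k x' t'\<bar> \<le> \<bar>x - x'\<bar> + C * sqrt (\<bar>t - t'\<bar> + \<epsilon> k) + C * \<epsilon> k"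
      using modulus[of S] by blast
    show ?thesis
    proof (intro exI[of _ C] allI impI)
      fix x x' t t' :: real assume a: "\<bar>x\<bar> \<le> S" "0 \<le> t" "0 \<le> t'" "\<bar>t - t'\<bar> < 1"
      have "\<forall>\<^sub>F k in sequentially. \<epsilon> (\<sigma> k) < 1 - \<bar>t - t'\<bar>"
        using a by (intro order_tendstoD(2)[OF \<epsilon>\<sigma>]) auto
      then have ev: "\<forall>\<^sub>F k in sequentially. \<bar>F (\<sigma> k) x t - F (\<sigma> k) x' t'\<bar> \<le>
          \<bar>x - x'\<bar> + C * sqrt (\<bar>t - t'\<bar> + \<epsilon> (\<sigma> k)) + C * \<epsilon> (\<sigma> k)"
        by eventually_elim (use C a in auto)
      show "\<bar>f x t - f x' t'\<bar> \<le> \<bar>x - x'\<bar> + C * sqrt \<bar>t - t'\<bar>"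
        by (rule tendsto_le[OF _ mod_lim _ ev]) (auto intro!: tendsto_intros f a)
    qed
  qed
  have lip: "\<bar>f x t - f y t\<bar> \<le> \<bar>x - y\<bar>" if "0 \<le> t" for x y t
    using fmod[of "\<bar>x\<bar>"] that by force
  have bound: "\<bar>f x t\<bar> \<le> B" if "0 \<le> t" for x t
    by (rule LIMSEQ_le_const2[OF tendsto_rabs[OF f[OF that]]]) (use B[OF that] in auto)
  have "continuous_on (UNIV \<times> {0..}) (\<lambda>(x, t). f x t)"
    unfolding continuous_on_def
  proof
    fix p :: "real \<times> real" assume p: "p \<in> UNIV \<times> {0..}"
    define x t where "x = fst p" and "t = snd p"
    have t: "0 \<le> t" using p by (auto simp: t_def)
    let ?F = "at p within UNIV \<times> {0..}"
    obtain C where C: "\<And>x' t'. 0 \<le> t' \<Longrightarrow> \<bar>t - t'\<bar> < 1 \<Longrightarrow> \<bar>f x t - f x' t'\<bar> \<le> \<bar>x - x'\<bar> + C * sqrt \<bar>t - t'\<bar>"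
      using fmod[of "\<bar>x\<bar>"] t by blast
    have id: "((\<lambda>q. q) \<longlongrightarrow> p) ?F" by (rule tendsto_ident_at)
    have "((\<lambda>q. \<bar>x - fst q\<bar> + C * sqrt \<bar>t - snd q\<bar>) \<longlongrightarrow> \<bar>x - fst p\<bar> + C * sqrt \<bar>t - snd p\<bar>) ?F"
      by (intro tendsto_intros id)
    then have z: "((\<lambda>q. \<bar>x - fst q\<bar> + C * sqrt \<bar>t - snd q\<bar>) \<longlongrightarrow> 0) ?F" by (simp add: x_def t_def)
    have "((\<lambda>q. \<bar>t - snd q\<bar>) \<longlongrightarrow> \<bar>t - snd p\<bar>) ?F" by (intro tendsto_intros id)
    then have "\<forall>\<^sub>F q in ?F. \<bar>t - snd q\<bar> < 1" by (rule order_tendstoD) (simp add: t_def)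
    moreover have "\<forall>\<^sub>F q in ?F. q \<in> UNIV \<times> {0..}" by (simp add: eventually_at_filter)
    ultimately have "\<forall>\<^sub>F q in ?F. norm ((case q of (x, t) \<Rightarrow> f x t) - f x t) \<le> \<bar>x - fst q\<bar> + C * sqrt \<bar>t - snd q\<bar>"
    proof eventually_elim
      case (elim q)
      then show ?case using C[of "snd q" "fst q"] by (auto simp: split_def abs_minus_commute mem_Times_iff)
    qed
    then have "((\<lambda>q. (case q of (x, t) \<Rightarrow> f x t) - f x t) \<longlongrightarrow> 0) ?F"
      by (rule Lim_null_comparison[OF _ z])
    then show "((\<lambda>(x, t). f x t) \<longlongrightarrow> (\<lambda>(x, t). f x t) p) ?F"
      by (simp add: LIM_zero_iff split_def x_def t_def)
  qed
  with \<sigma> f bound lip show ?thesis by (rule that)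
qed

section \<open>Test functions on a half-open time interval\<close>

lemma real_deriv_lipschitz:
  fixes f :: "real \<Rightarrow> real"
  assumes "convex S" "\<And>z. z \<in> S \<Longrightarrow> (f has_real_derivative f' z) (at z within S)"
    "\<And>z. z \<in> S \<Longrightarrow> \<bar>f' z\<bar> \<le> C" "x \<in> S" "y \<in> S"
  shows "\<bar>f x - f y\<bar> \<le> C * \<bar>x - y\<bar>"
  using field_differentiable_bound[of S f f' C x y] assms by simp

text \<open>
A test function may be nonzero at time 0, where only the one-sided time derivative exists. Its
support is compact in \<open>[0, T)\<close> times the line, and hence stays away from time \<open>T\<close>; the midpoint
between the last time \<open>T1\<close> of the support and \<open>T\<close> leaves room for bounding the derivative on a
compact set.
\<close>
lemma test_function_partial_derivatives:
  fixes \<eta> :: "real \<times> real \<Rightarrow> real"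
  assumes \<eta>: "\<eta> \<in> Cc_infinity (UNIV \<times> {0..<T})" and T: "0 < T"
  obtains D1 D2 :: "real \<times> real \<Rightarrow> real" and R T1 C
  where "0 < R" "0 \<le> T1" "T1 < T" "0 \<le> C"
    "\<And>x t. 0 \<le> t \<Longrightarrow> t < T \<Longrightarrow> ((\<lambda>y. \<eta> (y, t)) has_real_derivative D1 (x, t)) (at x)"
    "\<And>x t. 0 \<le> t \<Longrightarrow> t < T \<Longrightarrow> ((\<lambda>s. \<eta> (x, s)) has_real_derivative D2 (x, t)) (at t within {0..<T})"
    "continuous_on (UNIV \<times> {0..<T}) D1" "continuous_on (UNIV \<times> {0..<T}) D2"
    "\<And>x t. 0 \<le> t \<Longrightarrow> t < T \<Longrightarrow> R < \<bar>x\<bar> \<or> T1 < t \<Longrightarrow> \<eta> (x, t) = 0"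
    "\<And>x t. 0 \<le> t \<Longrightarrow> t < T \<Longrightarrow> \<bar>D1 (x, t)\<bar> \<le> C"
    "\<And>x t. 0 \<le> t \<Longrightarrow> t \<le> (T1 + T) / 2 \<Longrightarrow> \<bar>x\<bar> \<le> R + 1 \<Longrightarrow> \<bar>D2 (x, t)\<bar> \<le> C"
proof -
  let ?S = "UNIV \<times> {0..<T} :: (real \<times> real) set"
  have "smooth_on ?S \<eta>" and ex: "\<exists>K. compact K \<and> K \<subseteq> ?S \<and> (\<forall>p\<in>?S - K. \<eta> p = 0)"
    using \<eta> unfolding Cc_infinity_def mem_Collect_eq by (rule conjunct1, rule conjunct2)
  then have ck: "Ck_on (Suc 0) ?S \<eta>" unfolding smooth_on_def by (elim spec)
  obtain K where KK: "compact K \<and> K \<subseteq> ?S \<and> (\<forall>p\<in>?S - K. \<eta> p = 0)"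
    using ex by (rule exE)
  then have K: "compact K" "K \<subseteq> ?S" by simp_all
  have K0: "\<eta> p = 0" if "p \<in> ?S - K" for p
    using KK that by (elim conjE) (rule bspec)
  define D1 where "D1 p = frechet_derivative \<eta> (at p within ?S) (1, 0)" for p
  define D2 where "D2 p = frechet_derivative \<eta> (at p within ?S) (0, 1)" for p
  have cD: "continuous_on ?S D1" "continuous_on ?S D2"
    using ck unfolding D1_def D2_def by auto
  have der: "(\<eta> has_derivative frechet_derivative \<eta> (at p within ?S)) (at p within ?S)" if "p \<in> ?S" for p
    using ck that by (auto simp: differentiable_on_def frechet_derivative_works)
  have dx: "((\<lambda>y. \<eta> (y, t)) has_real_derivative D1 (x, t)) (at x)" if "0 \<le> t" "t < T" for x t
  proof -
    have "((\<lambda>y. (y, t)) has_derivative (\<lambda>v. (v, 0))) (at x within UNIV)"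
      by (auto intro!: derivative_eq_intros)
    moreover have "(\<eta> has_derivative frechet_derivative \<eta> (at (x, t) within ?S)) (at (x, t) within (\<lambda>y. (y, t)) ` UNIV)"
      by (rule has_derivative_subset[OF der]) (use that in auto)
    ultimately have "((\<lambda>y. \<eta> (y, t)) has_derivative (\<lambda>v. frechet_derivative \<eta> (at (x, t) within ?S) (v, 0))) (at x within UNIV)"
      by (rule has_derivative_in_compose)
    moreover have "frechet_derivative \<eta> (at (x, t) within ?S) (v, 0) = D1 (x, t) * v" for v
    proof -
      have "linear (frechet_derivative \<eta> (at (x, t) within ?S))"
        using der[of "(x, t)"] that by (auto intro: has_derivative_linear)
      from linear_scale[OF this, of v "(1, 0)"] show ?thesis by (simp add: D1_def)
    qed
    ultimately show ?thesis by (simp add: has_field_derivative_def)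
  qed
  have dt: "((\<lambda>s. \<eta> (x, s)) has_real_derivative D2 (x, t)) (at t within {0..<T})" if "0 \<le> t" "t < T" for x t
  proof -
    have "((\<lambda>s. (x, s)) has_derivative (\<lambda>v. (0, v))) (at t within {0..<T})"
      by (auto intro!: derivative_eq_intros)
    moreover have "(\<eta> has_derivative frechet_derivative \<eta> (at (x, t) within ?S)) (at (x, t) within (\<lambda>s. (x, s)) ` {0..<T})"
      by (rule has_derivative_subset[OF der]) (use that in auto)
    ultimately have "((\<lambda>s. \<eta> (x, s)) has_derivative (\<lambda>v. frechet_derivative \<eta> (at (x, t) within ?S) (0, v))) (at t within {0..<T})"
      by (rule has_derivative_in_compose)
    moreover have "frechet_derivative \<eta> (at (x, t) within ?S) (0, v) = D2 (x, t) * v" for v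
    proof -
      have "linear (frechet_derivative \<eta> (at (x, t) within ?S))"
        using der[of "(x, t)"] that by (auto intro: has_derivative_linear)
      from linear_scale[OF this, of v "(0, 1)"] show ?thesis by (simp add: D2_def)
    qed
    ultimately show ?thesis by (simp add: has_field_derivative_def)
  qed
  obtain R0 where R0: "\<And>p. p \<in> K \<Longrightarrow> norm p \<le> R0"
    using compact_imp_bounded[OF K(1)] bounded_iff by metis
  define R where "R = max R0 1"
  have R: "\<bar>x\<bar> \<le> R" if "(x, t) \<in> K" for x t
    using R0[OF that] norm_fst_le[of x t] by (simp add: R_def)
  have "\<exists>T1. 0 \<le> T1 \<and> T1 < T \<and> (\<forall>p\<in>K. snd p \<le> T1)"
  proof (cases "K = {}")
    case False
    have "compact (snd ` K)" by (intro compact_continuous_image continuous_intros K)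
    then obtain m where "m \<in> snd ` K" "\<And>s. s \<in> snd ` K \<Longrightarrow> s \<le> m"
      using compact_attains_sup[of "snd ` K"] False by auto
    moreover have "0 \<le> m" "m < T" using \<open>m \<in> snd ` K\<close> K(2) by auto
    ultimately show ?thesis by (intro exI[of _ m]) auto
  qed (use T in auto)
  then obtain T1 where T1: "0 \<le> T1" "T1 < T" "\<And>p. p \<in> K \<Longrightarrow> snd p \<le> T1" by blast
  have zero: "\<eta> (x, t) = 0" if "0 \<le> t" "t < T" "R < \<bar>x\<bar> \<or> T1 < t" for x t
    by (rule K0) (use that R[of x t] T1(3)[of "(x, t)"] in auto)
  have D1z: "D1 (x, t) = 0" if t: "0 \<le> t" "t < T" and out: "R < \<bar>x\<bar> \<or> T1 < t" for x t
  proof -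
    have "((\<lambda>y. \<eta> (y, t)) has_real_derivative 0) (at x)"
    proof (cases "T1 < t")
      case True
      then have "(\<lambda>y. \<eta> (y, t)) = (\<lambda>y. 0)" using zero t by auto
      then show ?thesis by simp
    next
      case False
      then have "R < \<bar>x\<bar>" using out by simp
      have o: "open {x::real. R < \<bar>x\<bar>}" by (intro open_Collect_less continuous_intros)
      have "((\<lambda>x. 0) has_real_derivative 0) (at x)" by simp
      then show ?thesis
        by (rule has_field_derivative_transform_within_open[OF _ o]) (use \<open>R < \<bar>x\<bar>\<close> zero t in auto)
    qed
    then show ?thesis using DERIV_unique[OF dx[OF t]] by blast
  qed
  define Kc where "Kc = {- (R + 1)..R + 1} \<times> {0..(T1 + T) / 2}"
  have Kc: "compact Kc" "Kc \<subseteq> ?S" using T1 by (auto simp: Kc_def compact_Times)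
  have "bounded (D1 ` Kc)" "bounded (D2 ` Kc)"
    by (intro compact_imp_bounded compact_continuous_image continuous_on_subset[OF cD(1)] Kc)
       (intro compact_imp_bounded compact_continuous_image continuous_on_subset[OF cD(2)] Kc)
  then obtain C1 C2 where C12: "\<And>p. p \<in> Kc \<Longrightarrow> \<bar>D1 p\<bar> \<le> C1" "\<And>p. p \<in> Kc \<Longrightarrow> \<bar>D2 p\<bar> \<le> C2"
    unfolding bounded_iff by (metis imageI real_norm_def)
  define C where "C = max 0 (max C1 C2)"
  have b1: "\<bar>D1 (x, t)\<bar> \<le> C" if "0 \<le> t" "t < T" for x t
  proof (cases "(x, t) \<in> Kc")
    case True then show ?thesis using C12(1)[of "(x, t)"] by (simp add: C_def)
  next
    case False
    then have "R < \<bar>x\<bar> \<or> T1 < t" using that T1 by (auto simp: Kc_def)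
    then show ?thesis using D1z that by (simp add: C_def)
  qed
  have b2: "\<bar>D2 (x, t)\<bar> \<le> C" if "0 \<le> t" "t \<le> (T1 + T) / 2" "\<bar>x\<bar> \<le> R + 1" for x t
  proof -
    have "(x, t) \<in> Kc" using that by (auto simp: Kc_def abs_le_iff)
    then show ?thesis using C12(2)[of "(x, t)"] by (simp add: C_def le_max_iff_disj)
  qed
  show ?thesis
    by (rule that[of R T1 C D1 D2]) (use T1 dx dt cD zero b1 b2 in \<open>auto simp: R_def C_def\<close>)
qed

text \<open>
The form in which the scheme meets the test function: the extension \<open>e\<close> by 0 to later times is
Lipschitz in both variables, and its forward difference quotients converge to the partial
derivatives even when the base point moves. The latter is the mean value theorem plus continuity
of the derivatives.
\<close>
lemma test_function_extension:
  fixes \<eta> :: "real \<times> real \<Rightarrow> real"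
  assumes \<eta>: "\<eta> \<in> Cc_infinity (UNIV \<times> {0..<T})" and T: "0 < T"
  obtains e ex et :: "real \<Rightarrow> real \<Rightarrow> real" and R C
  where "0 < R" "0 \<le> C"
    "\<And>x t. 0 \<le> t \<Longrightarrow> t < T \<Longrightarrow> e x t = \<eta> (x, t)"
    "\<And>x t. R < \<bar>x\<bar> \<or> T \<le> t \<Longrightarrow> e x t = 0"
    "\<And>x y t. 0 \<le> t \<Longrightarrow> \<bar>e x t - e y t\<bar> \<le> C * \<bar>x - y\<bar>"
    "\<And>x s t. 0 \<le> s \<Longrightarrow> 0 \<le> t \<Longrightarrow> \<bar>e x s - e x t\<bar> \<le> C * \<bar>s - t\<bar>"
    "\<And>x t. 0 < t \<Longrightarrow> t < T \<Longrightarrow> deriv (\<lambda>y. \<eta> (y, t)) x = ex x t"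
    "\<And>x t. 0 < t \<Longrightarrow> t < T \<Longrightarrow> deriv (\<lambda>s. \<eta> (x, s)) t = et x t"
    "\<And>x t \<epsilon>. 0 < t \<Longrightarrow> t < T \<Longrightarrow> 0 < \<epsilon> \<Longrightarrow> \<exists>d>0. \<forall>a h s. \<bar>a - x\<bar> < d \<longrightarrow> 0 < h \<longrightarrow> h < d \<longrightarrow> \<bar>s - t\<bar> < d \<longrightarrow>
        \<bar>(e (a + h) s - e a s) / h - ex x t\<bar> < \<epsilon>"
    "\<And>x t \<epsilon>. 0 < t \<Longrightarrow> t < T \<Longrightarrow> 0 < \<epsilon> \<Longrightarrow> \<exists>d>0. \<forall>a h s. \<bar>a - x\<bar> < d \<longrightarrow> 0 < h \<longrightarrow> h < d \<longrightarrow> \<bar>s - t\<bar> < d \<longrightarrow>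
        \<bar>(e a (s + h) - e a s) / h - et x t\<bar> < \<epsilon>"
proof -
  obtain D1 D2 :: "real \<times> real \<Rightarrow> real" and R T1 C where
    R: "0 < R" and T1: "0 \<le> T1" "T1 < T" and C: "0 \<le> C"
    and dx: "\<And>x t. 0 \<le> t \<Longrightarrow> t < T \<Longrightarrow> ((\<lambda>y. \<eta> (y, t)) has_real_derivative D1 (x, t)) (at x)"
    and dt: "\<And>x t. 0 \<le> t \<Longrightarrow> t < T \<Longrightarrow> ((\<lambda>s. \<eta> (x, s)) has_real_derivative D2 (x, t)) (at t within {0..<T})"
    and cD1: "continuous_on (UNIV \<times> {0..<T}) D1" and cD2: "continuous_on (UNIV \<times> {0..<T}) D2"
    and zero: "\<And>x t. 0 \<le> t \<Longrightarrow> t < T \<Longrightarrow> R < \<bar>x\<bar> \<or> T1 < t \<Longrightarrow> \<eta> (x, t) = 0"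
    and b1: "\<And>x t. 0 \<le> t \<Longrightarrow> t < T \<Longrightarrow> \<bar>D1 (x, t)\<bar> \<le> C"
    and b2: "\<And>x t. 0 \<le> t \<Longrightarrow> t \<le> (T1 + T) / 2 \<Longrightarrow> \<bar>x\<bar> \<le> R + 1 \<Longrightarrow> \<bar>D2 (x, t)\<bar> \<le> C"
    by (rule test_function_partial_derivatives[OF \<eta> T]) (rule that; assumption)
  define e where "e x t = (if 0 \<le> t \<and> t < T then \<eta> (x, t) else 0)" for x t
  have dt': "((\<lambda>s. \<eta> (x, s)) has_real_derivative D2 (x, t)) (at t)" if "0 < t" "t < T" for x t
  proof -
    have "at t within {0..<T} = at t" by (rule at_within_interior) (use that in simp)
    then show ?thesis using dt[of t x] that by simp
  qed
  have close: "\<exists>d>0. \<forall>b r. \<bar>b - x\<bar> < 2 * d \<longrightarrow> \<bar>r - t\<bar> < 2 * d \<longrightarrow> 0 < r \<and> r < T \<and> \<bar>D (b, r) - D (x, t)\<bar> < \<epsilon>"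
    if cD: "continuous_on (UNIV \<times> {0..<T}) D" and t: "0 < t" "t < T" and \<epsilon>: "0 < \<epsilon>" for D :: "real \<times> real \<Rightarrow> real" and x t \<epsilon>
  proof -
    have "(x, t) \<in> UNIV \<times> {0..<T}" using t by auto
    then obtain d where d: "0 < d" "\<And>p. p \<in> UNIV \<times> {0..<T} \<Longrightarrow> dist p (x, t) < d \<Longrightarrow> dist (D p) (D (x, t)) < \<epsilon>"
      using cD \<epsilon> unfolding continuous_on_iff by metis
    define d' where "d' = min (d / 4) (min (t / 2) ((T - t) / 2))"
    have "0 < d'" using d(1) t by (simp add: d'_def)
    moreover have "d' \<le> d / 4" unfolding d'_def by linarith
    moreover have "d' \<le> t / 2" unfolding d'_def by linarith
    moreover have "d' \<le> (T - t) / 2" unfolding d'_def by linarith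
    ultimately have d': "0 < d'" "d' \<le> d / 4" "d' \<le> t / 2" "d' \<le> (T - t) / 2" by simp_all
    have "0 < r \<and> r < T \<and> \<bar>D (b, r) - D (x, t)\<bar> < \<epsilon>" if a: "\<bar>b - x\<bar> < 2 * d'" "\<bar>r - t\<bar> < 2 * d'" for b r
    proof -
      have "- (2 * d') < r - t" "r - t < 2 * d'" using a(2) unfolding abs_less_iff by simp_all
      then have r: "0 < r" "r < T" using d'(3,4) by argo+
      have "dist (b, r) (x, t) \<le> \<bar>b - x\<bar> + \<bar>r - t\<bar>"
        unfolding dist_Pair_Pair dist_real_def by (rule order_trans[OF sqrt_sum_squares_le_sum_abs]) simp
      then have "dist (b, r) (x, t) < d" using a d' by linarith
      then show ?thesis using d(2)[of "(b, r)"] r by (simp add: dist_real_def)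
    qed
    then show ?thesis using d'(1) by blast
  qed
  have lipx: "\<bar>e x t - e y t\<bar> \<le> C * \<bar>x - y\<bar>" if "0 \<le> t" for x y t
  proof (cases "t < T")
    case True
    then show ?thesis unfolding e_def
      using real_deriv_lipschitz[of UNIV "\<lambda>y. \<eta> (y, t)" "\<lambda>y. D1 (y, t)" C x y] dx[OF that True] b1[OF that True] that by simp
  qed (use C in \<open>simp add: e_def\<close>)
  have lipt': "\<bar>e x s - e x t\<bar> \<le> C * \<bar>s - t\<bar>" if st: "0 \<le> s" "s \<le> t" for x s t
  proof (cases "R < \<bar>x\<bar>")
    case True
    then show ?thesis using zero st C by (simp add: e_def)
  next
    case False
    define T2 where "T2 = (T1 + T) / 2"
    have T2: "T1 < T2" "T2 < T" using T1 by (auto simp: T2_def)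
    have z: "e x r = 0" if "T2 \<le> r" for r using that zero[of r x] T2 T1 by (simp add: e_def)
    have in_T2: "\<bar>e x a - e x b\<bar> \<le> C * \<bar>a - b\<bar>" if "a \<in> {0..T2}" "b \<in> {0..T2}" for a b
    proof -
      have "\<bar>\<eta> (x, a) - \<eta> (x, b)\<bar> \<le> C * \<bar>a - b\<bar>"
      proof (rule real_deriv_lipschitz[of "{0..T2}" _ "\<lambda>s. D2 (x, s)"])
        fix z assume z: "z \<in> {0..T2}"
        show "((\<lambda>s. \<eta> (x, s)) has_real_derivative D2 (x, z)) (at z within {0..T2})"
          by (rule has_field_derivative_subset[OF dt]) (use z T2 in auto)
        show "\<bar>D2 (x, z)\<bar> \<le> C" using z False b2[of z x] by (simp add: T2_def)
      qed (use that in auto)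
      then show ?thesis using that T2 by (simp add: e_def)
    qed
    show ?thesis
    proof (cases "s \<le> T2")
      case s: True
      define t' where "t' = min t T2"
      have "e x t = e x t'" using z[of t] z[of T2] by (auto simp: t'_def min_def)
      moreover have "\<bar>e x s - e x t'\<bar> \<le> C * \<bar>s - t'\<bar>" using s st by (intro in_T2) (auto simp: t'_def)
      moreover have "C * \<bar>s - t'\<bar> \<le> C * \<bar>s - t\<bar>" using s st C by (intro mult_left_mono) (auto simp: t'_def)
      ultimately show ?thesis by simp
    next
      case False
      then show ?thesis using z[of s] z[of t] st C by simp
    qed
  qed
  have lipt: "\<bar>e x s - e x t\<bar> \<le> C * \<bar>s - t\<bar>" if "0 \<le> s" "0 \<le> t" for x s t
    using lipt'[of s t x] lipt'[of t s x] that by (cases "s \<le> t") (auto simp: abs_minus_commute)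
  show ?thesis
  proof (rule that[of R C e "\<lambda>x t. D1 (x, t)" "\<lambda>x t. D2 (x, t)"])
    show "0 < R" "0 \<le> C" by fact+
    show "e x t = \<eta> (x, t)" if "0 \<le> t" "t < T" for x t using that by (simp add: e_def)
    show "\<bar>e x t - e y t\<bar> \<le> C * \<bar>x - y\<bar>" if "0 \<le> t" for x y t by (rule lipx[OF that])
    show "\<bar>e x s - e x t\<bar> \<le> C * \<bar>s - t\<bar>" if "0 \<le> s" "0 \<le> t" for x s t by (rule lipt[OF that])
    show "deriv (\<lambda>y. \<eta> (y, t)) x = D1 (x, t)" if "0 < t" "t < T" for x t
      by (rule DERIV_imp_deriv) (use dx that in auto)
    show "deriv (\<lambda>s. \<eta> (x, s)) t = D2 (x, t)" if "0 < t" "t < T" for x t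
      by (rule DERIV_imp_deriv) (use dt' that in auto)
    show "\<exists>d>0. \<forall>a h s. \<bar>a - x\<bar> < d \<longrightarrow> 0 < h \<longrightarrow> h < d \<longrightarrow> \<bar>s - t\<bar> < d \<longrightarrow>
        \<bar>(e (a + h) s - e a s) / h - D1 (x, t)\<bar> < \<epsilon>" if t: "0 < t" "t < T" "0 < \<epsilon>" for x t \<epsilon>
    proof -
      obtain d where d: "0 < d" "\<And>b r. \<bar>b - x\<bar> < 2 * d \<Longrightarrow> \<bar>r - t\<bar> < 2 * d \<Longrightarrow> 0 < r \<and> r < T \<and> \<bar>D1 (b, r) - D1 (x, t)\<bar> < \<epsilon>"
        using close[OF cD1 t] by blast
      have "\<bar>(e (a + h) s - e a s) / h - D1 (x, t)\<bar> < \<epsilon>" if a: "\<bar>a - x\<bar> < d" "0 < h" "h < d" "\<bar>s - t\<bar> < d" for a h s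
      proof -
        have s: "0 < s" "s < T" using d(2)[of x s] a d(1) by auto
        obtain z where z: "a < z" "z < a + h" "\<eta> (a + h, s) - \<eta> (a, s) = (a + h - a) * D1 (z, s)"
          using MVT2[of a "a + h" "\<lambda>y. \<eta> (y, s)" "\<lambda>y. D1 (y, s)"] dx[of s] s a by auto
        then have "(e (a + h) s - e a s) / h = D1 (z, s)" using s a by (simp add: e_def)
        moreover have "\<bar>D1 (z, s) - D1 (x, t)\<bar> < \<epsilon>" using d(2)[of z s] z a by auto
        ultimately show ?thesis by simp
      qed
      then show ?thesis using d(1) by blast
    qed
    show "\<exists>d>0. \<forall>a h s. \<bar>a - x\<bar> < d \<longrightarrow> 0 < h \<longrightarrow> h < d \<longrightarrow> \<bar>s - t\<bar> < d \<longrightarrow>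
        \<bar>(e a (s + h) - e a s) / h - D2 (x, t)\<bar> < \<epsilon>" if t: "0 < t" "t < T" "0 < \<epsilon>" for x t \<epsilon>
    proof -
      obtain d where d: "0 < d" "\<And>b r. \<bar>b - x\<bar> < 2 * d \<Longrightarrow> \<bar>r - t\<bar> < 2 * d \<Longrightarrow> 0 < r \<and> r < T \<and> \<bar>D2 (b, r) - D2 (x, t)\<bar> < \<epsilon>"
        using close[OF cD2 t] by blast
      have "\<bar>(e a (s + h) - e a s) / h - D2 (x, t)\<bar> < \<epsilon>" if a: "\<bar>a - x\<bar> < d" "0 < h" "h < d" "\<bar>s - t\<bar> < d" for a h s
      proof -
        have s: "0 < s" "s < T" using d(2)[of x s] a d(1) by auto
        have s': "0 < s + h" "s + h < T" using d(2)[of x "s + h"] a d(1) by auto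
        obtain z where z: "s < z" "z < s + h" "\<eta> (a, s + h) - \<eta> (a, s) = (s + h - s) * D2 (a, z)"
          using MVT2[of s "s + h" "\<lambda>s. \<eta> (a, s)" "\<lambda>s. D2 (a, s)"] dt'[of _ a] s s' a by auto
        then have "(e a (s + h) - e a s) / h = D2 (a, z)" using s s' a by (simp add: e_def)
        moreover have "\<bar>D2 (a, z) - D2 (x, t)\<bar> < \<epsilon>" using d(2)[of a z] z a by auto
        ultimately show ?thesis by simp
      qed
      then show ?thesis using d(1) by blast
    qed
    show "e x t = 0" if "R < \<bar>x\<bar> \<or> T \<le> t" for x t
      using that zero[of t x] by (auto simp: e_def)
  qed
qed

section \<open>Step functions and summation by parts\<close>

lemma floor_step_measurable [measurable]:
  fixes g :: "int \<Rightarrow> real" and h :: real shows "(\<lambda>x. g \<lfloor>x / h\<rfloor>) \<in> borel_measurable borel"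
proof -
  have "(\<lambda>x::real. \<lfloor>x / h\<rfloor>) \<in> measurable borel (count_space UNIV)" by measurable
  then show ?thesis by (rule measurable_compose) simp
qed

text \<open>
Sums over the lattice are exactly integrals of step functions; passing to the limit becomes
dominated convergence.
\<close>
lemma integral_floor_step:
  fixes g :: "int \<Rightarrow> real"
  assumes h: "0 < h" and F: "finite F" "\<And>i. i \<notin> F \<Longrightarrow> g i = 0"
  shows "(LINT x|lebesgue. g \<lfloor>x / h\<rfloor>) = h * (\<Sum>i\<in>F. g i)"
proof -
  define I where "I i = {h * real_of_int i..<h * real_of_int i + h}" for i
  have mem: "x \<in> I i \<longleftrightarrow> \<lfloor>x / h\<rfloor> = i" for x i
    using h by (auto simp: I_def floor_eq_iff field_simps)
  have "g \<lfloor>x / h\<rfloor> = (\<Sum>i\<in>F. g i * indicator (I i) x)" for x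
  proof -
    have "(\<Sum>i\<in>F. g i * indicator (I i) x) = (\<Sum>i\<in>F. if i = \<lfloor>x / h\<rfloor> then g i else 0)"
      by (rule sum.cong) (auto simp: indicator_def mem)
    then show ?thesis using F by (simp add: sum.delta')
  qed
  then have "(LINT x|lebesgue. g \<lfloor>x / h\<rfloor>) = (LINT x|lebesgue. (\<Sum>i\<in>F. g i * indicator (I i) x))"
    by (intro Bochner_Integration.integral_cong) auto
  also have "\<dots> = (\<Sum>i\<in>F. LINT x|lebesgue. g i * indicator (I i) x)"
  proof (rule Bochner_Integration.integral_sum)
    fix i
    show "integrable lebesgue (\<lambda>x. g i * indicator (I i) x)"
      using h by (intro integrable_mult_right integrable_real_indicator) (auto simp: I_def)
  qed
  also have "\<dots> = (\<Sum>i\<in>F. h * g i)"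
    using h by (intro sum.cong refl) (simp add: I_def)
  finally show ?thesis by (simp add: sum_distrib_left)
qed

lemma dominated_convergence_interval:
  fixes H :: "nat \<Rightarrow> real \<Rightarrow> real"
  assumes Hm: "\<And>k. H k \<in> borel_measurable lebesgue" and N: "finite N"
    and lim: "\<And>t. t \<notin> N \<Longrightarrow> (\<lambda>k. H k t) \<longlonglongrightarrow> L t"
    and bound: "\<And>k t. \<bar>H k t\<bar> \<le> C * indicator {-R..R} t"
  shows "(\<lambda>k. LINT t|lebesgue. H k t) \<longlonglongrightarrow> (LINT t|lebesgue. L t)" "L \<in> borel_measurable lebesgue"
proof -
  have Ns: "N \<in> sets lebesgue" using N by (intro sets_completionI_sets) (simp add: finite_imp_closed)
  have 1: "(\<lambda>t. indicator (- N) t * L t) \<in> borel_measurable lebesgue"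
  proof (rule borel_measurable_LIMSEQ_real)
    show "(\<lambda>k. indicator (- N) t * H k t) \<longlonglongrightarrow> indicator (- N) t * L t" for t
      using lim[of t] by (cases "t \<in> N") (auto intro: tendsto_intros)
    show "(\<lambda>t. indicator (- N) t * H k t) \<in> borel_measurable lebesgue" for k
      using Ns Hm by (intro borel_measurable_times borel_measurable_indicator) (auto intro: Compl_in_sets_lebesgue[THEN iffD2])
  qed
  have 2: "(\<lambda>t. \<Sum>a\<in>N. L a * indicator {a} t) \<in> borel_measurable lebesgue"
    by (intro borel_measurable_sum borel_measurable_times borel_measurable_indicator) auto
  have "L = (\<lambda>t. indicator (- N) t * L t + (\<Sum>a\<in>N. L a * indicator {a} t))"
  proof
    fix t
    have "(\<Sum>a\<in>N. L a * indicator {a} t) = (\<Sum>a\<in>N. if a = t then L a else 0)"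
      by (rule sum.cong) (auto simp: indicator_def)
    then show "L t = indicator (- N) t * L t + (\<Sum>a\<in>N. L a * indicator {a} t)"
      using N by (simp add: indicator_def)
  qed
  also have "\<dots> \<in> borel_measurable lebesgue" by (rule borel_measurable_add[OF 1 2])
  finally show Lm: "L \<in> borel_measurable lebesgue" .
  show "(\<lambda>k. LINT t|lebesgue. H k t) \<longlonglongrightarrow> (LINT t|lebesgue. L t)"
  proof (rule integral_dominated_convergence[where w = "\<lambda>t. C * indicator {-R..R} t"])
    show "integrable lebesgue (\<lambda>t. C * indicator {-R..R} t)"
      by (intro integrable_mult_right integrable_real_indicator) (cases "- R \<le> R"; auto)+
    have "negligible N" using N by (rule negligible_finite)
    then have "AE t in lebesgue. t \<notin> N" by (simp add: negligible_iff_null_sets AE_not_in)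
    then show "AE t in lebesgue. (\<lambda>k. H k t) \<longlonglongrightarrow> L t" by eventually_elim (rule lim)
  qed (use Lm Hm bound in auto)
qed

lemma integral_abs_le_interval:
  fixes H :: "real \<Rightarrow> real"
  assumes "\<And>t. \<bar>H t\<bar> \<le> C * indicator {-R..R} t" "0 \<le> R" "0 \<le> C"
  shows "\<bar>LINT t|lebesgue. H t\<bar> \<le> C * (2 * R)"
proof (cases "integrable lebesgue H")
  case True
  have ind: "integrable lebesgue (\<lambda>t. C * indicator {-R..R} t)"
    using assms by (intro integrable_mult_right integrable_real_indicator) auto
  have "\<bar>LINT t|lebesgue. H t\<bar> \<le> (LINT t|lebesgue. \<bar>H t\<bar>)" by (rule integral_abs_bound)
  also have "\<dots> \<le> (LINT t|lebesgue. C * indicator {-R..R} t)"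
    using True ind assms(1) by (intro integral_mono) auto
  also have "\<dots> = C * (2 * R)" using assms by simp
  finally show ?thesis .
next
  case False
  then show ?thesis using assms by (simp add: not_integrable_integral_eq)
qed

text \<open>
Summation by parts in space. The vanishing of \<open>E\<close> includes \<open>\<bar>i\<bar> = Q\<close>, so that shifting the index
by one does not lose a boundary term.
\<close>
lemma sum_int_shift:
  fixes E \<Phi> :: "int \<Rightarrow> real"
  assumes E: "\<And>i. int Q \<le> \<bar>i\<bar> \<Longrightarrow> E i = 0"
  shows "(\<Sum>i=- int Q..int Q. E i * (\<Phi> i - \<Phi> (i - 1))) = - (\<Sum>i=- int Q..int Q. (E (i + 1) - E i) * \<Phi> i)"
    "(\<Sum>i=- int Q..int Q. E (i + 1) - E i) = 0"
proof -
  have sh: "(\<Sum>i=- int Q..int Q. E i * \<Psi> (i - 1)) = (\<Sum>i=- int Q..int Q. E (i + 1) * \<Psi> i)" for \<Psi> :: "int \<Rightarrow> real"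
  proof -
    have "(\<Sum>i=- int Q..int Q. E (i + 1) * \<Psi> i) = (\<Sum>i\<in>(\<lambda>i. i + 1) ` {- int Q..int Q}. E i * \<Psi> (i - 1))"
      by (subst sum.reindex) (auto simp: inj_on_def)
    also have "\<dots> = (\<Sum>i=- int Q + 1..int Q + 1. E i * \<Psi> (i - 1))" by simp
    also have "\<dots> = (\<Sum>i=- int Q..int Q. E i * \<Psi> (i - 1))"
      by (rule sum.mono_neutral_cong) (use E in auto)
    finally show ?thesis by simp
  qed
  show "(\<Sum>i=- int Q..int Q. E i * (\<Phi> i - \<Phi> (i - 1))) = - (\<Sum>i=- int Q..int Q. (E (i + 1) - E i) * \<Phi> i)"
    by (simp add: right_diff_distrib left_diff_distrib sum_subtractf sh)
  show "(\<Sum>i=- int Q..int Q. E (i + 1) - E i) = 0"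
    using sh[of "\<lambda>_. 1"] by (simp add: sum_subtractf)
qed

text \<open>
Pairing the increments of \<open>f\<close> with \<open>E\<close> at the later time leaves the initial value as the only
boundary term.
\<close>
lemma sum_time_parts:
  fixes E f :: "nat \<Rightarrow> real"
  assumes "E M = 0"
  shows "(\<Sum>n<M. (E (Suc n) - E n) * f n) + E 0 * f 0 = - (\<Sum>n<M. E (Suc n) * (f (Suc n) - f n))"
proof -
  have "(\<Sum>n<M. E (Suc n) * f (Suc n) - E n * f n) = E M * f M - E 0 * f 0"
    by (rule sum_lessThan_telescope)
  moreover have "(\<Sum>n<M. E (Suc n) * f (Suc n) - E n * f n) =
     (\<Sum>n<M. E (Suc n) * (f (Suc n) - f n)) + (\<Sum>n<M. (E (Suc n) - E n) * f n)"
    by (simp add: sum.distrib[symmetric] algebra_simps)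
  ultimately show ?thesis using assms by simp
qed

section \<open>The discrete weak formulation\<close>

text \<open>
In contrast to \<open>near\<close>, this window is centred at the observer, as in the principal value of the
weak formulation.
\<close>
definition close :: "nat \<Rightarrow> real \<Rightarrow> real \<Rightarrow> int \<Rightarrow> int set" where
  "close J h N i = {j \<in> window J. \<bar>h * of_int i - h * of_int j\<bar> < N}"

definition close_flux :: "nat \<Rightarrow> real \<Rightarrow> real \<Rightarrow> (int \<Rightarrow> real) \<Rightarrow> int \<Rightarrow> real" where
  "close_flux J h N g i = h * (\<Sum>j\<in>close J h N i. ang g i j)"

lemma finite_close [simp]: "finite (close J h N i)" by (simp add: close_def)

lemma card_lattice_interval: "h * real (card {j::int. a \<le> h * of_int j \<and> h * of_int j \<le> b}) \<le> b - a + h"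
  "finite {j::int. a \<le> h * of_int j \<and> h * of_int j \<le> b}"
  if h: "0 < h" and ab: "a \<le> b"
proof -
  have eq: "{j::int. a \<le> h * of_int j \<and> h * of_int j \<le> b} = {\<lceil>a / h\<rceil>..\<lfloor>b / h\<rfloor>}"
    using h by (auto simp: ceiling_le_iff le_floor_iff field_simps)
  show "finite {j::int. a \<le> h * of_int j \<and> h * of_int j \<le> b}" unfolding eq by simp
  have "real (card {\<lceil>a / h\<rceil>..\<lfloor>b / h\<rfloor>}) \<le> (b - a) / h + 1"
  proof -
    have 1: "real_of_int \<lfloor>b / h\<rfloor> \<le> b / h" "a / h \<le> real_of_int \<lceil>a / h\<rceil>" by simp_all
    have "0 \<le> (b - a) / h" using h ab by simp
    moreover have "(b - a) / h = b / h - a / h" by (rule diff_divide_distrib)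
    ultimately show ?thesis using diff_mono[OF 1] by (cases "\<lceil>a / h\<rceil> \<le> \<lfloor>b / h\<rfloor>") auto
  qed
  then have "h * real (card {\<lceil>a / h\<rceil>..\<lfloor>b / h\<rfloor>}) \<le> h * ((b - a) / h + 1)" using h by (intro mult_left_mono) auto
  then show "h * real (card {j::int. a \<le> h * of_int j \<and> h * of_int j \<le> b}) \<le> b - a + h"
    unfolding eq using h by (simp add: distrib_left)
qed

text \<open>
For an observer within \<open>r\<close> of the origin the two windows differ only by points whose distance
from the origin is within \<open>r\<close> of \<open>N\<close>. There are at most about \<open>4 * r / h\<close> of them, and each is
seen under an angle of order \<open>1 / N\<close>.
\<close>
lemma centred_window_error:
  assumes h: "0 < h" "h \<le> 1" and r: "0 \<le> r" "\<bar>h * of_int i\<bar> \<le> r" and N: "4 * r + 1 \<le> N"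
    and B: "\<And>i. \<bar>h * g i\<bar> \<le> B"
  shows "\<bar>h * (\<Sum>j\<in>near J h N. ang g i j) - h * (\<Sum>j\<in>close J h N i. ang g i j)\<bar> \<le> 8 * B * (2 * r + 1) / N"
proof -
  let ?A = "near J h N" and ?C = "close J h N i"
  define D where "D = (?A - ?C) \<union> (?C - ?A)"
  define P where "P = {j::int. N - r \<le> h * of_int j \<and> h * of_int j \<le> N + r}"
  define Q where "Q = {j::int. - N - r \<le> h * of_int j \<and> h * of_int j \<le> - N + r}"
  have B0: "0 \<le> B" using B[of 0] by linarith
  have DPQ: "D \<subseteq> P \<union> Q"
  proof
    fix j assume "j \<in> D"
    then have "(\<bar>h * of_int j\<bar> \<le> N) \<noteq> (\<bar>h * of_int i - h * of_int j\<bar> < N)"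
      by (auto simp: D_def near_def close_def)
    then have "N - r \<le> h * of_int j \<and> h * of_int j \<le> N + r \<or> - N - r \<le> h * of_int j \<and> h * of_int j \<le> - N + r"
      using r by linarith
    then show "j \<in> P \<union> Q" by (simp add: P_def Q_def)
  qed
  have ang: "\<bar>ang g i j\<bar> \<le> 4 * B / N" if "j \<in> D" for j
  proof -
    have "N - r \<le> \<bar>h * of_int j\<bar>" using DPQ that r N by (auto simp: P_def Q_def)
    moreover have "h * gap i j = h * of_int i + h / 2 - h * of_int j" by (simp add: gap_def algebra_simps)
    ultimately have g2: "N / 2 \<le> \<bar>h * gap i j\<bar>" using r N h by linarith
    have "\<bar>h * mid g i - h * g j\<bar> \<le> 2 * B"
    proof -
      have "h * mid g i = (h * g i + h * g (i + 1)) / 2" by (simp add: mid_def field_simps)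
      moreover have "\<bar>(a + b) / 2 - d\<bar> \<le> 2 * B" if "\<bar>a\<bar> \<le> B" "\<bar>b\<bar> \<le> B" "\<bar>d\<bar> \<le> B" for a b d :: real
        by (rule abs_leI) (use that[unfolded abs_le_iff] in argo)+
      ultimately show ?thesis using B by metis
    qed
    then have "\<bar>(h * mid g i - h * g j) / (h * gap i j)\<bar> \<le> 2 * B / (N / 2)"
      unfolding abs_divide using g2 r N B0 by (intro frac_le) auto
    moreover have "(h * mid g i - h * g j) / (h * gap i j) = (mid g i - g j) / gap i j"
      using h by (simp add: right_diff_distrib[symmetric])
    moreover have "\<bar>ang g i j\<bar> \<le> \<bar>(mid g i - g j) / gap i j\<bar>"
      unfolding ang_def using arctan_lipschitz_abs[of "(mid g i - g j) / gap i j" 0] by simp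
    ultimately show ?thesis by simp
  qed
  have cardD: "h * real (card D) \<le> 4 * r + 2"
  proof -
    have "card D \<le> card (P \<union> Q)"
      using DPQ card_lattice_interval(2)[OF h(1), of "N - r" "N + r"] card_lattice_interval(2)[OF h(1), of "- N - r" "- N + r"] r
      by (intro card_mono) (auto simp: P_def Q_def)
    also have "\<dots> \<le> card P + card Q" by (rule card_Un_le)
    finally have "real (card D) \<le> real (card P) + real (card Q)" by linarith
    then have "h * real (card D) \<le> h * (real (card P) + real (card Q))" using h by (intro mult_left_mono) auto
    moreover have "h * real (card P) \<le> 2 * r + h" "h * real (card Q) \<le> 2 * r + h"
      using card_lattice_interval(1)[OF h(1), of "N - r" "N + r"] card_lattice_interval(1)[OF h(1), of "- N - r" "- N + r"] r
      by (simp_all add: P_def Q_def)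
    ultimately show ?thesis using h by (simp add: distrib_left)
  qed
  have deq: "(\<Sum>j\<in>?A. ang g i j) - (\<Sum>j\<in>?C. ang g i j) = (\<Sum>j\<in>?A - ?C. ang g i j) - (\<Sum>j\<in>?C - ?A. ang g i j)"
    using sum.Int_Diff[of ?A "ang g i" ?C] sum.Int_Diff[of ?C "ang g i" ?A] by (simp add: Int_commute)
  have 1: "\<bar>(\<Sum>j\<in>?A. ang g i j) - (\<Sum>j\<in>?C. ang g i j)\<bar> \<le> (\<Sum>j\<in>?A - ?C. \<bar>ang g i j\<bar>) + (\<Sum>j\<in>?C - ?A. \<bar>ang g i j\<bar>)"
    unfolding deq using sum_abs[of "ang g i" "?A - ?C"] sum_abs[of "ang g i" "?C - ?A"] by linarith
  have "(\<Sum>j\<in>?A - ?C. \<bar>ang g i j\<bar>) + (\<Sum>j\<in>?C - ?A. \<bar>ang g i j\<bar>) = (\<Sum>j\<in>D. \<bar>ang g i j\<bar>)"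
    unfolding D_def by (subst sum.union_disjoint) auto
  also have "\<dots> \<le> (\<Sum>j\<in>D. 4 * B / N)" by (rule sum_mono) (rule ang)
  also have "\<dots> = real (card D) * (4 * B / N)" by simp
  finally have "\<bar>(\<Sum>j\<in>?A. ang g i j) - (\<Sum>j\<in>?C. ang g i j)\<bar> \<le> real (card D) * (4 * B / N)"
    using 1 by linarith
  then have "h * \<bar>(\<Sum>j\<in>?A. ang g i j) - (\<Sum>j\<in>?C. ang g i j)\<bar> \<le> h * (real (card D) * (4 * B / N))"
    using h by (intro mult_left_mono) auto
  also have "\<dots> = (h * real (card D)) * (4 * B / N)" by simp
  also have "\<dots> \<le> (4 * r + 2) * (4 * B / N)"
    using B0 N r by (intro mult_right_mono cardD divide_nonneg_nonneg) auto
  also have "\<dots> = 8 * B * (2 * r + 1) / N" by (simp add: algebra_simps add_divide_distrib)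
  finally show ?thesis using h by (simp add: right_diff_distrib[symmetric] abs_mult)
qed

text \<open>
Summation by parts in time and space turns the scheme into a weak formulation with two errors.
The viscosity contributes \<open>c * h * kernel_mass J\<close>. The flux from outside the centred window does
not become small, but the space differences \<open>W\<close> of the test function add up to 0; therefore only
its variation over the support matters, and that is of order \<open>1 / N\<close> uniformly in the mesh.
\<close>
lemma discrete_weak_form:
  fixes e :: "real \<Rightarrow> real \<Rightarrow> real" and g :: "int \<Rightarrow> real"
  assumes h: "0 < h" "h \<le> 1" and c: "0 < c" and \<tau>: "\<tau> = h / (3 * c * kernel_mass J)" "\<tau> \<le> 1"
    and B: "\<And>i. \<bar>h * g i\<bar> \<le> B" and v: "\<And>i. \<bar>g (i + 1) - g i\<bar> \<le> 1"
    and e0: "\<And>x t. R < \<bar>x\<bar> \<or> T \<le> t \<Longrightarrow> e x t = 0" and RT: "0 < R" "0 < T"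
    and ex: "\<And>x y t. 0 \<le> t \<Longrightarrow> \<bar>e x t - e y t\<bar> \<le> C * \<bar>x - y\<bar>"
    and N: "4 * (R + 2) + 1 \<le> N"
    and M: "T \<le> real M * \<tau>" "real M * \<tau> \<le> T + 1" and Q: "R < h * real Q" "h * real Q \<le> R + 2"
  shows "\<bar>(\<Sum>n<M. \<tau> * (h * (\<Sum>i=- int Q..int Q.
        (e (h * of_int i) (real (Suc n) * \<tau>) - e (h * of_int i) (real n * \<tau>)) / \<tau> * (h * evolve J g n i))))
      + h * (\<Sum>i=- int Q..int Q. e (h * of_int i) 0 * (h * g i))
      - c * (\<Sum>n<M. \<tau> * (h * (\<Sum>i=- int Q..int Q.
        (e (h * of_int i + h) (real (Suc n) * \<tau>) - e (h * of_int i) (real (Suc n) * \<tau>)) / h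
           * close_flux J h N (evolve J g n) i)))\<bar>
     \<le> (T + 1) * (2 * R + 5) * C * (c * ((128 * B\<^sup>2 + 64 * B * (R + 3) + 16 * B * (2 * R + 5)) / N) + c * h * kernel_mass J)"
proof -
  define H where "H = kernel_mass J"
  have H: "4 \<le> H" unfolding H_def by (rule kernel_mass_ge)
  have \<tau>0: "0 < \<tau>" using h c H by (simp add: \<tau> H_def)
  define E where "E n i = e (h * of_int i) (real n * \<tau>)" for n i
  define f where "f n i = h * evolve J g n i" for n i
  define \<Phi> where "\<Phi> n i = (\<Sum>j\<in>window J. ang (evolve J g n) i j)" for n i
  define \<Phi>n where "\<Phi>n n i = (\<Sum>j\<in>close J h N i. ang (evolve J g n) i j)" for n i
  define \<Phi>f where "\<Phi>f n i = \<Phi> n i - \<Phi>n n i" for n i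
  define V where "V n i = evolve J g n (i + 1) - evolve J g n i" for n i
  define W where "W n i = E (Suc n) (i + 1) - E (Suc n) i" for n i
  let ?I = "{- int Q..int Q}"
  have C0: "0 \<le> C"
  proof -
    have "0 \<le> \<bar>e 1 0 - e 0 0\<bar>" by simp
    also have "\<dots> \<le> C * \<bar>1 - 0\<bar>" by (rule ex) simp
    finally show ?thesis by simp
  qed
  have EQ: "E n i = 0" if "int Q \<le> \<bar>i\<bar>" for n i
  proof -
    have "real Q \<le> \<bar>real_of_int i\<bar>" using that by linarith
    then have "h * real Q \<le> \<bar>h * real_of_int i\<bar>" using h by (simp add: abs_mult)
    then show ?thesis unfolding E_def using e0 Q by auto
  qed
  have EM: "E M i = 0" for i unfolding E_def using e0 M by auto
  have fB: "\<bar>h * evolve J g n i\<bar> \<le> B" for n i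
  proof -
    have "\<bar>g i\<bar> \<le> B / h" for i using B[of i] h by (simp add: abs_mult field_simps)
    then have "\<bar>evolve J g n i\<bar> \<le> B / h" by (rule evolve_bound)
    then show ?thesis using h by (simp add: abs_mult field_simps)
  qed
  have fv: "\<bar>V n i\<bar> \<le> 1" for n i unfolding V_def by (rule evolve_slope[of g, OF v])
  have Wb: "\<bar>W n i\<bar> \<le> C * h" for n i
    using ex[of "real (Suc n) * \<tau>" "h * of_int (i + 1)" "h * of_int i"] \<tau>0 h
    by (simp add: W_def E_def right_diff_distrib[symmetric] abs_mult)
  \<comment> \<open>The scheme in physical units; \<open>h * (1 / (3 * H))\<close> equals \<open>c * \<tau>\<close> by the choice of the time step.\<close>
  have upd: "f (Suc n) i - f n i = c * \<tau> * (\<Phi> n i - \<Phi> n (i - 1)) + h / 6 * (V n i - V n (i - 1))" for n i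
  proof -
    have "c * \<tau> = h * (1 / (3 * H))" using c h H by (simp add: \<tau> H_def)
    then show ?thesis
      by (simp add: f_def step_def H_def \<Phi>_def V_def sum_subtractf algebra_simps)
  qed
  have "(\<Sum>n<M. \<Sum>i\<in>?I. (E (Suc n) i - E n i) * f n i) + (\<Sum>i\<in>?I. E 0 i * f 0 i)
      = (\<Sum>i\<in>?I. (\<Sum>n<M. (E (Suc n) i - E n i) * f n i) + E 0 i * f 0 i)"
    unfolding sum.distrib by (subst sum.swap) simp
  also have "\<dots> = (\<Sum>i\<in>?I. - (\<Sum>n<M. E (Suc n) i * (f (Suc n) i - f n i)))"
    by (intro sum.cong refl sum_time_parts[where E = "\<lambda>n. E n _" and f = "\<lambda>n. f n _"]) (rule EM)
  also have "\<dots> = (\<Sum>n<M. - (\<Sum>i\<in>?I. E (Suc n) i * (f (Suc n) i - f n i)))"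
    unfolding sum_negf by (subst sum.swap) simp
  also have "\<dots> = (\<Sum>n<M. c * \<tau> * (\<Sum>i\<in>?I. W n i * \<Phi> n i) + h / 6 * (\<Sum>i\<in>?I. W n i * V n i))"
  proof (rule sum.cong[OF refl])
    fix n
    have "(\<Sum>i\<in>?I. E (Suc n) i * (f (Suc n) i - f n i)) =
       c * \<tau> * (\<Sum>i\<in>?I. E (Suc n) i * (\<Phi> n i - \<Phi> n (i - 1))) + h / 6 * (\<Sum>i\<in>?I. E (Suc n) i * (V n i - V n (i - 1)))"
      unfolding upd sum_distrib_left sum.distrib[symmetric] by (intro sum.cong refl) (simp add: algebra_simps)
    then show "- (\<Sum>i\<in>?I. E (Suc n) i * (f (Suc n) i - f n i)) =
       c * \<tau> * (\<Sum>i\<in>?I. W n i * \<Phi> n i) + h / 6 * (\<Sum>i\<in>?I. W n i * V n i)"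
      using sum_int_shift(1)[of Q "E (Suc n)" "\<Phi> n"] sum_int_shift(1)[of Q "E (Suc n)" "V n"] EQ
      by (simp add: W_def)
  qed
  finally have main: "(\<Sum>n<M. \<Sum>i\<in>?I. (E (Suc n) i - E n i) * f n i) + (\<Sum>i\<in>?I. E 0 i * f 0 i) =
     (\<Sum>n<M. c * \<tau> * (\<Sum>i\<in>?I. W n i * \<Phi> n i) + h / 6 * (\<Sum>i\<in>?I. W n i * V n i))" .
  define K where "K = (128 * B\<^sup>2 + 64 * B * (R + 3) + 16 * B * (2 * R + 5)) / N"
  have cardI: "h * real (card ?I) \<le> 2 * R + 5"
    using Q h by (simp add: algebra_simps)
  have far: "\<bar>\<Sum>i\<in>?I. W n i * (h * \<Phi>f n i)\<bar> \<le> (2 * R + 5) * C * K" for n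
  proof -
    have "(\<Sum>i\<in>?I. W n i) = 0" unfolding W_def by (rule sum_int_shift(2)) (rule EQ)
    then have "(\<Sum>i\<in>?I. W n i * (h * \<Phi>f n i)) = (\<Sum>i\<in>?I. W n i * (h * \<Phi>f n i)) - (\<Sum>i\<in>?I. W n i) * (h * \<Phi>f n 0)" by simp
    also have "\<dots> = (\<Sum>i\<in>?I. W n i * (h * (\<Phi>f n i - \<Phi>f n 0)))"
      unfolding sum_distrib_right sum_subtractf[symmetric] by (intro sum.cong refl) (simp add: algebra_simps)
    finally have "\<bar>\<Sum>i\<in>?I. W n i * (h * \<Phi>f n i)\<bar> = \<bar>\<Sum>i\<in>?I. W n i * (h * (\<Phi>f n i - \<Phi>f n 0))\<bar>" by (rule arg_cong)
    also have "\<dots> \<le> (\<Sum>i\<in>?I. \<bar>W n i * (h * (\<Phi>f n i - \<Phi>f n 0))\<bar>)" by (rule sum_abs)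
    also have "\<dots> \<le> (\<Sum>i\<in>?I. C * h * K)"
    proof (rule sum_mono)
      fix i assume i: "i \<in> ?I"
      have "\<bar>real_of_int i\<bar> \<le> real Q" using i by (auto simp: abs_le_iff)
      then have "h * \<bar>real_of_int i\<bar> \<le> h * real Q" using h by (intro mult_left_mono) auto
      moreover have "\<bar>h * real_of_int i\<bar> = h * \<bar>real_of_int i\<bar>" using h by (simp add: abs_mult)
      ultimately have "\<bar>h * real_of_int i\<bar> \<le> R + 2" using Q by linarith
      then have xi: "\<bar>h * (real_of_int i + 1 / 2)\<bar> \<le> R + 3" using h by (simp add: distrib_left)
      have x0: "\<bar>h * (real_of_int 0 + 1 / 2)\<bar> \<le> R + 3" using h RT by simp
      have N': "0 < N" "2 * (R + 3) \<le> N" using N RT by auto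
      have 1: "\<bar>h * (\<Sum>j\<in>far J h N. ang (evolve J g n) i j - ang (evolve J g n) 0 j)\<bar> \<le> (128 * B\<^sup>2 + 64 * B * (R + 3)) / N"
        by (rule far_flux_difference[where g = "evolve J g n" and J = J, OF h(1) N' xi x0 fB])
      have 2: "\<bar>h * (\<Sum>j\<in>near J h N. ang (evolve J g n) i j) - h * \<Phi>n n i\<bar> \<le> 8 * B * (2 * (R + 2) + 1) / N"
        unfolding \<Phi>n_def
        by (rule centred_window_error[where g = "evolve J g n", OF h _ _ N fB]) (use RT \<open>\<bar>h * real_of_int i\<bar> \<le> R + 2\<close> in auto)
      have 3: "\<bar>h * (\<Sum>j\<in>near J h N. ang (evolve J g n) 0 j) - h * \<Phi>n n 0\<bar> \<le> 8 * B * (2 * (R + 2) + 1) / N"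
        unfolding \<Phi>n_def
        by (rule centred_window_error[where g = "evolve J g n", OF h _ _ N fB]) (use RT in auto)
      have "h * (\<Phi>f n i - \<Phi>f n 0) = h * (\<Sum>j\<in>far J h N. ang (evolve J g n) i j - ang (evolve J g n) 0 j)
          + (h * (\<Sum>j\<in>near J h N. ang (evolve J g n) i j) - h * \<Phi>n n i)
          - (h * (\<Sum>j\<in>near J h N. ang (evolve J g n) 0 j) - h * \<Phi>n n 0)"
        by (simp add: \<Phi>f_def \<Phi>_def sum_subtractf sum_near_far[of _ J h N] algebra_simps)
      then have "\<bar>h * (\<Phi>f n i - \<Phi>f n 0)\<bar> \<le> (128 * B\<^sup>2 + 64 * B * (R + 3)) / N
          + 8 * B * (2 * (R + 2) + 1) / N + 8 * B * (2 * (R + 2) + 1) / N"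
        using 1 2 3 by linarith
      also have "\<dots> = K" unfolding K_def add_divide_distrib[symmetric] by (rule arg_cong[where f = "\<lambda>x. x / N"]) (simp add: algebra_simps)
      finally have "\<bar>h * (\<Phi>f n i - \<Phi>f n 0)\<bar> \<le> K" .
      then show "\<bar>W n i * (h * (\<Phi>f n i - \<Phi>f n 0))\<bar> \<le> C * h * K"
        unfolding abs_mult[of "W n i"] using Wb[of n i] C0 h by (intro mult_mono) auto
    qed
    also have "\<dots> = (h * real (card ?I)) * (C * K)" by simp
    also have "\<dots> \<le> (2 * R + 5) * (C * K)"
    proof (rule mult_right_mono[OF cardI])
      have "0 \<le> B" using B[of 0] by linarith
      then have "0 \<le> K" unfolding K_def using N RT by (intro divide_nonneg_nonneg add_nonneg_nonneg mult_nonneg_nonneg) auto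
      then show "0 \<le> C * K" using C0 by simp
    qed
    finally show ?thesis by (simp add: mult_ac)
  qed
  have visc: "\<bar>\<Sum>i\<in>?I. W n i * V n i\<bar> \<le> (2 * R + 5) * C" for n
  proof -
    have "\<bar>\<Sum>i\<in>?I. W n i * V n i\<bar> \<le> (\<Sum>i\<in>?I. \<bar>W n i * V n i\<bar>)" by (rule sum_abs)
    also have "\<dots> \<le> (\<Sum>i\<in>?I. C * h * 1)"
      unfolding abs_mult by (intro sum_mono mult_mono Wb fv) (use C0 h in auto)
    also have "\<dots> = (h * real (card ?I)) * C" by simp
    also have "\<dots> \<le> (2 * R + 5) * C" by (rule mult_right_mono[OF cardI C0])
    finally show ?thesis .
  qed
  have split: "\<Phi> n i = \<Phi>n n i + \<Phi>f n i" for n i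
    by (simp add: \<Phi>f_def)
  have diff: "h * ((\<Sum>n<M. \<Sum>i\<in>?I. (E (Suc n) i - E n i) * f n i) + (\<Sum>i\<in>?I. E 0 i * f 0 i))
     - (\<Sum>n<M. c * \<tau> * (\<Sum>i\<in>?I. W n i * (h * \<Phi>n n i)))
     = (\<Sum>n<M. c * \<tau> * (\<Sum>i\<in>?I. W n i * (h * \<Phi>f n i)) + h * (h / 6) * (\<Sum>i\<in>?I. W n i * V n i))"
    unfolding main sum_distrib_left sum_subtractf[symmetric] sum.distrib[symmetric]
    by (intro sum.cong refl) (simp add: split sum.distrib sum_distrib_left algebra_simps)
  \<comment> \<open>The time step is so small, of order \<open>h / H\<close>, that the viscosity per unit of time is of order \<open>h * H\<close>.\<close>
  have hh: "h * (h / 6) \<le> \<tau> * (c * h * H)"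
  proof -
    have "\<tau> * (c * h * H) = h * (h / 3)" using c H by (simp add: \<tau> H_def)
    then show ?thesis using h by simp
  qed
  have "\<bar>\<Sum>n<M. c * \<tau> * (\<Sum>i\<in>?I. W n i * (h * \<Phi>f n i)) + h * (h / 6) * (\<Sum>i\<in>?I. W n i * V n i)\<bar>
     \<le> (\<Sum>n<M. \<bar>c * \<tau> * (\<Sum>i\<in>?I. W n i * (h * \<Phi>f n i)) + h * (h / 6) * (\<Sum>i\<in>?I. W n i * V n i)\<bar>)"
    by (rule sum_abs)
  also have "\<dots> \<le> (\<Sum>n<M. \<tau> * ((2 * R + 5) * C * (c * K + c * h * H)))"
  proof (rule sum_mono)
    fix n
    have "\<bar>c * \<tau> * (\<Sum>i\<in>?I. W n i * (h * \<Phi>f n i)) + h * (h / 6) * (\<Sum>i\<in>?I. W n i * V n i)\<bar>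
      \<le> \<bar>c * \<tau> * (\<Sum>i\<in>?I. W n i * (h * \<Phi>f n i))\<bar> + \<bar>h * (h / 6) * (\<Sum>i\<in>?I. W n i * V n i)\<bar>"
      by (rule abs_triangle_ineq)
    also have "\<dots> = c * \<tau> * \<bar>\<Sum>i\<in>?I. W n i * (h * \<Phi>f n i)\<bar> + h * (h / 6) * \<bar>\<Sum>i\<in>?I. W n i * V n i\<bar>"
      using c \<tau>0 h by (simp add: abs_mult)
    also have "\<dots> \<le> c * \<tau> * ((2 * R + 5) * C * K) + \<tau> * (c * h * H) * ((2 * R + 5) * C)"
    proof (rule add_mono)
      show "c * \<tau> * \<bar>\<Sum>i\<in>?I. W n i * (h * \<Phi>f n i)\<bar> \<le> c * \<tau> * ((2 * R + 5) * C * K)"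
        using c \<tau>0 by (intro mult_left_mono far) auto
      show "h * (h / 6) * \<bar>\<Sum>i\<in>?I. W n i * V n i\<bar> \<le> \<tau> * (c * h * H) * ((2 * R + 5) * C)"
        using c \<tau>0 h H by (intro mult_mono[OF hh visc]) auto
    qed
    also have "\<dots> = \<tau> * ((2 * R + 5) * C * (c * K + c * h * H))" by (simp add: algebra_simps)
    finally show "\<bar>c * \<tau> * (\<Sum>i\<in>?I. W n i * (h * \<Phi>f n i)) + h * (h / 6) * (\<Sum>i\<in>?I. W n i * V n i)\<bar>
      \<le> \<tau> * ((2 * R + 5) * C * (c * K + c * h * H))" .
  qed
  also have "\<dots> = (real M * \<tau>) * ((2 * R + 5) * C * (c * K + c * h * H))" by simp
  also have "\<dots> \<le> (T + 1) * ((2 * R + 5) * C * (c * K + c * h * H))"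
  proof (rule mult_right_mono[OF M(2)])
    have "0 \<le> B" using B[of 0] by linarith
    then have "0 \<le> K" unfolding K_def using N RT by (intro divide_nonneg_nonneg add_nonneg_nonneg mult_nonneg_nonneg) auto
    then show "0 \<le> (2 * R + 5) * C * (c * K + c * h * H)" using C0 c h H RT by simp
  qed
  finally have bound: "\<bar>h * ((\<Sum>n<M. \<Sum>i\<in>?I. (E (Suc n) i - E n i) * f n i) + (\<Sum>i\<in>?I. E 0 i * f 0 i))
     - (\<Sum>n<M. c * \<tau> * (\<Sum>i\<in>?I. W n i * (h * \<Phi>n n i)))\<bar> \<le> (T + 1) * ((2 * R + 5) * C * (c * K + c * h * H))"
    unfolding diff .
  have t1: "(\<Sum>n<M. \<tau> * (h * (\<Sum>i\<in>?I. (e (h * of_int i) (real (Suc n) * \<tau>) - e (h * of_int i) (real n * \<tau>)) / \<tau> * (h * evolve J g n i))))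
     = h * (\<Sum>n<M. \<Sum>i\<in>?I. (E (Suc n) i - E n i) * f n i)"
    unfolding sum_distrib_left using \<tau>0 by (intro sum.cong refl) (simp add: E_def f_def)
  have t0: "(\<Sum>i\<in>?I. e (h * of_int i) 0 * (h * g i)) = (\<Sum>i\<in>?I. E 0 i * f 0 i)"
    by (simp add: E_def f_def)
  have t2: "c * (\<Sum>n<M. \<tau> * (h * (\<Sum>i\<in>?I.
        (e (h * of_int i + h) (real (Suc n) * \<tau>) - e (h * of_int i) (real (Suc n) * \<tau>)) / h
           * close_flux J h N (evolve J g n) i))) = (\<Sum>n<M. c * \<tau> * (\<Sum>i\<in>?I. W n i * (h * \<Phi>n n i)))"
  proof -
    have q: "(e (h * of_int i + h) (real (Suc n) * \<tau>) - e (h * of_int i) (real (Suc n) * \<tau>)) / h * close_flux J h N (evolve J g n) i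
        = W n i * (h * \<Phi>n n i) / h" for n i
      by (simp only: W_def E_def \<Phi>n_def close_flux_def of_int_add of_int_1 distrib_left mult_1_right times_divide_eq_left)
    show ?thesis unfolding q sum_distrib_left using h by (intro sum.cong refl) simp
  qed
  show ?thesis unfolding t1 t0 t2 distrib_left[symmetric] using bound by (simp add: K_def H_def mult_ac)
qed

section \<open>From sums over cells to integrals\<close>

text \<open>
The value is 0 at negative times, where \<open>nat\<close> would otherwise continue the initial cell.
\<close>
definition cellwise :: "(nat \<Rightarrow> int \<Rightarrow> real) \<Rightarrow> real \<Rightarrow> real \<Rightarrow> real \<Rightarrow> real \<Rightarrow> real" where
  "cellwise \<phi> \<tau> h t x = (if t < 0 then 0 else \<phi> (nat \<lfloor>t / \<tau>\<rfloor>) \<lfloor>x / h\<rfloor>)"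

lemma floor_cell: "h * of_int \<lfloor>x / h\<rfloor> \<le> x" "x < h * of_int \<lfloor>x / h\<rfloor> + h" if "0 < h" for x h :: real
proof -
  have "real_of_int \<lfloor>x / h\<rfloor> \<le> x / h" "x / h < real_of_int \<lfloor>x / h\<rfloor> + 1" by linarith+
  then have "h * real_of_int \<lfloor>x / h\<rfloor> \<le> h * (x / h)" "h * (x / h) < h * (real_of_int \<lfloor>x / h\<rfloor> + 1)"
    using that by (intro mult_left_mono mult_strict_left_mono; simp)+
  then show "h * of_int \<lfloor>x / h\<rfloor> \<le> x" "x < h * of_int \<lfloor>x / h\<rfloor> + h" using that by (auto simp: distrib_left)
qed

lemma nat_floor_cell: "\<tau> * real (nat \<lfloor>t / \<tau>\<rfloor>) \<le> t" "t < \<tau> * real (nat \<lfloor>t / \<tau>\<rfloor>) + \<tau>" if "0 < \<tau>" "0 \<le> t" for t \<tau> :: real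
  using floor_cell[OF that(1), of t] that by auto

lemma floor_cell_tendsto:
  fixes h :: "nat \<Rightarrow> real"
  assumes "\<And>k. 0 < h k" "h \<longlonglongrightarrow> 0"
  shows "(\<lambda>k. h k * of_int \<lfloor>x / h k\<rfloor>) \<longlonglongrightarrow> x"
proof (rule LIM_zero_cancel, rule tendsto_0_le[OF assms(2), where K = 1])
  have "\<bar>h k * of_int \<lfloor>x / h k\<rfloor> - x\<bar> \<le> h k" for k using floor_cell[OF assms(1)[of k], of x] by linarith
  then show "\<forall>\<^sub>F k in sequentially. norm (h k * of_int \<lfloor>x / h k\<rfloor> - x) \<le> norm (h k) * 1"
    using assms(1) by (simp add: less_imp_le)
qed

lemma nat_floor_cell_tendsto:
  fixes h :: "nat \<Rightarrow> real"
  assumes "\<And>k. 0 < h k" "h \<longlonglongrightarrow> 0" "0 \<le> x"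
  shows "(\<lambda>k. real (nat \<lfloor>x / h k\<rfloor>) * h k) \<longlonglongrightarrow> x"
proof -
  have "real (nat \<lfloor>x / h k\<rfloor>) * h k = h k * of_int \<lfloor>x / h k\<rfloor>" for k
    using assms(1)[of k] assms(3) by simp
  then show ?thesis using floor_cell_tendsto[OF assms(1,2), of x] by (simp only:)
qed

text \<open>
Dominated convergence is used twice, for the space integral at fixed time and then for the time
integral, since the limit is stated as an iterated integral. The finite set \<open>N\<close> collects times
at which convergence may fail.
\<close>
lemma cellwise_sum_limit:
  fixes \<phi> :: "nat \<Rightarrow> nat \<Rightarrow> int \<Rightarrow> real" and h \<tau> :: "nat \<Rightarrow> real"
  assumes h: "\<And>k. 0 < h k" "\<And>k. h k \<le> 1" and \<tau>: "\<And>k. 0 < \<tau> k"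
    and supp: "\<And>k n i. M k \<le> n \<or> int (Q k) < \<bar>i\<bar> \<Longrightarrow> \<phi> k n i = 0"
    and M: "\<And>k. real (M k) * \<tau> k \<le> T" and Q: "\<And>k. h k * real (Q k) \<le> R" and R: "0 \<le> R" "0 \<le> T"
    and bound: "\<And>k n i. \<bar>\<phi> k n i\<bar> \<le> C"
    and N: "finite N" and lim: "\<And>t x. t \<notin> N \<Longrightarrow> (\<lambda>k. cellwise (\<phi> k) (\<tau> k) (h k) t x) \<longlonglongrightarrow> L t x"
  shows "(\<lambda>k. \<Sum>n<M k. \<tau> k * (h k * (\<Sum>i=- int (Q k)..int (Q k). \<phi> k n i))) \<longlonglongrightarrow> (LINT t|lebesgue. LINT x|lebesgue. L t x)"
proof -
  have C: "0 \<le> C" using bound[of 0 0 0] by linarith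
  define \<psi> where "\<psi> k m = (if m < 0 then 0 else h k * (\<Sum>i=- int (Q k)..int (Q k). \<phi> k (nat m) i))" for k and m :: int
  have neg: "t < 0 \<longleftrightarrow> \<lfloor>t / \<tau> k\<rfloor> < 0" for t k using \<tau>[of k] by (simp add: divide_less_0_iff)
  have inner: "(LINT x|lebesgue. cellwise (\<phi> k) (\<tau> k) (h k) t x) = \<psi> k \<lfloor>t / \<tau> k\<rfloor>" for k t
  proof (cases "t < 0")
    case True then show ?thesis using neg[of t k] by (simp add: cellwise_def \<psi>_def)
  next
    case False
    have "(LINT x|lebesgue. \<phi> k (nat \<lfloor>t / \<tau> k\<rfloor>) \<lfloor>x / h k\<rfloor>) = h k * (\<Sum>i=- int (Q k)..int (Q k). \<phi> k (nat \<lfloor>t / \<tau> k\<rfloor>) i)"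
      by (rule integral_floor_step[OF h(1)]) (use supp in auto)
    then show ?thesis using False neg[of t k] by (simp add: cellwise_def \<psi>_def)
  qed
  have outer: "(LINT t|lebesgue. \<psi> k \<lfloor>t / \<tau> k\<rfloor>) = (\<Sum>n<M k. \<tau> k * (h k * (\<Sum>i=- int (Q k)..int (Q k). \<phi> k n i)))" for k
  proof -
    have "(LINT t|lebesgue. \<psi> k \<lfloor>t / \<tau> k\<rfloor>) = \<tau> k * (\<Sum>m\<in>int ` {..<M k}. \<psi> k m)"
    proof (rule integral_floor_step[OF \<tau>])
      fix m assume m: "m \<notin> int ` {..<M k}"
      show "\<psi> k m = 0"
      proof (cases "m < 0")
        case False
        then have "M k \<le> nat m" using m by (metis image_eqI int_nat_eq lessThan_iff not_le)
        then show ?thesis using supp by (simp add: \<psi>_def)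
      qed (simp add: \<psi>_def)
    qed simp
    also have "(\<Sum>m\<in>int ` {..<M k}. \<psi> k m) = (\<Sum>n<M k. h k * (\<Sum>i=- int (Q k)..int (Q k). \<phi> k n i))"
      by (subst sum.reindex) (auto simp: \<psi>_def)
    finally show ?thesis by (simp add: sum_distrib_left)
  qed
  have cb: "\<bar>cellwise (\<phi> k) (\<tau> k) (h k) t x\<bar> \<le> (C * indicator {- T..T} t) * indicator {- (R + 1)..R + 1} x" for k t x
  proof (cases "cellwise (\<phi> k) (\<tau> k) (h k) t x = 0")
    case True then show ?thesis using C by (simp add: indicator_def)
  next
    case False
    then have t: "0 \<le> t" and nz: "\<phi> k (nat \<lfloor>t / \<tau> k\<rfloor>) \<lfloor>x / h k\<rfloor> \<noteq> 0"
      by (auto simp: cellwise_def split: if_splits)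
    have 1: "nat \<lfloor>t / \<tau> k\<rfloor> < M k" "\<bar>\<lfloor>x / h k\<rfloor>\<bar> \<le> int (Q k)" using supp nz by (meson not_le)+
    have "real (nat \<lfloor>t / \<tau> k\<rfloor>) + 1 \<le> real (M k)" using 1 by linarith
    then have "(real (nat \<lfloor>t / \<tau> k\<rfloor>) + 1) * \<tau> k \<le> real (M k) * \<tau> k" using \<tau>[of k] by (intro mult_right_mono) auto
    then have "t \<le> T" using nat_floor_cell(2)[OF \<tau>[of k] t] M[of k] by (simp add: algebra_simps)
    have "\<bar>real_of_int \<lfloor>x / h k\<rfloor>\<bar> \<le> real (Q k)" using 1(2) by linarith
    then have "h k * \<bar>real_of_int \<lfloor>x / h k\<rfloor>\<bar> \<le> h k * real (Q k)" using h(1)[of k] by (intro mult_left_mono) auto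
    moreover have "\<bar>h k * real_of_int \<lfloor>x / h k\<rfloor>\<bar> = h k * \<bar>real_of_int \<lfloor>x / h k\<rfloor>\<bar>" using h(1)[of k] by (simp add: abs_mult)
    ultimately have "\<bar>h k * real_of_int \<lfloor>x / h k\<rfloor>\<bar> \<le> R" using Q[of k] by linarith
    then have "\<bar>x\<bar> \<le> R + 1" using floor_cell[OF h(1)[of k], of x] h(2)[of k] by linarith
    then have "x \<in> {- (R + 1)..R + 1}" "t \<in> {- T..T}" using \<open>t \<le> T\<close> t by auto
    then show ?thesis using bound t by (simp add: cellwise_def)
  qed
  have cm: "(\<lambda>x. cellwise (\<phi> k) (\<tau> k) (h k) t x) \<in> borel_measurable lebesgue" for k t
    unfolding cellwise_def by (rule borel_imp_lebesgue_measurable) (rule floor_step_measurable)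
  have inner_lim: "(\<lambda>k. \<psi> k \<lfloor>t / \<tau> k\<rfloor>) \<longlonglongrightarrow> (LINT x|lebesgue. L t x)" if "t \<notin> N" for t
    unfolding inner[symmetric]
    by (rule dominated_convergence_interval(1)[where N = "{}", OF cm _ _ cb]) (use lim[OF that] in auto)
  have "(\<lambda>k. LINT t|lebesgue. \<psi> k \<lfloor>t / \<tau> k\<rfloor>) \<longlonglongrightarrow> (LINT t|lebesgue. LINT x|lebesgue. L t x)"
  proof (rule dominated_convergence_interval(1)[OF _ N inner_lim])
    show "(\<lambda>t. \<psi> k \<lfloor>t / \<tau> k\<rfloor>) \<in> borel_measurable lebesgue" for k
      by (rule borel_imp_lebesgue_measurable) (rule floor_step_measurable)
    show "\<bar>\<psi> k \<lfloor>t / \<tau> k\<rfloor>\<bar> \<le> (C * (2 * (R + 1))) * indicator {- T..T} t" for k t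
    proof -
      have "\<bar>LINT x|lebesgue. cellwise (\<phi> k) (\<tau> k) (h k) t x\<bar> \<le> (C * indicator {- T..T} t) * (2 * (R + 1))"
        by (rule integral_abs_le_interval[OF cb]) (use R C in auto)
      then show ?thesis unfolding inner by (simp add: mult_ac)
    qed
  qed
  then show ?thesis unfolding outer .
qed

lemma close_flux_bound:
  assumes "0 < h" "h \<le> 1" "0 \<le> N"
  shows "\<bar>close_flux J h N u i\<bar> \<le> (2 * N + 1) * pi"
proof -
  let ?P = "{j::int. h * of_int i - N \<le> h * of_int j \<and> h * of_int j \<le> h * of_int i + N}"
  have fin: "finite ?P" and cP: "h * real (card ?P) \<le> 2 * N + h"
    using card_lattice_interval[of h "h * of_int i - N" "h * of_int i + N"] assms by auto
  have "card (close J h N i) \<le> card ?P" by (rule card_mono[OF fin]) (auto simp: close_def)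
  then have "h * real (card (close J h N i)) \<le> h * real (card ?P)" using assms by (intro mult_left_mono) auto
  then have c: "h * real (card (close J h N i)) \<le> 2 * N + 1" using cP assms by linarith
  have "\<bar>\<Sum>j\<in>close J h N i. ang u i j\<bar> \<le> (\<Sum>j\<in>close J h N i. \<bar>ang u i j\<bar>)" by (rule sum_abs)
  also have "\<dots> \<le> (\<Sum>j\<in>close J h N i. pi)"
  proof (rule sum_mono)
    fix j show "\<bar>ang u i j\<bar> \<le> pi" using ang_bound[of u i j] pi_ge_zero by linarith
  qed
  also have "\<dots> = real (card (close J h N i)) * pi" by simp
  finally have "h * \<bar>\<Sum>j\<in>close J h N i. ang u i j\<bar> \<le> h * (real (card (close J h N i)) * pi)"
    using assms by (intro mult_left_mono) auto
  also have "\<dots> = (h * real (card (close J h N i))) * pi" by simp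
  also have "\<dots> \<le> (2 * N + 1) * pi" by (rule mult_right_mono[OF c]) simp
  finally show ?thesis using assms by (simp add: close_flux_def abs_mult)
qed

text \<open>
The flux through the centred window is the integral of a step function with values in \<open>[- pi /
2, pi / 2]\<close>, which converges away from the singularity \<open>y = x\<close> and the two ends of the window.
The cut-off \<open>J\<close> is invisible in the limit, because \<open>h * J\<close> tends to infinity.
\<close>
lemma close_flux_limit:
  fixes h :: "nat \<Rightarrow> real" and u :: "nat \<Rightarrow> int \<Rightarrow> real"
  assumes h: "\<And>k. 0 < h k" "\<And>k. h k \<le> 1" "h \<longlonglongrightarrow> 0"
    and J: "filterlim (\<lambda>k. h k * real (J k)) at_top sequentially"
    and v: "\<And>k i. \<bar>u k (i + 1) - u k i\<bar> \<le> 1"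
    and F: "\<And>y. (\<lambda>k. h k * u k \<lfloor>y / h k\<rfloor>) \<longlonglongrightarrow> F y" and N: "0 < N"
  shows "(\<lambda>k. close_flux (J k) (h k) N (u k) \<lfloor>x / h k\<rfloor>) \<longlonglongrightarrow>
    (LINT y|lebesgue. indicator {y. \<bar>x - y\<bar> < N} y * arctan ((F x - F y) / (x - y)))"
proof -
  define q where "q k j = (if j \<in> close (J k) (h k) N \<lfloor>x / h k\<rfloor> then ang (u k) \<lfloor>x / h k\<rfloor> j else 0)" for k j
  have rep: "close_flux (J k) (h k) N (u k) \<lfloor>x / h k\<rfloor> = (LINT y|lebesgue. q k \<lfloor>y / h k\<rfloor>)" for k
  proof -
    have "(LINT y|lebesgue. q k \<lfloor>y / h k\<rfloor>) = h k * (\<Sum>j\<in>close (J k) (h k) N \<lfloor>x / h k\<rfloor>. q k j)"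
      by (rule integral_floor_step[OF h(1)]) (auto simp: q_def)
    then show ?thesis by (simp add: close_flux_def q_def)
  qed
  have cell: "(\<lambda>k. h k * of_int \<lfloor>y / h k\<rfloor>) \<longlonglongrightarrow> y" for y by (rule floor_cell_tendsto[OF h(1,3)])
  have lim: "(\<lambda>k. q k \<lfloor>y / h k\<rfloor>) \<longlonglongrightarrow> indicator {y. \<bar>x - y\<bar> < N} y * arctan ((F x - F y) / (x - y))"
    if y: "y \<notin> {x, x - N, x + N}" for y
  proof -
    have dl: "(\<lambda>k. \<bar>h k * of_int \<lfloor>x / h k\<rfloor> - h k * of_int \<lfloor>y / h k\<rfloor>\<bar>) \<longlonglongrightarrow> \<bar>x - y\<bar>"
      by (intro tendsto_intros cell)
    show ?thesis
    proof (cases "\<bar>x - y\<bar> < N")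
      case True
      have "\<forall>\<^sub>F k in sequentially. \<bar>h k * of_int \<lfloor>x / h k\<rfloor> - h k * of_int \<lfloor>y / h k\<rfloor>\<bar> < N"
        by (rule order_tendstoD(2)[OF dl True])
      moreover have "\<forall>\<^sub>F k in sequentially. \<bar>y\<bar> + 1 \<le> h k * real (J k)"
        using J by (simp add: filterlim_at_top)
      ultimately have ev: "\<forall>\<^sub>F k in sequentially.
          arctan ((h k * mid (u k) \<lfloor>x / h k\<rfloor> - h k * u k \<lfloor>y / h k\<rfloor>) / (h k * gap \<lfloor>x / h k\<rfloor> \<lfloor>y / h k\<rfloor>)) = q k \<lfloor>y / h k\<rfloor>"
      proof eventually_elim
        case (elim k)
        have "\<bar>h k * of_int \<lfloor>y / h k\<rfloor>\<bar> \<le> \<bar>y\<bar> + 1" using floor_cell[OF h(1)[of k], of y] h(2)[of k] by linarith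
        moreover have "\<bar>h k * of_int \<lfloor>y / h k\<rfloor>\<bar> = h k * \<bar>real_of_int \<lfloor>y / h k\<rfloor>\<bar>" using h(1)[of k] by (simp add: abs_mult)
        ultimately have "h k * \<bar>real_of_int \<lfloor>y / h k\<rfloor>\<bar> \<le> h k * real (J k)" using elim(2) by linarith
        then have "\<bar>real_of_int \<lfloor>y / h k\<rfloor>\<bar> \<le> real (J k)" using h(1)[of k] by simp
        then have "\<bar>\<lfloor>y / h k\<rfloor>\<bar> \<le> int (J k)" by linarith
        then have "\<lfloor>y / h k\<rfloor> \<in> close (J k) (h k) N \<lfloor>x / h k\<rfloor>" using elim by (auto simp: close_def window_def)
        then show ?case using h(1)[of k] by (simp add: q_def ang_def right_diff_distrib[symmetric])
      qed
      have m: "(\<lambda>k. h k * mid (u k) \<lfloor>x / h k\<rfloor>) \<longlonglongrightarrow> F x"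
      proof -
        have "(\<lambda>k. h k * ((u k (\<lfloor>x / h k\<rfloor> + 1) - u k \<lfloor>x / h k\<rfloor>) / 2)) \<longlonglongrightarrow> 0"
        proof (rule tendsto_0_le[OF h(3), where K = 1])
          have "\<bar>h k * ((u k (\<lfloor>x / h k\<rfloor> + 1) - u k \<lfloor>x / h k\<rfloor>) / 2)\<bar> \<le> h k * 1" for k
            unfolding abs_mult using v[of k "\<lfloor>x / h k\<rfloor>"] h(1)[of k] by (intro mult_mono) auto
          then show "\<forall>\<^sub>F k in sequentially. norm (h k * ((u k (\<lfloor>x / h k\<rfloor> + 1) - u k \<lfloor>x / h k\<rfloor>) / 2)) \<le> norm (h k) * 1"
            using h(1) by (simp add: less_imp_le)
        qed
        from tendsto_add[OF F[of x] this]
        have "(\<lambda>k. h k * u k \<lfloor>x / h k\<rfloor> + h k * ((u k (\<lfloor>x / h k\<rfloor> + 1) - u k \<lfloor>x / h k\<rfloor>) / 2)) \<longlonglongrightarrow> F x" by simp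
        moreover have "h k * u k i + h k * ((u k (i + 1) - u k i) / 2) = h k * mid (u k) i" for k i
          by (simp add: mid_def field_simps)
        ultimately show ?thesis by simp
      qed
      have gp: "(\<lambda>k. h k * gap \<lfloor>x / h k\<rfloor> \<lfloor>y / h k\<rfloor>) \<longlonglongrightarrow> x - y"
      proof -
        have "(\<lambda>k. h k * of_int \<lfloor>x / h k\<rfloor> - h k * of_int \<lfloor>y / h k\<rfloor> + h k / 2) \<longlonglongrightarrow> x - y + 0 / 2"
          by (intro tendsto_intros cell h) simp
        moreover have "h k * of_int i - h k * of_int j + h k / 2 = h k * gap i j" for k i j
          by (simp add: gap_def algebra_simps)
        ultimately show ?thesis by simp
      qed
      have "(\<lambda>k. arctan ((h k * mid (u k) \<lfloor>x / h k\<rfloor> - h k * u k \<lfloor>y / h k\<rfloor>) / (h k * gap \<lfloor>x / h k\<rfloor> \<lfloor>y / h k\<rfloor>)))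
          \<longlonglongrightarrow> arctan ((F x - F y) / (x - y))"
        by (intro tendsto_arctan tendsto_divide tendsto_diff m F gp) (use y in auto)
      then have "(\<lambda>k. q k \<lfloor>y / h k\<rfloor>) \<longlonglongrightarrow> arctan ((F x - F y) / (x - y))"
        by (rule Lim_transform_eventually[OF _ ev])
      then show ?thesis using True by simp
    next
      case False
      then have "N < \<bar>x - y\<bar>" using y by (auto simp: abs_if split: if_splits)
      then have "\<forall>\<^sub>F k in sequentially. N < \<bar>h k * of_int \<lfloor>x / h k\<rfloor> - h k * of_int \<lfloor>y / h k\<rfloor>\<bar>"
        by (rule order_tendstoD(1)[OF dl])
      then have "\<forall>\<^sub>F k in sequentially. q k \<lfloor>y / h k\<rfloor> = 0"
        by eventually_elim (simp add: q_def close_def)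
      then show ?thesis using False tendsto_eventually by fastforce
    qed
  qed
  show ?thesis
    unfolding rep
  proof (rule dominated_convergence_interval(1)[where N = "{x, x - N, x + N}", OF _ _ lim])
    show "(\<lambda>y. q k \<lfloor>y / h k\<rfloor>) \<in> borel_measurable lebesgue" for k
      by (rule borel_imp_lebesgue_measurable) (rule floor_step_measurable)
    show "\<bar>q k \<lfloor>y / h k\<rfloor>\<bar> \<le> pi / 2 * indicator {- (\<bar>x\<bar> + N + 2)..\<bar>x\<bar> + N + 2} y" for k y
    proof (cases "\<lfloor>y / h k\<rfloor> \<in> close (J k) (h k) N \<lfloor>x / h k\<rfloor>")
      case True
      then have "\<bar>h k * of_int \<lfloor>x / h k\<rfloor> - h k * of_int \<lfloor>y / h k\<rfloor>\<bar> < N" by (simp add: close_def)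
      then have "y \<in> {- (\<bar>x\<bar> + N + 2)..\<bar>x\<bar> + N + 2}"
        using floor_cell[OF h(1)[of k], of y] floor_cell[OF h(1)[of k], of x] h(2)[of k] unfolding atLeastAtMost_iff by linarith
      then show ?thesis using ang_bound[of "u k" "\<lfloor>x / h k\<rfloor>" "\<lfloor>y / h k\<rfloor>"] True by (simp add: q_def)
    qed (simp add: q_def)
  qed simp
qed

text \<open>
Testing the cell averages with a sampled function is the same as testing \<open>f0\<close> with the step
function that takes the sampled values, and this step function converges uniformly.
\<close>
lemma cell_average_limit:
  fixes e0 :: "real \<Rightarrow> real"
  assumes h: "\<And>k. 0 < h k" "\<And>k. h k \<le> 1" "h \<longlonglongrightarrow> 0" and f0: "locally_integrable f0"
    and e0: "\<And>x. R < \<bar>x\<bar> \<Longrightarrow> e0 x = 0" "\<And>x y. \<bar>e0 x - e0 y\<bar> \<le> C * \<bar>x - y\<bar>" and R: "0 < R"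
    and Q: "\<And>k. R < h k * real (Q k)"
  shows "(\<lambda>k. h k * (\<Sum>i=- int (Q k)..int (Q k). e0 (h k * of_int i) * (h k * cell_average f0 (h k) i)))
    \<longlonglongrightarrow> (LINT x|lebesgue. e0 x * f0 x)"
proof -
  define I where "I k i = {h k * real_of_int i<..h k * real_of_int i + h k}" for k and i :: int
  define s where "s k x = (\<Sum>i=- int (Q k)..int (Q k). e0 (h k * of_int i) * indicator (I k i) x)" for k x
  have C: "0 \<le> C" using e0(2)[of 1 0] by simp
  have s: "\<exists>a. s k x = e0 a \<and> \<bar>a - x\<bar> \<le> h k" for k x
  proof -
    \<comment> \<open>The cells of the averages are open on the left, so that \<open>x\<close> lies in the cell with this index and not in the one given by the floor.\<close>
    define c where "c = \<lceil>x / h k\<rceil> - 1"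
    have mem: "x \<in> I k i \<longleftrightarrow> i = c" for i
    proof -
      have "x \<in> I k i \<longleftrightarrow> real_of_int i < x / h k \<and> x / h k \<le> real_of_int i + 1"
        using h(1)[of k] by (auto simp: I_def field_simps)
      also have "\<dots> \<longleftrightarrow> \<lceil>x / h k\<rceil> = i + 1" by (simp add: ceiling_eq_iff)
      also have "\<dots> \<longleftrightarrow> i = c" by (auto simp: c_def)
      finally show ?thesis .
    qed
    have "s k x = (\<Sum>i=- int (Q k)..int (Q k). if i = c then e0 (h k * of_int i) else 0)"
      unfolding s_def by (rule sum.cong) (auto simp: indicator_def mem)
    also have "\<dots> = e0 (h k * of_int c)"
    proof (cases "c \<in> {- int (Q k)..int (Q k)}")
      case False
      then have "int (Q k) \<le> \<bar>c\<bar>" by auto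
      then have "real (Q k) \<le> \<bar>real_of_int c\<bar>" by linarith
      then have "h k * real (Q k) \<le> h k * \<bar>real_of_int c\<bar>" using h(1)[of k] by (intro mult_left_mono) auto
      moreover have "h k * \<bar>real_of_int c\<bar> = \<bar>h k * real_of_int c\<bar>" using h(1)[of k] by (simp add: abs_mult)
      ultimately have "e0 (h k * of_int c) = 0" using e0(1) Q[of k] by auto
      then show ?thesis using False by simp
    qed simp
    finally have "s k x = e0 (h k * of_int c)" .
    moreover have "x \<in> I k c" by (simp add: mem)
    then have "\<bar>h k * of_int c - x\<bar> \<le> h k" by (auto simp: I_def)
    ultimately show ?thesis by blast
  qed
  define K where "K = {- (R + 1)..R + 1}"
  define fK where "fK = (\<lambda>x. indicator K x * f0 x)"
  have fK: "integrable lebesgue fK"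
    unfolding fK_def using f0 by (rule locally_integrable_mult_indicator) (simp add: K_def)
  have eb: "\<bar>e0 x\<bar> \<le> C * (2 * R + 1)" for x
  proof (cases "R < \<bar>x\<bar>")
    case False
    have "\<bar>e0 x - e0 (R + 1)\<bar> \<le> C * \<bar>x - (R + 1)\<bar>" by (rule e0)
    also have "\<dots> \<le> C * (2 * R + 1)" using False R C by (intro mult_left_mono) auto
    finally show ?thesis using e0(1)[of "R + 1"] R by simp
  qed (use e0 C R in auto)
  have sK: "fK x * s k x = f0 x * s k x" for k x
  proof (cases "x \<in> K")
    case False
    obtain a where a: "s k x = e0 a" "\<bar>a - x\<bar> \<le> h k" using s by blast
    have "R < \<bar>a\<bar>" using False a h(2)[of k] by (auto simp: K_def)
    then show ?thesis using a e0 by simp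
  qed (simp add: fK_def)
  have slim: "(\<lambda>k. s k x) \<longlonglongrightarrow> e0 x" for x
  proof (rule LIM_zero_cancel, rule tendsto_0_le[OF h(3), where K = C])
    have "\<bar>s k x - e0 x\<bar> \<le> h k * C" for k
    proof -
      obtain a where a: "s k x = e0 a" "\<bar>a - x\<bar> \<le> h k" using s by blast
      have "\<bar>e0 a - e0 x\<bar> \<le> C * \<bar>a - x\<bar>" by (rule e0)
      also have "\<dots> \<le> C * h k" using a C by (intro mult_left_mono) auto
      finally show ?thesis using a by (simp add: mult.commute)
    qed
    then show "\<forall>\<^sub>F k in sequentially. norm (s k x - e0 x) \<le> norm (h k) * C"
      using h(1) by (simp add: less_imp_le)
  qed
  have sm: "s k \<in> borel_measurable lebesgue" for k
    unfolding s_def I_def by (intro borel_measurable_sum borel_measurable_times borel_measurable_indicator) auto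
  have em: "e0 \<in> borel_measurable lebesgue" by (rule borel_measurable_LIMSEQ_real[OF slim sm])
  have "(\<lambda>k. LINT x|lebesgue. fK x * s k x) \<longlonglongrightarrow> (LINT x|lebesgue. fK x * e0 x)"
  proof (rule integral_dominated_convergence[where w = "\<lambda>x. C * (2 * R + 1) * \<bar>fK x\<bar>"])
    show "AE x in lebesgue. norm (fK x * s k x) \<le> C * (2 * R + 1) * \<bar>fK x\<bar>" for k
    proof (rule AE_I2)
      fix x
      obtain a where "s k x = e0 a" using s by blast
      then have "\<bar>fK x\<bar> * \<bar>s k x\<bar> \<le> \<bar>fK x\<bar> * (C * (2 * R + 1))" using eb[of a] by (intro mult_left_mono) auto
      then show "norm (fK x * s k x) \<le> C * (2 * R + 1) * \<bar>fK x\<bar>" by (simp add: abs_mult mult_ac)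
    qed
    show "AE x in lebesgue. (\<lambda>k. fK x * s k x) \<longlonglongrightarrow> fK x * e0 x"
      by (intro AE_I2 tendsto_mult tendsto_const slim)
    show "integrable lebesgue (\<lambda>x. C * (2 * R + 1) * \<bar>fK x\<bar>)" by (intro integrable_mult_right integrable_abs fK)
  qed (use fK sm em in \<open>auto intro!: borel_measurable_times\<close>)
  moreover have "(\<lambda>x. fK x * e0 x) = (\<lambda>x. e0 x * f0 x)"
  proof
    fix x show "fK x * e0 x = e0 x * f0 x"
    proof (cases "x \<in> K")
      case False
      then have "R < \<bar>x\<bar>" by (auto simp: K_def)
      then show ?thesis using e0 by simp
    qed (simp add: fK_def)
  qed
  moreover have "(LINT x|lebesgue. fK x * s k x) = h k * (\<Sum>i=- int (Q k)..int (Q k). e0 (h k * of_int i) * (h k * cell_average f0 (h k) i))" for k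
  proof -
    have "fK x * s k x = (\<Sum>i=- int (Q k)..int (Q k). e0 (h k * of_int i) * (f0 x * indicator (I k i) x))" for x
    proof -
      have "fK x * s k x = f0 x * s k x" by (rule sK)
      also have "\<dots> = (\<Sum>i=- int (Q k)..int (Q k). e0 (h k * of_int i) * (f0 x * indicator (I k i) x))"
        unfolding s_def sum_distrib_left by (intro sum.cong refl) (simp add: mult_ac)
      finally show ?thesis .
    qed
    then have "(LINT x|lebesgue. fK x * s k x) = (LINT x|lebesgue. (\<Sum>i=- int (Q k)..int (Q k). e0 (h k * of_int i) * (f0 x * indicator (I k i) x)))"
      by (simp only:)
    also have "\<dots> = (\<Sum>i=- int (Q k)..int (Q k). LINT x|lebesgue. e0 (h k * of_int i) * (f0 x * indicator (I k i) x))"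
      unfolding I_def by (rule Bochner_Integration.integral_sum) (intro integrable_mult_right locally_integrable_interval f0)
    also have "\<dots> = (\<Sum>i=- int (Q k)..int (Q k). h k * (e0 (h k * of_int i) * (h k * cell_average f0 (h k) i)))"
      using h(1)[of k] by (intro sum.cong refl) (simp add: cell_average_def I_def power2_eq_square)
    finally show ?thesis by (simp add: sum_distrib_left)
  qed
  ultimately show ?thesis by simp
qed

section \<open>Existence of a weak solution\<close>

text \<open>
First the mesh is refined with \<open>N\<close> fixed, then \<open>N\<close> is sent to infinity. In the discrete weak
formulation the sums converge to integrals, the viscous error vanishes, and an error of order \<open>1
/ N\<close> remains. Letting \<open>N\<close> grow afterwards is precisely the principal value, taken after testing.
\<close>
lemma scheme_limit_weak_solution:
  fixes h \<tau> :: "nat \<Rightarrow> real" and J :: "nat \<Rightarrow> nat" and f :: "real \<Rightarrow> real \<Rightarrow> real"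
  assumes c: "0 < c" and h: "\<And>k. 0 < h k" "\<And>k. h k \<le> 1" "h \<longlonglongrightarrow> 0"
    and \<tau>: "\<And>k. \<tau> k = h k / (3 * c * kernel_mass (J k))" "\<And>k. \<tau> k \<le> 1" "\<tau> \<longlonglongrightarrow> 0"
    and hH: "(\<lambda>k. h k * kernel_mass (J k)) \<longlonglongrightarrow> 0"
    and J: "filterlim (\<lambda>k. h k * real (J k)) at_top sequentially"
    and f0: "locally_integrable f0"
    and B: "\<And>k i. \<bar>h k * cell_average f0 (h k) i\<bar> \<le> B"
    and v: "\<And>k i. \<bar>cell_average f0 (h k) (i + 1) - cell_average f0 (h k) i\<bar> \<le> 1"
    and conv: "\<And>x t. 0 \<le> t \<Longrightarrow>
        (\<lambda>k. h k * evolve (J k) (cell_average f0 (h k)) (nat \<lfloor>t / \<tau> k\<rfloor>) \<lfloor>x / h k\<rfloor>) \<longlonglongrightarrow> f x t"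
    and T: "0 < T" and \<eta>: "\<eta> \<in> Cc_infinity (UNIV \<times> {0..<T})"
  shows "((\<lambda>N::real. LINT t:{0<..<T}|lebesgue. LINT x|lebesgue.
              deriv (\<lambda>y. \<eta> (y, t)) x *
              (c * (LINT a:{a. \<bar>x - a\<bar> < N}|lebesgue. arctan ((f x t - f a t) / (x - a)))))
         \<longlongrightarrow>
           (LINT t:{0<..<T}|lebesgue. LINT x|lebesgue. deriv (\<lambda>s. \<eta> (x, s)) t * f x t)
           + (LINT x|lebesgue. \<eta> (x, 0) * f0 x)) at_top"
proof -
  obtain e ex et :: "real \<Rightarrow> real \<Rightarrow> real" and R C where R: "0 < R" and C: "0 \<le> C"
    and e_eq: "\<And>x t. 0 \<le> t \<Longrightarrow> t < T \<Longrightarrow> e x t = \<eta> (x, t)"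
    and e0: "\<And>x t. R < \<bar>x\<bar> \<or> T \<le> t \<Longrightarrow> e x t = 0"
    and lipx: "\<And>x y t. 0 \<le> t \<Longrightarrow> \<bar>e x t - e y t\<bar> \<le> C * \<bar>x - y\<bar>"
    and lipt: "\<And>x s t. 0 \<le> s \<Longrightarrow> 0 \<le> t \<Longrightarrow> \<bar>e x s - e x t\<bar> \<le> C * \<bar>s - t\<bar>"
    and dex: "\<And>x t. 0 < t \<Longrightarrow> t < T \<Longrightarrow> deriv (\<lambda>y. \<eta> (y, t)) x = ex x t"
    and det: "\<And>x t. 0 < t \<Longrightarrow> t < T \<Longrightarrow> deriv (\<lambda>s. \<eta> (x, s)) t = et x t"
    and qx: "\<And>x t \<epsilon>. 0 < t \<Longrightarrow> t < T \<Longrightarrow> 0 < \<epsilon> \<Longrightarrow> \<exists>d>0. \<forall>a h s. \<bar>a - x\<bar> < d \<longrightarrow> 0 < h \<longrightarrow> h < d \<longrightarrow> \<bar>s - t\<bar> < d \<longrightarrow>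
        \<bar>(e (a + h) s - e a s) / h - ex x t\<bar> < \<epsilon>"
    and qt: "\<And>x t \<epsilon>. 0 < t \<Longrightarrow> t < T \<Longrightarrow> 0 < \<epsilon> \<Longrightarrow> \<exists>d>0. \<forall>a h s. \<bar>a - x\<bar> < d \<longrightarrow> 0 < h \<longrightarrow> h < d \<longrightarrow> \<bar>s - t\<bar> < d \<longrightarrow>
        \<bar>(e a (s + h) - e a s) / h - et x t\<bar> < \<epsilon>"
    by (rule test_function_extension[OF \<eta> T]) (rule that; assumption)
  have H: "4 \<le> kernel_mass (J k)" for k by (rule kernel_mass_ge)
  have \<tau>0: "0 < \<tau> k" for k
  proof -
    have "0 < 3 * c * kernel_mass (J k)" using c H[of k] by (intro mult_pos_pos) auto
    then show ?thesis unfolding \<tau>(1) using h(1)[of k] by (rule divide_pos_pos[rotated])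
  qed
  define g where "g k = cell_average f0 (h k)" for k
  define U where "U k n = evolve (J k) (g k) n" for k n
  define M where "M k = nat \<lceil>T / \<tau> k\<rceil>" for k
  define Q where "Q k = nat \<lceil>R / h k\<rceil> + 1" for k
  have M: "T \<le> real (M k) * \<tau> k" "real (M k) * \<tau> k \<le> T + 1" for k
  proof -
    have "0 < T / \<tau> k" using T \<tau>0[of k] by simp
    then have "0 \<le> \<lceil>T / \<tau> k\<rceil>" by linarith
    then have m: "T / \<tau> k \<le> real (M k)" "real (M k) \<le> T / \<tau> k + 1" unfolding M_def by (simp_all add: ceiling_correct)
    then have "T / \<tau> k * \<tau> k \<le> real (M k) * \<tau> k" "real (M k) * \<tau> k \<le> (T / \<tau> k + 1) * \<tau> k"
      using \<tau>0[of k] by (intro mult_right_mono; simp)+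
    then show "T \<le> real (M k) * \<tau> k" "real (M k) * \<tau> k \<le> T + 1"
      using \<tau>0[of k] \<tau>(2)[of k] by (simp_all add: distrib_right)
  qed
  have Q: "R < h k * real (Q k)" "h k * real (Q k) \<le> R + 2" for k
  proof -
    have "0 < R / h k" using R h(1)[of k] by simp
    then have "0 \<le> \<lceil>R / h k\<rceil>" by linarith
    then have m: "R / h k < real (Q k)" "real (Q k) \<le> R / h k + 2" unfolding Q_def by (simp_all add: ceiling_correct) linarith+
    then have "h k * (R / h k) < h k * real (Q k)" "h k * real (Q k) \<le> h k * (R / h k + 2)"
      using h(1)[of k] by (intro mult_strict_left_mono mult_left_mono; simp)+
    then show "R < h k * real (Q k)" "h k * real (Q k) \<le> R + 2"
      using h(1)[of k] h(2)[of k] by (simp_all add: distrib_left)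
  qed
  have far_i: "R < \<bar>h k * of_int i\<bar>" if "int (Q k) \<le> \<bar>i\<bar>" for k i
  proof -
    have "real (Q k) \<le> \<bar>real_of_int i\<bar>" using that by linarith
    then have "h k * real (Q k) \<le> h k * \<bar>real_of_int i\<bar>" using h(1)[of k] by (intro mult_left_mono) auto
    moreover have "h k * \<bar>real_of_int i\<bar> = \<bar>h k * real_of_int i\<bar>" using h(1)[of k] by (simp add: abs_mult)
    ultimately show ?thesis using Q(1)[of k] by linarith
  qed
  have late: "T \<le> real n * \<tau> k" if "M k \<le> n" for n k
  proof -
    have "real (M k) * \<tau> k \<le> real n * \<tau> k" using that \<tau>0[of k] by (intro mult_right_mono) auto
    then show ?thesis using M(1)[of k] by linarith
  qed
  have UB: "\<bar>h k * U k n i\<bar> \<le> B" for k n i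
  proof -
    have "\<bar>g k i\<bar> \<le> B / h k" for i using B[of k i] h(1)[of k] by (simp add: g_def abs_mult field_simps)
    then have "\<bar>U k n i\<bar> \<le> B / h k" unfolding U_def by (rule evolve_bound)
    then show ?thesis using h(1)[of k] by (simp add: abs_mult field_simps)
  qed
  have Uv: "\<bar>U k n (i + 1) - U k n i\<bar> \<le> 1" for k n i
    unfolding U_def by (rule evolve_slope[of "g k"]) (use v in \<open>simp add: g_def\<close>)
  define Dt where "Dt k n i = (e (h k * of_int i) (real (Suc n) * \<tau> k) - e (h k * of_int i) (real n * \<tau> k)) / \<tau> k" for k n i
  define Dx where "Dx k n i = (e (h k * of_int i + h k) (real (Suc n) * \<tau> k) - e (h k * of_int i) (real (Suc n) * \<tau> k)) / h k" for k n i
  have Dt0: "Dt k n i = 0" if "M k \<le> n \<or> int (Q k) < \<bar>i\<bar>" for k n i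
  proof -
    have "R < \<bar>h k * of_int i\<bar> \<or> T \<le> real m * \<tau> k" if "n \<le> m" for m
    proof (cases "M k \<le> n")
      case True
      then show ?thesis using late[of k m] \<open>n \<le> m\<close> by auto
    next
      case False
      then have "int (Q k) \<le> \<bar>i\<bar>" using \<open>M k \<le> n \<or> int (Q k) < \<bar>i\<bar>\<close> by linarith
      then show ?thesis using far_i by blast
    qed
    from this[of n] this[of "Suc n"]
    have "R < \<bar>h k * of_int i\<bar> \<or> T \<le> real n * \<tau> k" "R < \<bar>h k * of_int i\<bar> \<or> T \<le> real (Suc n) * \<tau> k" by simp_all
    then show ?thesis unfolding Dt_def using e0 by simp
  qed
  have Dx0: "Dx k n i = 0" if "M k \<le> n \<or> int (Q k) < \<bar>i\<bar>" for k n i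
  proof -
    have "h k * of_int i + h k = h k * of_int (i + 1)" by (simp add: distrib_left)
    moreover have "R < \<bar>h k * of_int (i + 1)\<bar> \<or> T \<le> real (Suc n) * \<tau> k"
    proof (cases "M k \<le> n")
      case False
      then have "int (Q k) \<le> \<bar>i + 1\<bar>" using that by linarith
      then show ?thesis using far_i by blast
    qed (use late[of k "Suc n"] in auto)
    moreover have "R < \<bar>h k * of_int i\<bar> \<or> T \<le> real (Suc n) * \<tau> k"
    proof (cases "M k \<le> n")
      case False
      then have "int (Q k) \<le> \<bar>i\<bar>" using that by linarith
      then show ?thesis using far_i by blast
    qed (use late[of k "Suc n"] in auto)
    ultimately show ?thesis unfolding Dx_def using e0 by simp
  qed
  have Dtb: "\<bar>Dt k n i\<bar> \<le> C" for k n i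
    using lipt[of "real (Suc n) * \<tau> k" "real n * \<tau> k" "h k * of_int i"] \<tau>0[of k]
    by (simp add: Dt_def abs_divide divide_le_eq left_diff_distrib[symmetric])
  have Dxb: "\<bar>Dx k n i\<bar> \<le> C" for k n i
    using lipx[of "real (Suc n) * \<tau> k" "h k * of_int i + h k" "h k * of_int i"] \<tau>0[of k] h(1)[of k]
    by (simp add: Dx_def abs_divide divide_le_eq)
  \<comment> \<open>The test function is sampled at the end of the time step and the solution at its beginning; both nodes converge to \<open>t\<close>.\<close>
  have nodes: "(\<lambda>k. real (nat \<lfloor>t / \<tau> k\<rfloor>) * \<tau> k) \<longlonglongrightarrow> t" "(\<lambda>k. real (Suc (nat \<lfloor>t / \<tau> k\<rfloor>)) * \<tau> k) \<longlonglongrightarrow> t" if "0 \<le> t" for t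
  proof -
    show 1: "(\<lambda>k. real (nat \<lfloor>t / \<tau> k\<rfloor>) * \<tau> k) \<longlonglongrightarrow> t" by (rule nat_floor_cell_tendsto[OF \<tau>0 \<tau>(3) that])
    from tendsto_add[OF 1 \<tau>(3)] show "(\<lambda>k. real (Suc (nat \<lfloor>t / \<tau> k\<rfloor>)) * \<tau> k) \<longlonglongrightarrow> t"
      by (simp add: distrib_right add.commute)
  qed
  have cellx: "(\<lambda>k. h k * of_int \<lfloor>x / h k\<rfloor>) \<longlonglongrightarrow> x" for x by (rule floor_cell_tendsto[OF h(1,3)])
  have ev_close: "\<forall>\<^sub>F k in sequentially. \<bar>X k - l\<bar> < d" if "X \<longlonglongrightarrow> l" "0 < d" for X :: "nat \<Rightarrow> real" and l d
    using tendstoD[OF that] by (simp add: dist_real_def)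
  have Dt_lim: "(\<lambda>k. Dt k (nat \<lfloor>t / \<tau> k\<rfloor>) \<lfloor>x / h k\<rfloor>) \<longlonglongrightarrow> et x t" if t: "0 < t" "t < T" for x t
  proof (rule tendstoI)
    fix \<epsilon> :: real assume "0 < \<epsilon>"
    then obtain d where d: "0 < d" "\<And>a h s. \<bar>a - x\<bar> < d \<Longrightarrow> 0 < h \<Longrightarrow> h < d \<Longrightarrow> \<bar>s - t\<bar> < d \<Longrightarrow>
        \<bar>(e a (s + h) - e a s) / h - et x t\<bar> < \<epsilon>" using qt[OF t, of \<epsilon> x] by blast
    show "\<forall>\<^sub>F k in sequentially. dist (Dt k (nat \<lfloor>t / \<tau> k\<rfloor>) \<lfloor>x / h k\<rfloor>) (et x t) < \<epsilon>"
      using ev_close[OF cellx[of x] d(1)] ev_close[OF \<tau>(3) d(1)] ev_close[OF nodes(1)[OF less_imp_le[OF t(1)]] d(1)]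
    proof eventually_elim
      case (elim k)
      have "real (Suc (nat \<lfloor>t / \<tau> k\<rfloor>)) * \<tau> k = real (nat \<lfloor>t / \<tau> k\<rfloor>) * \<tau> k + \<tau> k" by (simp add: distrib_right)
      then show ?case using d(2)[of "h k * of_int \<lfloor>x / h k\<rfloor>" "\<tau> k" "real (nat \<lfloor>t / \<tau> k\<rfloor>) * \<tau> k"] elim \<tau>0[of k]
        by (simp add: Dt_def dist_real_def)
    qed
  qed
  have Dx_lim: "(\<lambda>k. Dx k (nat \<lfloor>t / \<tau> k\<rfloor>) \<lfloor>x / h k\<rfloor>) \<longlonglongrightarrow> ex x t" if t: "0 < t" "t < T" for x t
  proof (rule tendstoI)
    fix \<epsilon> :: real assume "0 < \<epsilon>"
    then obtain d where d: "0 < d" "\<And>a h s. \<bar>a - x\<bar> < d \<Longrightarrow> 0 < h \<Longrightarrow> h < d \<Longrightarrow> \<bar>s - t\<bar> < d \<Longrightarrow>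
        \<bar>(e (a + h) s - e a s) / h - ex x t\<bar> < \<epsilon>" using qx[OF t, of \<epsilon> x] by blast
    show "\<forall>\<^sub>F k in sequentially. dist (Dx k (nat \<lfloor>t / \<tau> k\<rfloor>) \<lfloor>x / h k\<rfloor>) (ex x t) < \<epsilon>"
      using ev_close[OF cellx[of x] d(1)] ev_close[OF h(3) d(1)] ev_close[OF nodes(2)[OF less_imp_le[OF t(1)]] d(1)]
    proof eventually_elim
      case (elim k)
      then show ?case using d(2)[of "h k * of_int \<lfloor>x / h k\<rfloor>" "h k" "real (Suc (nat \<lfloor>t / \<tau> k\<rfloor>)) * \<tau> k"] h(1)[of k]
        by (simp add: Dx_def dist_real_def)
    qed
  qed
  have late_zero: "\<forall>\<^sub>F k in sequentially. \<forall>i. Dt k (nat \<lfloor>t / \<tau> k\<rfloor>) i = 0 \<and> Dx k (nat \<lfloor>t / \<tau> k\<rfloor>) i = 0"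
    if t: "T < t" for t
  proof -
    have "0 \<le> t" using t T by simp
    have "\<forall>\<^sub>F k in sequentially. T < real (nat \<lfloor>t / \<tau> k\<rfloor>) * \<tau> k"
      by (rule order_tendstoD(1)[OF nodes(1)[OF \<open>0 \<le> t\<close>] t])
    then show ?thesis
    proof eventually_elim
      case (elim k)
      have "real (Suc (nat \<lfloor>t / \<tau> k\<rfloor>)) * \<tau> k = real (nat \<lfloor>t / \<tau> k\<rfloor>) * \<tau> k + \<tau> k" by (simp add: distrib_right)
      then have "T \<le> real (Suc (nat \<lfloor>t / \<tau> k\<rfloor>)) * \<tau> k" using elim \<tau>0[of k] by linarith
      then show ?case using elim e0 by (simp add: Dt_def Dx_def)
    qed
  qed
  have T1: "0 \<le> T + 1" "0 \<le> R + 2" using T R by auto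
  define A where "A k = (\<Sum>n<M k. \<tau> k * (h k * (\<Sum>i=- int (Q k)..int (Q k). Dt k n i * (h k * U k n i))))" for k
  define A' where "A' = (LINT t|lebesgue. LINT x|lebesgue. (if 0 < t \<and> t < T then et x t * f x t else 0))"
  have A_lim: "A \<longlonglongrightarrow> A'"
    unfolding A_def A'_def
  proof (rule cellwise_sum_limit[where \<tau> = \<tau> and h = h and N = "{0, T}" and C = "C * B" and T = "T + 1" and R = "R + 2", OF h(1,2) \<tau>0 _ M(2) Q(2) T1(2,1)])
    show "Dt k n i * (h k * U k n i) = 0" if "M k \<le> n \<or> int (Q k) < \<bar>i\<bar>" for k n i
      using Dt0[OF that] by simp
    show "\<bar>Dt k n i * (h k * U k n i)\<bar> \<le> C * B" for k n i
      unfolding abs_mult[of "Dt k n i"] using C by (intro mult_mono Dtb UB) auto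
    show "(\<lambda>k. cellwise (\<lambda>n i. Dt k n i * (h k * U k n i)) (\<tau> k) (h k) t x) \<longlonglongrightarrow>
        (if 0 < t \<and> t < T then et x t * f x t else 0)" if t: "t \<notin> {0, T}" for t x
    proof -
      consider "t < 0" | "0 < t" "t < T" | "T < t" using t by force
      then show ?thesis
      proof cases
        case 2
        then have "(\<lambda>k. Dt k (nat \<lfloor>t / \<tau> k\<rfloor>) \<lfloor>x / h k\<rfloor> * (h k * U k (nat \<lfloor>t / \<tau> k\<rfloor>) \<lfloor>x / h k\<rfloor>)) \<longlonglongrightarrow> et x t * f x t"
          unfolding U_def g_def by (intro tendsto_mult Dt_lim conv) auto
        then show ?thesis using 2 by (simp add: cellwise_def)
      next
        case 3
        have "\<forall>\<^sub>F k in sequentially. cellwise (\<lambda>n i. Dt k n i * (h k * U k n i)) (\<tau> k) (h k) t x = 0"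
          using late_zero[OF 3] by eventually_elim (simp add: cellwise_def)
        then show ?thesis using 3 T tendsto_eventually by fastforce
      qed (simp add: cellwise_def)
    qed
  qed simp
  define I where "I k = h k * (\<Sum>i=- int (Q k)..int (Q k). e (h k * of_int i) 0 * (h k * g k i))" for k
  define I' where "I' = (LINT x|lebesgue. e x 0 * f0 x)"
  have I_lim: "I \<longlonglongrightarrow> I'"
    unfolding I_def I'_def g_def
    by (rule cell_average_limit[where R = R and C = C, OF h f0 _ _ R Q(1)]) (use e0 lipx in auto)
  define \<Phi> where "\<Phi> N x t = (LINT y|lebesgue. indicator {y. \<bar>x - y\<bar> < N} y * arctan ((f x t - f y t) / (x - y)))" for N x t
  define D where "D N k = (\<Sum>n<M k. \<tau> k * (h k * (\<Sum>i=- int (Q k)..int (Q k). Dx k n i * close_flux (J k) (h k) N (U k n) i)))" for N k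
  define D' where "D' N = (LINT t|lebesgue. LINT x|lebesgue. (if 0 < t \<and> t < T then ex x t * \<Phi> N x t else 0))" for N
  have D_lim: "D N \<longlonglongrightarrow> D' N" if N: "0 < N" for N
    unfolding D_def D'_def
  proof (rule cellwise_sum_limit[where \<tau> = \<tau> and h = h and N = "{0, T}" and C = "C * ((2 * N + 1) * pi)" and T = "T + 1" and R = "R + 2", OF h(1,2) \<tau>0 _ M(2) Q(2) T1(2,1)])
    show "Dx k n i * close_flux (J k) (h k) N (U k n) i = 0" if "M k \<le> n \<or> int (Q k) < \<bar>i\<bar>" for k n i
      using Dx0[OF that] by simp
    show "\<bar>Dx k n i * close_flux (J k) (h k) N (U k n) i\<bar> \<le> C * ((2 * N + 1) * pi)" for k n i
      unfolding abs_mult using C N by (intro mult_mono Dxb close_flux_bound h) auto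
    show "(\<lambda>k. cellwise (\<lambda>n i. Dx k n i * close_flux (J k) (h k) N (U k n) i) (\<tau> k) (h k) t x) \<longlonglongrightarrow>
        (if 0 < t \<and> t < T then ex x t * \<Phi> N x t else 0)" if t: "t \<notin> {0, T}" for t x
    proof -
      consider "t < 0" | "0 < t" "t < T" | "T < t" using t by force
      then show ?thesis
      proof cases
        case 2
        have "(\<lambda>k. close_flux (J k) (h k) N (U k (nat \<lfloor>t / \<tau> k\<rfloor>)) \<lfloor>x / h k\<rfloor>) \<longlonglongrightarrow> \<Phi> N x t"
          unfolding \<Phi>_def
          by (rule close_flux_limit[where u = "\<lambda>k. U k (nat \<lfloor>t / \<tau> k\<rfloor>)" and F = "\<lambda>y. f y t", OF h J Uv _ N]) (use 2 conv in \<open>simp add: U_def g_def\<close>)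
        then have "(\<lambda>k. Dx k (nat \<lfloor>t / \<tau> k\<rfloor>) \<lfloor>x / h k\<rfloor> * close_flux (J k) (h k) N (U k (nat \<lfloor>t / \<tau> k\<rfloor>)) \<lfloor>x / h k\<rfloor>) \<longlonglongrightarrow> ex x t * \<Phi> N x t"
          by (intro tendsto_mult Dx_lim 2)
        then show ?thesis using 2 by (simp add: cellwise_def)
      next
        case 3
        have "\<forall>\<^sub>F k in sequentially. cellwise (\<lambda>n i. Dx k n i * close_flux (J k) (h k) N (U k n) i) (\<tau> k) (h k) t x = 0"
          using late_zero[OF 3] by eventually_elim (simp add: cellwise_def)
        then show ?thesis using 3 T tendsto_eventually by fastforce
      qed (simp add: cellwise_def)
    qed
  qed simp
  define K where "K = 128 * B\<^sup>2 + 64 * B * (R + 3) + 16 * B * (2 * R + 5)"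
  define W where "W = (T + 1) * (2 * R + 5) * C"
  have discrete: "\<bar>A k + I k - c * D N k\<bar> \<le> W * (c * (K / N) + c * h k * kernel_mass (J k))" if N: "4 * (R + 2) + 1 \<le> N" for N k
    unfolding A_def I_def D_def Dt_def Dx_def U_def W_def K_def
    by (rule discrete_weak_form[OF h(1,2) c \<tau>(1,2) _ _ e0 R T lipx N M Q])
      (use B v in \<open>simp_all add: g_def\<close>)
  have limit_bound: "\<bar>A' + I' - c * D' N\<bar> \<le> W * c * K * (1 / N)" if N: "4 * (R + 2) + 1 \<le> N" for N
  proof -
    have N0: "0 < N" using N R by simp
    have l: "(\<lambda>k. \<bar>A k + I k - c * D N k\<bar>) \<longlonglongrightarrow> \<bar>A' + I' - c * D' N\<bar>"
      by (intro tendsto_intros A_lim I_lim D_lim N0)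
    have "(\<lambda>k. W * (c * (K / N) + c * (h k * kernel_mass (J k)))) \<longlonglongrightarrow> W * (c * (K / N) + c * 0)"
      by (intro tendsto_intros hH)
    then have r: "(\<lambda>k. W * (c * (K / N) + c * h k * kernel_mass (J k))) \<longlonglongrightarrow> W * c * K * (1 / N)" by (simp add: mult_ac)
    show ?thesis by (rule LIMSEQ_le[OF l r]) (use discrete[OF N] in blast)
  qed
  have lim: "((\<lambda>N. c * D' N) \<longlongrightarrow> A' + I') at_top"
  proof -
    have z: "((\<lambda>N::real. 1 / N) \<longlongrightarrow> 0) at_top"
      by (rule tendsto_divide_0[OF tendsto_const]) (rule filterlim_at_top_imp_at_infinity[OF filterlim_ident])
    have "((\<lambda>N. c * D' N - (A' + I')) \<longlongrightarrow> 0) at_top"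
    proof (rule tendsto_0_le[OF z, where K = "\<bar>W * c * K\<bar>"])
      show "\<forall>\<^sub>F N in at_top. norm (c * D' N - (A' + I')) \<le> norm (1 / N) * \<bar>W * c * K\<bar>"
        using eventually_ge_at_top[of "4 * (R + 2) + 1"]
      proof eventually_elim
        case (elim N)
        have "W * c * K * (1 / N) \<le> \<bar>W * c * K\<bar> * \<bar>1 / N\<bar>" unfolding abs_mult[symmetric] by (rule abs_ge_self)
        then show ?case using limit_bound[OF elim] by (simp add: abs_minus_commute mult.commute)
      qed
    qed
    then show ?thesis by (rule LIM_zero_cancel)
  qed
  have lhs: "(LINT t:{0<..<T}|lebesgue. LINT x|lebesgue.
              deriv (\<lambda>y. \<eta> (y, t)) x *
              (c * (LINT a:{a. \<bar>x - a\<bar> < N}|lebesgue. arctan ((f x t - f a t) / (x - a))))) = c * D' N" for N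
  proof -
    have "(LINT t:{0<..<T}|lebesgue. LINT x|lebesgue.
              deriv (\<lambda>y. \<eta> (y, t)) x *
              (c * (LINT a:{a. \<bar>x - a\<bar> < N}|lebesgue. arctan ((f x t - f a t) / (x - a)))))
      = (LINT t|lebesgue. c * (LINT x|lebesgue. (if 0 < t \<and> t < T then ex x t * \<Phi> N x t else 0)))"
      unfolding set_lebesgue_integral_def
    proof (rule Bochner_Integration.integral_cong[OF refl])
      fix t
      show "indicator {0<..<T} t *\<^sub>R (LINT x|lebesgue. deriv (\<lambda>y. \<eta> (y, t)) x *
              (c * (LINT a|lebesgue. indicator {a. \<bar>x - a\<bar> < N} a *\<^sub>R arctan ((f x t - f a t) / (x - a)))))
        = c * (LINT x|lebesgue. (if 0 < t \<and> t < T then ex x t * \<Phi> N x t else 0))"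
      proof (cases "0 < t \<and> t < T")
        case True
        have "(LINT x|lebesgue. deriv (\<lambda>y. \<eta> (y, t)) x *
              (c * (LINT a|lebesgue. indicator {a. \<bar>x - a\<bar> < N} a *\<^sub>R arctan ((f x t - f a t) / (x - a)))))
          = (LINT x|lebesgue. c * (ex x t * \<Phi> N x t))"
          using True by (intro Bochner_Integration.integral_cong refl) (simp add: dex \<Phi>_def)
        then show ?thesis using True by simp
      next
        case False
        then have "\<not> (0 < t \<and> t < T)" .
        then show ?thesis by (simp only: if_False greaterThanLessThan_iff indicator_simps not_False_eq_True simp_thms) simp
      qed
    qed
    then show ?thesis by (simp add: D'_def)
  qed
  have rhs1: "(LINT t:{0<..<T}|lebesgue. LINT x|lebesgue. deriv (\<lambda>s. \<eta> (x, s)) t * f x t) = A'"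
    unfolding set_lebesgue_integral_def A'_def
  proof (rule Bochner_Integration.integral_cong[OF refl])
    fix t
    show "indicator {0<..<T} t *\<^sub>R (LINT x|lebesgue. deriv (\<lambda>s. \<eta> (x, s)) t * f x t) =
      (LINT x|lebesgue. (if 0 < t \<and> t < T then et x t * f x t else 0))"
      by (cases "0 < t \<and> t < T") (auto simp: det)
  qed
  have rhs2: "(LINT x|lebesgue. \<eta> (x, 0) * f0 x) = I'"
    using e_eq[of 0] T by (simp add: I'_def)
  show ?thesis unfolding lhs rhs1 rhs2 by (rule lim)
qed

text \<open>
With \<open>h\<close> of order \<open>1 / k\<^sup>2\<close> and \<open>J\<close> of order \<open>k ^ 3\<close>, the radius \<open>h * J\<close> of the window grows
like \<open>k\<close>, while \<open>h * kernel_mass J\<close>, which governs the viscosity, is at most of order \<open>1 / sqrt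
k\<close>. The minimum with \<open>c\<close> keeps the time steps below 1.
\<close>
definition mesh :: "real \<Rightarrow> nat \<Rightarrow> real" where "mesh c k = min 1 c / (real k + 1)\<^sup>2"
definition reach :: "nat \<Rightarrow> nat" where "reach k = (k + 1) ^ 3"
definition tick :: "real \<Rightarrow> nat \<Rightarrow> real" where "tick c k = mesh c k / (3 * c * kernel_mass (reach k))"

lemma mesh_facts:
  assumes c: "0 < c"
  shows "0 < mesh c k" "mesh c k \<le> 1" "mesh c \<longlonglongrightarrow> 0"
    "mesh c k * kernel_mass (reach k) \<le> 16" "(\<lambda>k. mesh c k * kernel_mass (reach k)) \<longlonglongrightarrow> 0"
    "filterlim (\<lambda>k. mesh c k * real (reach k)) at_top sequentially"
    "0 < tick c k" "tick c k \<le> 1" "tick c \<longlonglongrightarrow> 0"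
proof -
  have m1: "0 < min 1 c" "min 1 c \<le> 1" using c by auto
  have k1: "1 \<le> (real k + 1)\<^sup>2" for k by (simp add: power2_eq_square algebra_simps)
  show m: "0 < mesh c k" for k using m1 by (simp add: mesh_def)
  show le1: "mesh c k \<le> 1" for k 
  proof -
    have "min 1 c \<le> (real k + 1)\<^sup>2" "0 < (real k + 1)\<^sup>2" using m1(2) k1[of k] by linarith+
    then show ?thesis unfolding mesh_def by (simp only: divide_le_eq_1_pos)
  qed
  have inv0: "(\<lambda>k. 1 / (real k + 1)) \<longlonglongrightarrow> 0"
    using LIMSEQ_inverse_real_of_nat by (simp add: inverse_eq_divide add.commute)
  have mk: "mesh c k \<le> 1 / (real k + 1)" for k
  proof -
    have "mesh c k \<le> 1 / (real k + 1)\<^sup>2" unfolding mesh_def using m1 by (intro divide_right_mono) auto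
    also have "\<dots> \<le> 1 / (real k + 1)" by (simp add: power2_eq_square divide_simps)
    finally show ?thesis .
  qed
  show m0: "mesh c \<longlonglongrightarrow> 0"
    by (rule tendsto_0_le[OF inv0, where K = 1]) (use m mk in \<open>auto simp: less_imp_le\<close>)
  have H: "4 \<le> kernel_mass J" for J by (rule kernel_mass_ge)
  have mH: "mesh c k * kernel_mass (reach k) \<le> 16 * sqrt (1 / (real k + 1))" for k
  proof -
    define a where "a = real k + 1"
    have a: "1 \<le> a" by (simp add: a_def)
    have "1 \<le> a ^ 3" using a by simp
    have "kernel_mass (reach k) \<le> 8 * sqrt (2 * a ^ 3 + 1)"
      using kernel_mass_le[of "reach k"] by (simp add: reach_def a_def add.commute)
    also have "sqrt (2 * a ^ 3 + 1) \<le> sqrt (4 * a ^ 3)" using \<open>1 \<le> a ^ 3\<close> by simp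
    also have "sqrt (4 * a ^ 3) = 2 * a\<^sup>2 * sqrt (1 / a)"
    proof (rule real_sqrt_unique)
      show "(2 * a\<^sup>2 * sqrt (1 / a))\<^sup>2 = 4 * a ^ 3"
      proof -
        have "(sqrt (1 / a))\<^sup>2 = 1 / a" using a by simp
        then have "(2 * a\<^sup>2 * sqrt (1 / a))\<^sup>2 = 4 * (a\<^sup>2)\<^sup>2 * (1 / a)" by (simp only: power_mult_distrib) simp
        then show ?thesis using a by (simp add: power2_eq_square power3_eq_cube)
      qed
      show "0 \<le> 2 * a\<^sup>2 * sqrt (1 / a)" using a by simp
    qed
    finally have "kernel_mass (reach k) \<le> 16 * a\<^sup>2 * sqrt (1 / a)" by simp
    moreover have "mesh c k \<le> 1 / a\<^sup>2" unfolding mesh_def a_def using m1 by (intro divide_right_mono) auto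
    ultimately have "mesh c k * kernel_mass (reach k) \<le> 1 / a\<^sup>2 * (16 * a\<^sup>2 * sqrt (1 / a))"
      using H[of "reach k"] by (intro mult_mono) auto
    then show ?thesis using a by (simp add: a_def)
  qed
  show "mesh c k * kernel_mass (reach k) \<le> 16" for k
  proof -
    have "sqrt (1 / (real k + 1)) \<le> 1" by simp
    then show ?thesis using mH[of k] by linarith
  qed
  have "(\<lambda>k. 16 * sqrt (1 / (real k + 1))) \<longlonglongrightarrow> 16 * sqrt 0" by (intro tendsto_intros inv0)
  then have s0: "(\<lambda>k. 16 * sqrt (1 / (real k + 1))) \<longlonglongrightarrow> 0" by simp
  show "(\<lambda>k. mesh c k * kernel_mass (reach k)) \<longlonglongrightarrow> 0"
  proof (rule tendsto_sandwich[OF _ _ tendsto_const s0])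
    show "\<forall>\<^sub>F k in sequentially. 0 \<le> mesh c k * kernel_mass (reach k)"
      using m H by (intro always_eventually allI mult_nonneg_nonneg) (auto intro: less_imp_le order_trans[of 0 4])
    show "\<forall>\<^sub>F k in sequentially. mesh c k * kernel_mass (reach k) \<le> 16 * sqrt (1 / (real k + 1))"
      using mH by simp
  qed
  have "mesh c k * real (reach k) = min 1 c * (real k + 1)" for k
  proof -
    have r: "real (reach k) = (real k + 1) ^ 3" by (simp add: reach_def add.commute)
    show ?thesis unfolding mesh_def r by (simp add: power2_eq_square power3_eq_cube del: of_nat_Suc)
  qed
  moreover have "filterlim (\<lambda>k. min 1 c * (real k + 1)) at_top sequentially"
  proof (rule filterlim_tendsto_pos_mult_at_top[OF tendsto_const m1(1)])
    show "filterlim (\<lambda>k. real k + 1) at_top sequentially"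
      using filterlim_tendsto_add_at_top[OF tendsto_const filterlim_real_sequentially, of 1] by (simp add: add.commute)
  qed
  ultimately show "filterlim (\<lambda>k. mesh c k * real (reach k)) at_top sequentially" by simp
  have d: "0 < 3 * c * kernel_mass (reach k)" for k using c H[of "reach k"] by (intro mult_pos_pos) auto
  show t: "0 < tick c k" for k unfolding tick_def by (rule divide_pos_pos[OF m d])
  have tm: "tick c k \<le> mesh c k * (1 / c)" for k
  proof -
    have "c \<le> 3 * c * kernel_mass (reach k)" using c H[of "reach k"] by simp
    then have "tick c k \<le> mesh c k / c" unfolding tick_def using m[of k] c d[of k] by (intro divide_left_mono) auto
    then show ?thesis by simp
  qed
  show "tick c k \<le> 1" for k
  proof -
    have "mesh c k \<le> min 1 c / 1" unfolding mesh_def using m1 k1[of k] by (intro divide_left_mono) auto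
    then have "mesh c k \<le> c" by simp
    then have "mesh c k * (1 / c) \<le> 1" using c by simp
    then show ?thesis using tm[of k] by linarith
  qed
  show "tick c \<longlonglongrightarrow> 0"
    by (rule tendsto_0_le[OF m0, where K = "1 / c"]) (use t tm m in \<open>auto simp: less_imp_le abs_of_pos\<close>)
qed

text \<open>
The slope bound controls differences in space, \<open>evolve_time_modulus\<close> those in time; rounding to
the grid costs one more cell in each direction.
\<close>
lemma scheme_modulus:
  assumes c: "0 < c" and B: "\<And>k i. \<bar>mesh c k * g k i\<bar> \<le> B" and v: "\<And>k i. \<bar>g k (i + 1) - g k i\<bar> \<le> 1"
  defines "F \<equiv> \<lambda>k x t. mesh c k * evolve (reach k) (g k) (nat \<lfloor>t / tick c k\<rfloor>) \<lfloor>x / mesh c k\<rfloor>"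
  shows "\<exists>C\<ge>0. \<forall>k x x' t t'. \<bar>x\<bar> \<le> S \<longrightarrow> 0 \<le> t \<longrightarrow> 0 \<le> t' \<longrightarrow> \<bar>t - t'\<bar> + (tick c k + mesh c k) \<le> 1 \<longrightarrow>
        \<bar>F k x t - F k x' t'\<bar> \<le> \<bar>x - x'\<bar> + C * sqrt (\<bar>t - t'\<bar> + (tick c k + mesh c k)) + C * (tick c k + mesh c k)"
proof -
  note mf = mesh_facts[OF c]
  define S' where "S' = \<bar>S\<bar> + 1"
  define C where "C = (2 + c * (pi * (2 * (2 * (S' + 3)) + 1) + (128 * B\<^sup>2 + 64 * B * (S' + 3)) / (2 * (S' + 3)) + 16))"
  have B0: "0 \<le> B" using B[of 0 0] by linarith
  have C0: "0 \<le> C" unfolding C_def S'_def using c B0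
    by (intro add_nonneg_nonneg mult_nonneg_nonneg divide_nonneg_nonneg) auto
  define C' where "C' = max C 3"
  show ?thesis
  proof (intro exI[of _ C'] conjI allI impI)
    show "0 \<le> C'" by (simp add: C'_def)
    fix k x x' t t'
    assume x: "\<bar>x\<bar> \<le> S" and t: "0 \<le> t" "0 \<le> t'" and le: "\<bar>t - t'\<bar> + (tick c k + mesh c k) \<le> 1"
    define h where "h = mesh c k"
    define \<tau> where "\<tau> = tick c k"
    define i where "i = \<lfloor>x / h\<rfloor>"
    define i' where "i' = \<lfloor>x' / h\<rfloor>"
    define n where "n s = nat \<lfloor>s / \<tau>\<rfloor>" for s
    have h: "0 < h" "h \<le> 1" and \<tau>: "0 < \<tau>" using mf by (auto simp: h_def \<tau>_def)
    have xi: "\<bar>h * of_int i\<bar> \<le> S'"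
      using floor_cell[OF h(1), of x] x h unfolding i_def S'_def by linarith
    have time: "\<bar>h * evolve (reach k) (g k) (n b) i - h * evolve (reach k) (g k) (n a) i\<bar> \<le> C * sqrt (\<bar>t - t'\<bar> + \<tau>) + 2 * h"
      if ab: "0 \<le> a" "0 \<le> b" "\<bar>a - b\<bar> = \<bar>t - t'\<bar>" "n a \<le> n b" for a b
    proof -
      have "(real (n b) - real (n a)) * \<tau> \<le> \<bar>t - t'\<bar> + \<tau>"
      proof -
        have "(real (n b) - real (n a)) * \<tau> = \<tau> * real (n b) - \<tau> * real (n a)" by (simp add: algebra_simps)
        then show ?thesis using nat_floor_cell[OF \<tau> ab(1)] nat_floor_cell[OF \<tau> ab(2)] ab(3) unfolding n_def by linarith
      qed
      moreover have "\<bar>t - t'\<bar> + \<tau> \<le> 1" using le h by (simp add: h_def \<tau>_def)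
      ultimately have d: "(real (n b) - real (n a)) * \<tau> \<le> \<bar>t - t'\<bar> + \<tau>" "(real (n b) - real (n a)) * \<tau> \<le> 1" by linarith+
      have "\<bar>h * evolve (reach k) (g k) (n b) i - h * evolve (reach k) (g k) (n a) i\<bar> \<le> C * sqrt ((real (n b) - real (n a)) * \<tau>) + 2 * h"
        unfolding C_def
        by (rule evolve_time_modulus[where L = 16 and J = "reach k" and g = "g k", OF h c _ _ _ v _ xi ab(4) d(2)])
          (use mf(4)[of k] B in \<open>simp_all add: h_def \<tau>_def tick_def S'_def\<close>)
      also have "\<dots> \<le> C * sqrt (\<bar>t - t'\<bar> + \<tau>) + 2 * h"
        using d(1) C0 by (intro add_right_mono mult_left_mono) auto
      finally show ?thesis .
    qed
    have 1: "\<bar>F k x t - F k x t'\<bar> \<le> C * sqrt (\<bar>t - t'\<bar> + \<tau>) + 2 * h"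
    proof (cases "n t \<le> n t'")
      case True
      then show ?thesis using time[of t t'] t
        by (simp add: F_def h_def[symmetric] \<tau>_def[symmetric] i_def[symmetric] n_def[symmetric] abs_minus_commute)
    next
      case False
      then show ?thesis using time[of t' t] t
        by (simp add: F_def h_def[symmetric] \<tau>_def[symmetric] i_def[symmetric] n_def[symmetric] abs_minus_commute)
    qed
    have 2: "\<bar>F k x t' - F k x' t'\<bar> \<le> \<bar>x - x'\<bar> + h"
    proof -
      have "\<bar>evolve (reach k) (g k) (n t') i - evolve (reach k) (g k) (n t') i'\<bar> \<le> \<bar>real_of_int (i - i')\<bar>"
        by (rule slope_bound_imp_lipschitz) (rule evolve_slope[of "g k", OF v])
      then have "h * \<bar>evolve (reach k) (g k) (n t') i - evolve (reach k) (g k) (n t') i'\<bar> \<le> h * \<bar>real_of_int (i - i')\<bar>"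
        using h by (intro mult_left_mono) auto
      also have "\<dots> = \<bar>h * of_int i - h * of_int i'\<bar>" using h by (simp add: right_diff_distrib[symmetric] abs_mult)
      also have "\<dots> \<le> \<bar>x - x'\<bar> + h"
        using floor_cell[OF h(1), of x] floor_cell[OF h(1), of x'] unfolding i_def i'_def by linarith
      finally show ?thesis using h
        by (simp add: F_def h_def[symmetric] \<tau>_def[symmetric] i_def[symmetric] i'_def[symmetric] n_def[symmetric] right_diff_distrib[symmetric] abs_mult)
    qed
    have "\<bar>F k x t - F k x' t'\<bar> \<le> \<bar>x - x'\<bar> + C * sqrt (\<bar>t - t'\<bar> + \<tau>) + 3 * h" using 1 2 by linarith
    also have "\<dots> \<le> \<bar>x - x'\<bar> + C' * sqrt (\<bar>t - t'\<bar> + (\<tau> + h)) + C' * (\<tau> + h)"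
    proof (intro add_mono order_refl)
      show "C * sqrt (\<bar>t - t'\<bar> + \<tau>) \<le> C' * sqrt (\<bar>t - t'\<bar> + (\<tau> + h))"
        using h \<tau> C0 by (intro mult_mono) (auto simp: C'_def)
      show "3 * h \<le> C' * (\<tau> + h)" using h \<tau> by (intro mult_mono) (auto simp: C'_def)
    qed
    finally show "\<bar>F k x t - F k x' t'\<bar> \<le> \<bar>x - x'\<bar> + C' * sqrt (\<bar>t - t'\<bar> + (tick c k + mesh c k)) + C' * (tick c k + mesh c k)"
      by (simp add: h_def \<tau>_def)
  qed
qed

theorem theorem4p1:
  fixes \<rho>1 \<rho>2 :: real and f0 :: "real \<Rightarrow> real"
  assumes "\<rho>2 > \<rho>1"
    and "Linf_norm f0 < \<infinity>"
    and "weakly_differentiable f0"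
    and "Linf_norm (weak_deriv f0) < 1"
  shows "\<exists>f :: real \<Rightarrow> real \<Rightarrow> real.
           muskat_weak_solution \<rho>1 \<rho>2 f0 f \<and>
           (\<forall>T>0. continuous_on (UNIV \<times> {0..T}) (\<lambda>(x, t). f x t) \<and>
                  f \<in> Linf_W1inf T \<and>
                  (\<exists>L. \<forall>t\<in>{0..T}. L-lipschitz_on UNIV (\<lambda>x. f x t)))"
proof -
  define c where "c = (\<rho>2 - \<rho>1) / (2 * pi)"
  have c: "0 < c" using assms(1) by (simp add: c_def)
  note mf = mesh_facts[OF c]
  have wd: "has_weak_deriv f0 (weak_deriv f0)"
    using assms(3) unfolding weakly_differentiable_def weak_deriv_def by (rule someI_ex)
  have f0: "locally_integrable f0" using wd by (simp add: has_weak_deriv_def)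
  have ae1: "AE x in lebesgue. \<bar>weak_deriv f0 x\<bar> \<le> 1"
  proof -
    have "AE x in lebesgue. ereal \<bar>weak_deriv f0 x\<bar> \<le> Linf_norm (weak_deriv f0)" unfolding Linf_norm_def by (rule esssup_AE)
    then show ?thesis
    proof eventually_elim
      case (elim x)
      then have "ereal \<bar>weak_deriv f0 x\<bar> < ereal 1" using assms(4) unfolding one_ereal_def by (rule le_less_trans)
      then show ?case by simp
    qed
  qed
  obtain B where B: "AE x in lebesgue. \<bar>f0 x\<bar> \<le> B"
  proof (cases "Linf_norm f0")
    case (real b)
    have "AE x in lebesgue. ereal \<bar>f0 x\<bar> \<le> Linf_norm f0" unfolding Linf_norm_def by (rule esssup_AE)
    then show ?thesis using that[of b] real by simp
  qed (use assms(2) Linf_norm_not_MInf in auto)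
  define g where "g k = cell_average f0 (mesh c k)" for k
  have gB: "\<bar>mesh c k * g k i\<bar> \<le> B" for k i unfolding g_def by (rule cell_average_bound[OF f0 B mf(1)])
  have gv: "\<bar>g k (i + 1) - g k i\<bar> \<le> 1" for k i unfolding g_def by (rule cell_average_slope[OF wd ae1 mf(1)])
  define F where "F k x t = mesh c k * evolve (reach k) (g k) (nat \<lfloor>t / tick c k\<rfloor>) \<lfloor>x / mesh c k\<rfloor>" for k x t
  have FB: "\<bar>F k x t\<bar> \<le> B" for k x t
  proof -
    have "\<bar>g k i\<bar> \<le> B / mesh c k" for i using gB[of k i] mf(1)[of k] by (simp add: abs_mult field_simps)
    then have "\<bar>evolve (reach k) (g k) (nat \<lfloor>t / tick c k\<rfloor>) \<lfloor>x / mesh c k\<rfloor>\<bar> \<le> B / mesh c k" by (rule evolve_bound)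
    then show ?thesis using mf(1)[of k] by (simp add: F_def abs_mult field_simps)
  qed
  have \<epsilon>0: "(\<lambda>k. tick c k + mesh c k) \<longlonglongrightarrow> 0" using tendsto_add[OF mf(9,3)] by simp
  obtain \<sigma> f where \<sigma>: "strict_mono (\<sigma> :: nat \<Rightarrow> nat)"
    and conv: "\<And>x t. 0 \<le> t \<Longrightarrow> (\<lambda>k. F (\<sigma> k) x t) \<longlonglongrightarrow> f x t"
    and fB: "\<And>x t. 0 \<le> t \<Longrightarrow> \<bar>f x t\<bar> \<le> B"
    and lip: "\<And>x y t. 0 \<le> t \<Longrightarrow> \<bar>f x t - f y t\<bar> \<le> \<bar>x - y\<bar>"
    and cont: "continuous_on (UNIV \<times> {0..}) (\<lambda>(x, t). f x t)"
  proof (rule pointwise_compactness[of F B "\<lambda>k. tick c k + mesh c k"])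
    show "\<exists>C\<ge>0. \<forall>k x x' t t'. \<bar>x\<bar> \<le> S \<longrightarrow> 0 \<le> t \<longrightarrow> 0 \<le> t' \<longrightarrow> \<bar>t - t'\<bar> + (tick c k + mesh c k) \<le> 1 \<longrightarrow>
        \<bar>F k x t - F k x' t'\<bar> \<le> \<bar>x - x'\<bar> + C * sqrt (\<bar>t - t'\<bar> + (tick c k + mesh c k)) + C * (tick c k + mesh c k)" for S
      unfolding F_def by (rule scheme_modulus[where B = B and g = g, OF c gB gv])
    show "0 \<le> tick c k + mesh c k" for k using mf(1,7)[of k] by simp
  qed (use FB \<epsilon>0 that in auto)
  have sub: "(\<lambda>k. X (\<sigma> k)) \<longlonglongrightarrow> l" if "X \<longlonglongrightarrow> l" for X :: "nat \<Rightarrow> real" and l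
    using LIMSEQ_subseq_LIMSEQ[OF that \<sigma>] by (simp add: o_def)
  have weak: "muskat_weak_solution \<rho>1 \<rho>2 f0 f"
    unfolding muskat_weak_solution_def c_def[symmetric]
  proof (intro allI impI ballI)
    fix T :: real and \<eta> :: "real \<times> real \<Rightarrow> real" assume T: "0 < T" and \<eta>: "\<eta> \<in> Cc_infinity (UNIV \<times> {0..<T})"
    show "((\<lambda>N::real. LINT t:{0<..<T}|lebesgue. LINT x|lebesgue.
              deriv (\<lambda>y. \<eta> (y, t)) x *
              (c * (LINT a:{a. \<bar>x - a\<bar> < N}|lebesgue. arctan ((f x t - f a t) / (x - a)))))
         \<longlongrightarrow>
           (LINT t:{0<..<T}|lebesgue. LINT x|lebesgue. deriv (\<lambda>s. \<eta> (x, s)) t * f x t)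
           + (LINT x|lebesgue. \<eta> (x, 0) * f0 x)) at_top"
    proof (rule scheme_limit_weak_solution[where h = "\<lambda>k. mesh c (\<sigma> k)" and \<tau> = "\<lambda>k. tick c (\<sigma> k)" and J = "\<lambda>k. reach (\<sigma> k)" and B = B,
          OF c mf(1,2) sub[OF mf(3)] _ mf(8) sub[OF mf(9)] sub[OF mf(5)] _ f0 _ _ _ T \<eta>])
      show "filterlim (\<lambda>k. mesh c (\<sigma> k) * real (reach (\<sigma> k))) at_top sequentially"
        by (rule filterlim_compose[OF mf(6)]) (rule filterlim_subseq[OF \<sigma>])
      show "(\<lambda>k. mesh c (\<sigma> k) * evolve (reach (\<sigma> k)) (cell_average f0 (mesh c (\<sigma> k))) (nat \<lfloor>t / tick c (\<sigma> k)\<rfloor>) \<lfloor>x / mesh c (\<sigma> k)\<rfloor>) \<longlonglongrightarrow> f x t"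
        if "0 \<le> t" for x t using conv[OF that, of x] by (simp add: F_def g_def)
    qed (use gB gv in \<open>simp_all add: tick_def g_def\<close>)
  qed
  have "continuous_on (UNIV \<times> {0..T}) (\<lambda>(x, t). f x t)" for T
    by (rule continuous_on_subset[OF cont]) auto
  moreover have "f \<in> Linf_W1inf T" for T
    using calculation lip fB by (rule lipschitz_in_x_imp_Linf_W1inf)
  moreover have "\<exists>L. \<forall>t\<in>{0..T}. L-lipschitz_on UNIV (\<lambda>x. f x t)" for T
    by (rule exI[of _ 1]) (use lip in \<open>auto intro!: lipschitz_onI simp: dist_real_def\<close>)
  ultimately show ?thesis using weak by blast
qed

end
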